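(* Let $n\ge 1$ and let $k$ be a field whose characteristic does not divide $n!$. Let $k\mathcal F$ be the face semigroup algebra of the reflection arrangement of the symmetric group $\mathcal S_n$ acting on $\mathbb R^n$ by permuting coordinates, and let $(k\mathcal F)^{\mathcal S_n}$ be its $\mathcal S_n$-invariant subalgebra. The quiver of $(k\mathcal F)^{\mathcal S_n}$ is the directed graph with one vertex $\nu_p$ for each integer partition $p$ of $n$, and exactly one arrow $\nu_p\to\nu_q$ if and only if $q$ is obtained from $p$ by adding two distinct elements of $p$ (and no arrow $\nu_p\to\nu_q$ otherwise).
   Context: The reflection arrangement of $\mathcal S_n$ is the braid arrangement $\mathcal A$ in $V=\mathbb R^n$, consisting of the hyperplanes $H_{ij}=\{\vec v: v_i=v_j\}$, $1\le i<j\le n$; $\omega\in\mathcal S_n$ acts by $\omega(v_1,\dots,v_n)=(v_{\omega^{-1}(1)},\dots,v_{\omega^{-1}(n)})$. Face semigroup algebra. For each $H\in\mathcal A$ let $H^+,H^-$ be the two open half spaces determined by $H$ (labels fixed arbitrarily) and $H^0=H$. A face is a non-empty intersection $x=\bigcap_{H\in\mathcal A}H^{\sigma_H(x)}$ with $\sigma_H(x)\in\{+,0,-\}$. The set $\mathcal F$ of faces is a semigroup with identity: $xy$ is the face with $\sigma_H(xy)=\sigma_H(x)$ if $\sigma_H(x)\ne 0$ and $\sigma_H(xy)=\sigma_H(y)$ if $\sigma_H(x)=0$. $k\mathcal F$ is its semigroup algebra over $k$. The group acts on $\mathcal F$, hence by algebra automorphisms on $k\mathcal F$, and $(k\mathcal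 F)^{\mathcal S_n}$ is the subalgebra of elements fixed by all of $\mathcal S_n$. Integer partitions. An integer partition of $n$ is a collection (multiset) of positive integers that sum to $n$. "$q$ is obtained from $p$ by adding two distinct elements of $p$" means that $q$ is obtained by replacing two elements $p_i\neq p_j$ (of different values) of $p$ by the single element $p_i+p_j$. Quivers. A finite dimensional $k$-algebra $A$ is split basic if $A/\operatorname{rad}(A)$ is isomorphic to a direct product of copies of $k$; the algebra $(k\mathcal F)^{\mathcal S_n}$ is split basic. The quiver of a split basic algebra $A$ is the directed graph defined from any complete system of primitive orthogonal idempotents $\{e_v:v\in\mathcal V\}$ (pairwise orthogonal primitive idempotents summing to $1$): it has one vertex $v$ for each $e_v$, and the number of arrows from $x$ to $y$ is $\dim_k e_y\big(\operatorname{rad}(A)/\operatorname{rad}^2(A)\big)e_x$. It does not depend on the chosen system, up to isomorphism of directed graphs. *)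

theory Defs
  imports
    "HOL-Analysis.Analysis"
    "HOL-Algebra.Algebra"
    "HOL-Combinatorics.Permutations"
    "HOL-Library.Multiset"
    "Graph_Theory.Digraph_Isomorphism"
begin

section \<open>Fields and finite dimensional algebras\<close>

text \<open>The additive order of \<open>1\<close>; \<^const>\<open>group.ord\<close> is \<open>0\<close> for elements of infinite order,
  so this is \<open>0\<close> in characteristic zero.\<close>

definition ring_characteristic :: "('a, 'm) ring_scheme \<Rightarrow> nat" where
  "ring_characteristic R = group.ord (add_monoid R) \<one>\<^bsub>R\<^esub>"

text \<open>An associative unital algebra; the library's \<^locale>\<open>algebra\<close> is for commutative ones.\<close>

definition assoc_algebra :: "('k, 'm) ring_scheme \<Rightarrow> ('k, 'a) module \<Rightarrow> bool" where
  "assoc_algebra k A \<longleftrightarrow> ring A \<and> module k A \<and>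
    (\<forall>c \<in> carrier k. \<forall>a \<in> carrier A. \<forall>b \<in> carrier A.
      (c \<odot>\<^bsub>A\<^esub> a) \<otimes>\<^bsub>A\<^esub> b = c \<odot>\<^bsub>A\<^esub> (a \<otimes>\<^bsub>A\<^esub> b) \<and>
      a \<otimes>\<^bsub>A\<^esub> (c \<odot>\<^bsub>A\<^esub> b) = c \<odot>\<^bsub>A\<^esub> (a \<otimes>\<^bsub>A\<^esub> b))"

text \<open>The image \<open>k\<cdot>1\<close> of the base field. The library's dimension theory
  (\<^const>\<open>ring.dimension\<close>) is for subspaces of a ring over a subfield of that ring, so
  dimensions over \<open>k\<close> are expressed as dimensions over \<open>k\<cdot>1\<close> or its image in a quotient.\<close>

definition scalars :: "('k, 'm) ring_scheme \<Rightarrow> ('k, 'a) module \<Rightarrow> 'a set" where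
  "scalars k A = (\<lambda>c. c \<odot>\<^bsub>A\<^esub> \<one>\<^bsub>A\<^esub>) ` carrier k"

definition left_ideal :: "'a set \<Rightarrow> ('a, 'm) ring_scheme \<Rightarrow> bool" where
  "left_ideal L A \<longleftrightarrow> additive_subgroup L A \<and> (\<forall>a \<in> carrier A. \<forall>l \<in> L. a \<otimes>\<^bsub>A\<^esub> l \<in> L)"

definition maximal_left_ideal :: "'a set \<Rightarrow> ('a, 'm) ring_scheme \<Rightarrow> bool" where
  "maximal_left_ideal L A \<longleftrightarrow> left_ideal L A \<and> L \<noteq> carrier A \<and>
    (\<forall>L'. left_ideal L' A \<longrightarrow> L \<subseteq> L' \<longrightarrow> L' = L \<or> L' = carrier A)"

definition jacobson_radical :: "('a, 'm) ring_scheme \<Rightarrow> 'a set" where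
  "jacobson_radical A = {a \<in> carrier A. \<forall>L. maximal_left_ideal L A \<longrightarrow> a \<in> L}"

text \<open>The isomorphism \<open>\<phi> : A/rad(A) \<rightarrow> k\<^sup>m\<close> is required to be one of \<open>k\<close>-algebras; the last conjunct
  is its \<open>k\<close>-linearity.\<close>

definition split_basic :: "('k, 'm) ring_scheme \<Rightarrow> ('k, 'a) module \<Rightarrow> bool" where
  "split_basic k A \<longleftrightarrow>
    assoc_algebra k A \<and> ring.finite_dimension A (scalars k A) (carrier A) \<and>
    (\<exists>m :: nat. \<exists>\<phi> \<in> ring_iso (A Quot jacobson_radical A) (RDirProd_list (replicate m k)).
      \<forall>c \<in> carrier k. \<forall>a \<in> carrier A.
        \<phi> (jacobson_radical A +>\<^bsub>A\<^esub> (c \<odot>\<^bsub>A\<^esub> a)) =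
          map (\<lambda>t. c \<otimes>\<^bsub>k\<^esub> t) (\<phi> (jacobson_radical A +>\<^bsub>A\<^esub> a)))"

section \<open>The quiver of a split basic algebra\<close>

definition idempotent_elem :: "('a, 'm) ring_scheme \<Rightarrow> 'a \<Rightarrow> bool" where
  "idempotent_elem A e \<longleftrightarrow> e \<in> carrier A \<and> e \<otimes>\<^bsub>A\<^esub> e = e"

definition primitive_idempotent :: "('a, 'm) ring_scheme \<Rightarrow> 'a \<Rightarrow> bool" where
  "primitive_idempotent A e \<longleftrightarrow> idempotent_elem A e \<and> e \<noteq> \<zero>\<^bsub>A\<^esub> \<and>
    \<not> (\<exists>f g. idempotent_elem A f \<and> idempotent_elem A g \<and> f \<noteq> \<zero>\<^bsub>A\<^esub> \<and> g \<noteq> \<zero>\<^bsub>A\<^esub> \<and>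
        f \<otimes>\<^bsub>A\<^esub> g = \<zero>\<^bsub>A\<^esub> \<and> g \<otimes>\<^bsub>A\<^esub> f = \<zero>\<^bsub>A\<^esub> \<and> e = f \<oplus>\<^bsub>A\<^esub> g)"

text \<open>Orthogonal nonzero idempotents are distinct, so a system can be given as a set, which then
  also serves as the vertex set of the quiver.\<close>

definition complete_primitive_system :: "('a, 'm) ring_scheme \<Rightarrow> 'a set \<Rightarrow> bool" where
  "complete_primitive_system A E \<longleftrightarrow> finite E \<and> (\<forall>e \<in> E. primitive_idempotent A e) \<and>
    (\<forall>e \<in> E. \<forall>f \<in> E. e \<noteq> f \<longrightarrow> e \<otimes>\<^bsub>A\<^esub> f = \<zero>\<^bsub>A\<^esub>) \<and>
    finsum A (\<lambda>e. e) E = \<one>\<^bsub>A\<^esub>"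

text \<open>The dimension of \<open>f (rad(A)/rad\<^sup>2(A)) e\<close>, taken inside \<open>A/rad\<^sup>2(A)\<close>.\<close>

definition arrow_number :: "('k, 'm) ring_scheme \<Rightarrow> ('k, 'a) module \<Rightarrow> 'a \<Rightarrow> 'a \<Rightarrow> nat" where
  "arrow_number k A e f =
    (let J = jacobson_radical A; J2 = ideal_prod A J J in
      ring.dim (A Quot J2) ((\<lambda>c. J2 +>\<^bsub>A\<^esub> c) ` scalars k A)
        ((\<lambda>r. J2 +>\<^bsub>A\<^esub> (f \<otimes>\<^bsub>A\<^esub> r \<otimes>\<^bsub>A\<^esub> e)) ` J))"

definition quiver_of_system ::
    "('k, 'm) ring_scheme \<Rightarrow> ('k, 'a) module \<Rightarrow> 'a set \<Rightarrow> ('a, 'a \<times> 'a \<times> nat) pre_digraph" where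
  "quiver_of_system k A E =
    \<lparr> verts = E,
      arcs = {(e, f, i). e \<in> E \<and> f \<in> E \<and> i < arrow_number k A e f},
      tail = (\<lambda>(e, f, i). e),
      head = (\<lambda>(e, f, i). f) \<rparr>"

text \<open>\<open>G\<close> is, up to isomorphism, the quiver of the algebra \<open>A\<close>: \<open>A\<close> is split basic, so that its
  quiver is defined, and every complete system (of which there is one) computes \<open>G\<close>.\<close>

definition has_quiver ::
    "('k, 'm) ring_scheme \<Rightarrow> ('k, 'a) module \<Rightarrow> ('v, 'e) pre_digraph \<Rightarrow> bool" where
  "has_quiver k A G \<longleftrightarrow> split_basic k A \<and>
    (\<exists>E. complete_primitive_system A E) \<and>
    (\<forall>E. complete_primitive_system A E \<longrightarrow> digraph_iso (quiver_of_system k A E) G)"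

section \<open>Faces of the braid arrangement\<close>

text \<open>Coordinates are indexed by an arbitrary finite linearly ordered type \<open>'n\<close>; the order only
  serves to list each hyperplane once, as \<open>H\<^sub>i\<^sub>j\<close> with \<open>i < j\<close>, and to label its half spaces.\<close>

type_synonym 'n region = "(real, 'n) vec set"

datatype side = Plus | Zero | Minus

fun half_space :: "'n \<Rightarrow> 'n \<Rightarrow> side \<Rightarrow> ('n::{finite,linorder}) region" where
  "half_space i j Plus = {v. v $ i > v $ j}"
| "half_space i j Zero = {v. v $ i = v $ j}"
| "half_space i j Minus = {v. v $ i < v $ j}"

definition cell :: "('n \<Rightarrow> 'n \<Rightarrow> side) \<Rightarrow> ('n::{finite,linorder}) region" where
  "cell \<sigma> = (\<Inter>(i, j) \<in> {(i, j). i < j}. half_space i j (\<sigma> i j))"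

definition faces :: "('n::{finite,linorder}) region set" where
  "faces = {x. x \<noteq> {} \<and> (\<exists>\<sigma>. x = cell \<sigma>)}"

definition face_side :: "('n::{finite,linorder}) region \<Rightarrow> 'n \<Rightarrow> 'n \<Rightarrow> side" where
  "face_side x i j = (THE s. x \<subseteq> half_space i j s)"

definition face_mult :: "('n::{finite,linorder}) region \<Rightarrow> 'n region \<Rightarrow> 'n region" where
  "face_mult x y =
    cell (\<lambda>i j. if face_side x i j \<noteq> Zero then face_side x i j else face_side y i j)"

definition perm_vec :: "('n::finite \<Rightarrow> 'n) \<Rightarrow> real ^ 'n \<Rightarrow> real ^ 'n" where
  "perm_vec \<omega> v = (\<chi> i. v $ (inv_into UNIV \<omega> i))"

section \<open>The face semigroup algebra and its invariants\<close>

text \<open>An element \<open>\<Sum>\<^sub>x a\<^sub>x x\<close> is the (extensional) function \<open>x \<mapsto> a\<^sub>x\<close> on the finite set of faces. The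
  unit is the face lying on all hyperplanes.\<close>

definition face_algebra ::
    "('k, 'm) ring_scheme \<Rightarrow> ('k, ('n::{finite,linorder}) region \<Rightarrow> 'k) module" where
  "face_algebra k =
    \<lparr> carrier = faces \<rightarrow>\<^sub>E carrier k,
      monoid.mult = (\<lambda>a b. \<lambda>z \<in> faces.
        finsum k (\<lambda>(x, y). a x \<otimes>\<^bsub>k\<^esub> b y) {(x, y). x \<in> faces \<and> y \<in> faces \<and> face_mult x y = z}),
      monoid.one = (\<lambda>z \<in> faces. if z = cell (\<lambda>i j. Zero) then \<one>\<^bsub>k\<^esub> else \<zero>\<^bsub>k\<^esub>),
      ring.zero = (\<lambda>z \<in> faces. \<zero>\<^bsub>k\<^esub>),
      ring.add = (\<lambda>a b. \<lambda>z \<in> faces. a z \<oplus>\<^bsub>k\<^esub> b z),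
      module.smult = (\<lambda>c a. \<lambda>z \<in> faces. c \<otimes>\<^bsub>k\<^esub> a z) \<rparr>"

text \<open>The linear extension of \<open>x \<mapsto> \<omega> x\<close>: the coefficient of \<open>z\<close> in \<open>\<Sum>\<^sub>x a\<^sub>x (\<omega> x)\<close> is that of
  the preimage of \<open>z\<close> in \<open>\<Sum>\<^sub>x a\<^sub>x x\<close>.\<close>

definition perm_elem ::
    "('n \<Rightarrow> 'n) \<Rightarrow> (('n::{finite,linorder}) region \<Rightarrow> 'k) \<Rightarrow> ('n region \<Rightarrow> 'k)" where
  "perm_elem \<omega> a = (\<lambda>z \<in> faces. a (perm_vec (inv_into UNIV \<omega>) ` z))"

definition invariant_face_algebra ::
    "('k, 'm) ring_scheme \<Rightarrow> ('k, ('n::{finite,linorder}) region \<Rightarrow> 'k) module" where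
  "invariant_face_algebra k = (face_algebra k)
    \<lparr> carrier := {a \<in> carrier (face_algebra k). \<forall>\<omega>. \<omega> permutes UNIV \<longrightarrow> perm_elem \<omega> a = a} \<rparr>"

section \<open>Integer partitions\<close>

definition integer_partitions :: "nat \<Rightarrow> nat multiset set" where
  "integer_partitions n = {p. (\<forall>i \<in># p. 0 < i) \<and> sum_mset p = n}"

definition adds_two_distinct :: "nat multiset \<Rightarrow> nat multiset \<Rightarrow> bool" where
  "adds_two_distinct p q \<longleftrightarrow>
    (\<exists>a b r. a \<noteq> b \<and> p = add_mset a (add_mset b r) \<and> q = add_mset (a + b) r)"

definition partition_quiver :: "nat \<Rightarrow> (nat multiset, nat multiset \<times> nat multiset) pre_digraph" where
  "partition_quiver n =
    \<lparr> verts = integer_partitions n,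
      arcs = {(p, q). p \<in> integer_partitions n \<and> q \<in> integer_partitions n \<and> adds_two_distinct p q},
      tail = fst,
      head = snd \<rparr>"

end

theory Submission
  imports Defs "HOL-Combinatorics.Multiset_Permutations"
begin

text \<open>The sums over the orbits of faces form a basis of the invariants, indexed by the compositions \<open>c\<close>
  of \<open>n\<close>. Adding the coefficients of the faces which a face of type \<open>\<mu>\<close> refines is a character \<open>\<chi>\<^sub>\<mu>\<close>. As \<open>n!\<close> is
  invertible, the filtration by the number of blocks produces orthogonal idempotents \<open>e\<^sub>\<mu>\<close> dual to
  these characters.

  Let \<open>s\<close> be the sum of the faces of type \<open>\<mu>\<close> whose first two blocks have sizes \<open>a, b\<close>, minus the sum of those
  with sizes \<open>b, a\<close>. If \<open>\<nu>\<close> arises from \<open>\<mu>\<close> by merging \<open>a \<noteq> b\<close>, then \<open>r = e\<^sub>\<nu> s e\<^sub>\<mu>\<close> is an arrow from \<open>\<mu>\<close> to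
  \<open>\<nu>\<close>. Multiplying \<open>r\<close> from the left by the orbit of a composition \<open>d\<close> of type \<open>\<nu>\<close> yields, up to a nonzero
  factor, the compositions obtained by splitting a part \<open>a + b\<close> of \<open>d\<close> into \<open>a, b\<close>, minus those obtained by
  splitting it into \<open>b, a\<close>. These relations identify all rearrangements of a composition of type \<open>\<mu>\<close> modulo
  the left ideal generated by the arrows, so \<open>A e\<^sub>\<mu>\<close> is spanned by \<open>e\<^sub>\<mu>\<close> and this left ideal. Hence the
  arrows generate the common kernel of the characters, which is nilpotent and therefore the radical; as an
  arrow lowers the number of parts by one, the arrows are independent modulo its square.\<close>

section \<open>Split algebras given by dual characters\<close>

text \<open>The identities rest on a triangularity. A product of faces has at least as many blocks
  as each factor, and right multiplication by \<open>tail_elem (Suc l)\<close> annihilates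
  everything supported on more than \<open>l\<close> blocks; so two elements supported on at least
  \<open>l\<close> blocks give the same product with it as soon as they agree on the faces with
  exactly \<open>l\<close> blocks. There a product has the coefficients of such a left factor times
  characters of the right one. The invertibility of \<open>n!\<close> enters three times: in the
  \<open>l!\<close> orderings of \<open>l\<close> blocks, which normalise the idempotents; in the
  factor \<open>fact (size \<mu> - 2)\<close> of the splitting relation, which counts the orders of
  the blocks other than the two split ones; and in the length of a run of equal letters. The last is
  the obstacle: if \<open>a + b\<close> occurs several times in \<open>d\<close>, the relation is a
  sum over all occurrences, from which no single exchange can be read off. Larger sums are therefore
  treated before smaller ones: once \<open>a + b\<close> commutes with the other letters, its
  occurrences can be collected in one run, all summands become congruent, and their number is
  divided out.\<close>

locale assoc_alg = k: field k + ring A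
  for k :: "('k, 'm) ring_scheme" and A :: "('k, 'a) module" (structure) +
  assumes assoc_algebra: "assoc_algebra k A"
begin

lemma smult_module: "module k A"
  using assoc_algebra by (simp add: assoc_algebra_def)

lemmas smult_closed [simp, intro] = module.smult_closed [OF smult_module]
lemmas smult_l_distr = module.smult_l_distr [OF smult_module]
lemmas smult_r_distr = module.smult_r_distr [OF smult_module]
lemmas smult_assoc1 = module.smult_assoc1 [OF smult_module]
lemmas smult_one [simp] = module.smult_one [OF smult_module]

lemma smult_l_null [simp]: "a \<in> carrier A \<Longrightarrow> \<zero>\<^bsub>k\<^esub> \<odot> a = \<zero>"
  using module.smult_l_null [OF smult_module] by simp

lemma smult_r_null [simp]: "c \<in> carrier k \<Longrightarrow> c \<odot> \<zero> = \<zero>"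
  using module.smult_r_null [OF smult_module] by simp

lemma smult_mult_left:
  "c \<in> carrier k \<Longrightarrow> a \<in> carrier A \<Longrightarrow> b \<in> carrier A \<Longrightarrow> (c \<odot> a) \<otimes> b = c \<odot> (a \<otimes> b)"
  and smult_mult_right:
  "c \<in> carrier k \<Longrightarrow> a \<in> carrier A \<Longrightarrow> b \<in> carrier A \<Longrightarrow> a \<otimes> (c \<odot> b) = c \<odot> (a \<otimes> b)"
  using assoc_algebra by (auto simp: assoc_algebra_def)

lemma scalar_mult: "c \<in> carrier k \<Longrightarrow> a \<in> carrier A \<Longrightarrow> (c \<odot> \<one>) \<otimes> a = c \<odot> a"
  by (simp add: smult_mult_left)

text \<open>Needed to see that \<open>scalars k A\<close> and its image in a quotient are subfields,
  over which dimensions are counted.\<close>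

lemma scalar_ring_hom: "ring_hom_ring k A (\<lambda>c. c \<odot> \<one>)"
proof (unfold_locales, rule ring_hom_memI)
  fix x y assume xy: "x \<in> carrier k" "y \<in> carrier k"
  show "(x \<otimes>\<^bsub>k\<^esub> y) \<odot> \<one> = (x \<odot> \<one>) \<otimes> (y \<odot> \<one>)"
    using xy by (simp add: smult_assoc1 scalar_mult)
qed (auto simp: smult_l_distr)

end

text \<open>The \<open>e p\<close> lift the unit vectors along the map formed by all characters, so
  the algebra splits over \<open>k\<close> modulo their common kernel \<open>J\<close>. That
  \<open>J\<close> is the radical requires nilpotency, which is a separate assumption below.\<close>

locale dual_characters = assoc_alg k A
  for k :: "('k, 'm) ring_scheme" and A :: "('k, 'a) module" (structure) +
  fixes P :: "'p set" and chi :: "'p \<Rightarrow> 'a \<Rightarrow> 'k" and e :: "'p \<Rightarrow> 'a"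
  assumes finite_P [simp]: "finite P"
    and chi_hom: "p \<in> P \<Longrightarrow> chi p \<in> ring_hom A k"
    and chi_smult: "p \<in> P \<Longrightarrow> c \<in> carrier k \<Longrightarrow> a \<in> carrier A \<Longrightarrow> chi p (c \<odot> a) = c \<otimes>\<^bsub>k\<^esub> chi p a"
    and e_closed [simp]: "p \<in> P \<Longrightarrow> e p \<in> carrier A"
    and chi_e: "p \<in> P \<Longrightarrow> q \<in> P \<Longrightarrow> chi p (e q) = (if p = q then \<one>\<^bsub>k\<^esub> else \<zero>\<^bsub>k\<^esub>)"
    and e_mult: "p \<in> P \<Longrightarrow> q \<in> P \<Longrightarrow> e p \<otimes> e q = (if p = q then e p else \<zero>)"
    and e_sum: "(\<Oplus>p\<in>P. e p) = \<one>"
begin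

lemma chi_ring_hom: "p \<in> P \<Longrightarrow> ring_hom_ring A k (chi p)"
  using chi_hom by unfold_locales auto

lemma chi_simps [simp]:
  assumes "p \<in> P"
  shows "a \<in> carrier A \<Longrightarrow> chi p a \<in> carrier k"
    and "a \<in> carrier A \<Longrightarrow> b \<in> carrier A \<Longrightarrow> chi p (a \<otimes> b) = chi p a \<otimes>\<^bsub>k\<^esub> chi p b"
    and "a \<in> carrier A \<Longrightarrow> b \<in> carrier A \<Longrightarrow> chi p (a \<oplus> b) = chi p a \<oplus>\<^bsub>k\<^esub> chi p b"
    and "a \<in> carrier A \<Longrightarrow> b \<in> carrier A \<Longrightarrow> chi p (a \<ominus> b) = chi p a \<ominus>\<^bsub>k\<^esub> chi p b"
    and "chi p \<one> = \<one>\<^bsub>k\<^esub>"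
    and "chi p \<zero> = \<zero>\<^bsub>k\<^esub>"
proof -
  interpret h: ring_hom_ring A k "chi p" by (rule chi_ring_hom [OF assms])
  show "a \<in> carrier A \<Longrightarrow> chi p a \<in> carrier k"
    and "a \<in> carrier A \<Longrightarrow> b \<in> carrier A \<Longrightarrow> chi p (a \<otimes> b) = chi p a \<otimes>\<^bsub>k\<^esub> chi p b"
    and "a \<in> carrier A \<Longrightarrow> b \<in> carrier A \<Longrightarrow> chi p (a \<oplus> b) = chi p a \<oplus>\<^bsub>k\<^esub> chi p b"
    and "a \<in> carrier A \<Longrightarrow> b \<in> carrier A \<Longrightarrow> chi p (a \<ominus> b) = chi p a \<ominus>\<^bsub>k\<^esub> chi p b"
    and "chi p \<one> = \<one>\<^bsub>k\<^esub>" and "chi p \<zero> = \<zero>\<^bsub>k\<^esub>"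
    by (simp_all add: a_minus_def k.minus_eq)
qed

definition J :: "'a set" where
  "J = {a \<in> carrier A. \<forall>p \<in> P. chi p a = \<zero>\<^bsub>k\<^esub>}"

lemma J_carrier: "a \<in> J \<Longrightarrow> a \<in> carrier A"
  by (simp add: J_def)

lemma ideal_J: "ideal J A"
proof (rule idealI)
  show "ring A" by (rule ring_axioms)
  show "subgroup J (add_monoid A)"
  proof (rule subgroup.intro)
    show "J \<subseteq> carrier (add_monoid A)" by (auto simp: J_def)
    show "\<And>x y. x \<in> J \<Longrightarrow> y \<in> J \<Longrightarrow> x \<otimes>\<^bsub>add_monoid A\<^esub> y \<in> J" by (auto simp: J_def)
    show "\<one>\<^bsub>add_monoid A\<^esub> \<in> J" by (auto simp: J_def)
    fix x assume x: "x \<in> J"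
    have "chi p (\<ominus> x) = \<zero>\<^bsub>k\<^esub>" if p: "p \<in> P" for p
    proof -
      have "chi p (\<zero> \<ominus> x) = \<zero>\<^bsub>k\<^esub>" using x p chi_simps(4)[OF p zero_closed] by (simp add: J_def k.minus_eq)
      then show ?thesis using x by (simp add: a_minus_def J_def)
    qed
    then show "inv\<^bsub>add_monoid A\<^esub> x \<in> J" using x by (simp add: J_def a_inv_def[symmetric])
  qed
qed (auto simp: J_def)

lemma J_mult: "a \<in> J \<Longrightarrow> b \<in> carrier A \<Longrightarrow> a \<otimes> b \<in> J" "a \<in> J \<Longrightarrow> b \<in> carrier A \<Longrightarrow> b \<otimes> a \<in> J"
  by (auto simp: J_def)

lemma ideal_J2: "ideal (J \<cdot> J) A"
  by (rule ideal_prod_is_ideal[OF ideal_J ideal_J])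

lemma J2_subset: "J \<cdot> J \<subseteq> J"
  using ideal_prod_inter[OF ideal_J ideal_J] by simp

lemma e_nonzero: "p \<in> P \<Longrightarrow> e p \<noteq> \<zero>"
  using chi_e[of p p] chi_simps(6)[of p] k.one_not_zero by auto

text \<open>A character is multiplicative and nonzero on exactly one \<open>e p\<close>, so it takes
  the same value on both terms. Corners are thus scalar modulo \<open>J\<close>: multiples of
  \<open>e p\<close> on the diagonal, zero off it.\<close>

lemma corner_decomposition:
  assumes "p \<in> P" "q \<in> P" "a \<in> carrier A"
  shows "e q \<otimes> a \<otimes> e p \<ominus> (if p = q then chi p a \<odot> e p else \<zero>) \<in> J"
proof -
  have "chi s (e q \<otimes> a \<otimes> e p \<ominus> (if p = q then chi p a \<odot> e p else \<zero>)) = \<zero>\<^bsub>k\<^esub>" if s: "s \<in> P" for s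
    using assms s by (auto simp: chi_e chi_smult k.minus_eq k.r_neg)
  then show ?thesis using assms by (auto simp: J_def)
qed

end

section \<open>Nil kernels: the radical and the primitive idempotents\<close>

locale nilpotent_dual_characters = dual_characters +
  assumes J_nilpotent: "a \<in> J \<Longrightarrow> \<exists>N::nat. a [^] N = \<zero>"
begin

lemma idempotent_in_J:
  assumes "idempotent_elem A f" "f \<in> J"
  shows "f = \<zero>"
proof -
  have f: "f \<in> carrier A" "f \<otimes> f = f" using assms by (auto simp: idempotent_elem_def)
  have pow: "f [^] Suc N = f" for N :: nat by (induction N) (use f in auto)
  obtain N :: nat where "f [^] N = \<zero>" using J_nilpotent[OF assms(2)] by blast
  then have "f [^] Suc N = \<zero>" using f by simp
  then show ?thesis using pow by simp
qed

text \<open>The kernel of a character is a maximal left ideal, because its quotient is the field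
  \<open>k\<close>. Conversely, a maximal left ideal \<open>L\<close> without \<open>j\<close> would
  give \<open>\<one> = l \<oplus> a \<otimes> j\<close> with \<open>l\<close> in \<open>L\<close>;
  as \<open>a \<otimes> j\<close> is nilpotent, this forces \<open>\<one>\<close> into
  \<open>L\<close>.\<close>

lemma jacobson_radical_eq: "jacobson_radical A = J"
proof (intro equalityI subsetI)
  fix a assume a: "a \<in> jacobson_radical A"
  then have ac: "a \<in> carrier A" by (simp add: jacobson_radical_def)
  have "chi p a = \<zero>\<^bsub>k\<^esub>" if p: "p \<in> P" for p
  proof -
    define L where "L = {x \<in> carrier A. chi p x = \<zero>\<^bsub>k\<^esub>}"
    have mem: "x \<in> L \<longleftrightarrow> x \<in> carrier A \<and> chi p x = \<zero>\<^bsub>k\<^esub>" for x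
      by (simp add: L_def)
    have "chi p (\<ominus> x) = \<ominus>\<^bsub>k\<^esub> chi p x" if "x \<in> carrier A" for x
      using chi_simps(4)[OF p zero_closed that] that p by (simp add: a_minus_def)
    then have left: "left_ideal L A"
      unfolding left_ideal_def additive_subgroup_def
      by (intro conjI subgroup.intro ballI) (auto simp: L_def p a_inv_def[symmetric])
    have "maximal_left_ideal L A"
      unfolding maximal_left_ideal_def
    proof (intro conjI allI impI left)
      show "L \<noteq> carrier A" using mem[of \<one>] chi_simps(5)[OF p] by auto
      fix L' assume L': "left_ideal L' A" "L \<subseteq> L'"
      interpret L': additive_subgroup L' A using L' by (simp add: left_ideal_def)
      show "L' = L \<or> L' = carrier A"
      proof (rule disjCI)
        assume ne: "L' \<noteq> carrier A"
        show "L' = L"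
        proof (rule ccontr)
          assume "L' \<noteq> L"
          then obtain b where b: "b \<in> L'" "b \<notin> L" using L' by blast
          then have bc: "b \<in> carrier A" using L'.a_subset by blast
          then have c: "chi p b \<in> carrier k" "chi p b \<noteq> \<zero>\<^bsub>k\<^esub>" using b p mem by auto
          then have u: "chi p b \<in> Units k" by (simp add: k.field_Units)
          have "x \<in> L'" if x: "x \<in> carrier A" for x
          proof -
            \<comment> \<open>Scaled such that \<open>?y\<close> has the same character value as
              \<open>x\<close>, which puts \<open>x \<ominus> ?y\<close> into the kernel
              \<open>L\<close>.\<close>
            let ?c = "chi p x \<otimes>\<^bsub>k\<^esub> inv\<^bsub>k\<^esub> chi p b"
            have cc: "?c \<in> carrier k" using u x p by simp
            let ?y = "(?c \<odot> \<one>) \<otimes> b"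
            have y: "?y \<in> L'" using L'(1) b cc by (simp add: left_ideal_def)
            have yc: "?y \<in> carrier A" using y L'.a_subset by blast
            have "chi p (?c \<odot> \<one>) = ?c" using chi_smult[OF p cc one_closed] p cc by simp
            then have "chi p ?y = chi p x" using u p cc bc x by (simp add: k.m_assoc)
            then have "x \<ominus> ?y \<in> L" unfolding mem using x p yc
              by (simp add: k.minus_eq k.r_neg)
            then have "x \<ominus> ?y \<in> L'" using L' by blast
            then have "(x \<ominus> ?y) \<oplus> ?y \<in> L'" using y by blast
            then show ?thesis using x yc by (simp add: a_minus_def a_assoc l_neg)
          qed
          then show False using ne L'.a_subset by blast
        qed
      qed
    qed
    then show ?thesis using a mem by (auto simp: jacobson_radical_def)
  qed
  then show "a \<in> J" using ac by (simp add: J_def)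
next
  fix j assume j: "j \<in> J"
  then have jc: "j \<in> carrier A" by (rule J_carrier)
  show "j \<in> jacobson_radical A"
    unfolding jacobson_radical_def
  proof (intro CollectI conjI jc allI impI)
    fix L assume L: "maximal_left_ideal L A"
    then have left: "left_ideal L A" and max: "\<And>L'. left_ideal L' A \<Longrightarrow> L \<subseteq> L' \<Longrightarrow> L' = L \<or> L' = carrier A"
      and Lne: "L \<noteq> carrier A" by (auto simp: maximal_left_ideal_def)
    interpret L: additive_subgroup L A using left by (simp add: left_ideal_def)
    have Lm: "a \<in> carrier A \<Longrightarrow> l \<in> L \<Longrightarrow> a \<otimes> l \<in> L" for a l using left by (simp add: left_ideal_def)
    have Lc: "l \<in> L \<Longrightarrow> l \<in> carrier A" for l using L.a_subset by blast
    show "j \<in> L"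
    proof (rule ccontr)
      assume jn: "j \<notin> L"
      define L' where "L' = {l \<oplus> a \<otimes> j | l a. l \<in> L \<and> a \<in> carrier A}"
      have L'I: "l \<in> L \<Longrightarrow> a \<in> carrier A \<Longrightarrow> x = l \<oplus> a \<otimes> j \<Longrightarrow> x \<in> L'" for l a x
        by (auto simp: L'_def)
      have sub: "L \<subseteq> L'"
      proof
        fix l assume "l \<in> L" then show "l \<in> L'" using jc Lc by (intro L'I[of l \<zero>]) auto
      qed
      have jL': "j \<in> L'" using jc by (intro L'I[of \<zero> \<one>]) auto
      have "left_ideal L' A"
        unfolding left_ideal_def
      proof (intro conjI ballI)
        show "additive_subgroup L' A"
        proof (rule additive_subgroup.intro, rule subgroup.intro)
          show "L' \<subseteq> carrier (add_monoid A)" using jc Lc by (auto simp: L'_def)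
          show "\<one>\<^bsub>add_monoid A\<^esub> \<in> L'" using sub by auto
          fix x assume "x \<in> L'"
          then obtain l a where x: "l \<in> L" "a \<in> carrier A" "x = l \<oplus> a \<otimes> j" by (auto simp: L'_def)
          have "\<ominus> x = (\<ominus> l) \<oplus> (\<ominus> a) \<otimes> j" using x jc Lc by (simp add: minus_add l_minus)
          then have "\<ominus> x \<in> L'" using x by (intro L'I) auto
          then show "inv\<^bsub>add_monoid A\<^esub> x \<in> L'" by (simp add: a_inv_def)
          fix y assume "y \<in> L'"
          then obtain l' a' where y: "l' \<in> L" "a' \<in> carrier A" "y = l' \<oplus> a' \<otimes> j" by (auto simp: L'_def)
          have "x \<oplus> y = (l \<oplus> l') \<oplus> (a \<oplus> a') \<otimes> j"
            using x y jc Lc by (simp add: l_distr a_ac)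
          then have "x \<oplus> y \<in> L'" using x y by (intro L'I) auto
          then show "x \<otimes>\<^bsub>add_monoid A\<^esub> y \<in> L'" by simp
        qed
        fix a x assume a: "a \<in> carrier A" and "x \<in> L'"
        then obtain l b where x: "l \<in> L" "b \<in> carrier A" "x = l \<oplus> b \<otimes> j" by (auto simp: L'_def)
        show "a \<otimes> x \<in> L'" using a x jc Lc Lm
          by (intro L'I[of "a \<otimes> l" "a \<otimes> b"]) (auto simp: r_distr m_assoc)
      qed
      then have "L' = carrier A" using max sub jL' jn by blast
      then have "\<one> \<in> L'" by simp
      then obtain l a where la: "l \<in> L" "a \<in> carrier A" "\<one> = l \<oplus> a \<otimes> j" by (auto simp: L'_def)
      define n where "n = a \<otimes> j"
      have nJ: "n \<in> J" unfolding n_def by (rule J_mult(2)[OF j la(2)])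
      have nc: "n \<in> carrier A" using nJ J_carrier by simp
      obtain N :: nat where N: "n [^] N = \<zero>" using J_nilpotent[OF nJ] by blast
      \<comment> \<open>Multiplying \<open>\<one> = l \<oplus> n\<close> by a power of
        \<open>n\<close> from the left descends from one power in \<open>L\<close> to the previous
        one, starting at the vanishing power.\<close>
      have step: "n [^] i \<in> L" if "n [^] Suc i \<in> L" for i :: nat
      proof -
        have "n [^] i = n [^] i \<otimes> (l \<oplus> n)" using la(3)[folded n_def, symmetric] nc by simp
        also have "\<dots> = n [^] i \<otimes> l \<oplus> n [^] Suc i" using nc Lc la by (simp add: r_distr)
        finally have eq: "n [^] i = n [^] i \<otimes> l \<oplus> n [^] Suc i" .
        have "n [^] i \<otimes> l \<oplus> n [^] Suc i \<in> L"
          by (rule L.a_closed[OF Lm[OF nat_pow_closed[OF nc] la(1)] that])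
        then show ?thesis by (simp only: eq[symmetric])
      qed
      have "n [^] (N - i) \<in> L" for i :: nat
      proof (induction i)
        case 0 show ?case using N by simp
      next
        case (Suc i)
        show ?case
        proof (cases "i < N")
          case True
          then have "N - i = Suc (N - Suc i)" by simp
          then show ?thesis using step[of "N - Suc i"] Suc by (simp only:)
        next
          case False
          then have "N - Suc i = N - i" by simp
          then show ?thesis using Suc by (simp only:)
        qed
      qed
      from this[of N] have "\<one> \<in> L" by simp
      then have "x \<in> L" if "x \<in> carrier A" for x using Lm[of x \<one>] that by simp
      then show False using Lne Lc by blast
    qed
  qed
qed


text \<open>The inverse is the geometric series of \<open>n\<close>. Its partial sums are produced
  by induction on the number of terms, for both sides at once.\<close>

lemma one_minus_J_Units:
  assumes "n \<in> J"
  shows "\<one> \<ominus> n \<in> Units A"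
proof -
  have n: "n \<in> carrier A" using assms by (rule J_carrier)
  obtain N :: nat where N: "n [^] N = \<zero>" using J_nilpotent[OF assms] by blast
  have "\<exists>b \<in> carrier A. (\<one> \<ominus> n) \<otimes> b = \<one> \<ominus> n [^] M \<and> b \<otimes> (\<one> \<ominus> n) = \<one> \<ominus> n [^] M" for M :: nat
  proof (induction M)
    case 0
    then show ?case using n by (intro bexI[of _ \<zero>]) (auto simp: a_minus_def r_neg)
  next
    case (Suc M)
    then obtain b where b: "b \<in> carrier A" "(\<one> \<ominus> n) \<otimes> b = \<one> \<ominus> n [^] M"
      "b \<otimes> (\<one> \<ominus> n) = \<one> \<ominus> n [^] M" by blast
    have com: "n \<otimes> n [^] M = n [^] M \<otimes> n"
      using n nat_pow_Suc2 by simp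
    have can: "\<one> \<ominus> x \<oplus> (x \<ominus> y) = \<one> \<ominus> y" if "x \<in> carrier A" "y \<in> carrier A" for x y
      using that by (simp add: a_minus_def a_assoc r_neg1)
    have "(\<one> \<ominus> n) \<otimes> n [^] M = n [^] M \<ominus> n [^] Suc M"
      "n [^] M \<otimes> (\<one> \<ominus> n) = n [^] M \<ominus> n [^] Suc M"
      using n com by (simp_all add: a_minus_def l_distr r_distr l_minus r_minus)
    then show ?case using n b
      by (intro bexI[of _ "b \<oplus> n [^] M"]) (auto simp: l_distr r_distr can)
  qed
  from this[of N] obtain b where b: "b \<in> carrier A" "(\<one> \<ominus> n) \<otimes> b = \<one>" "b \<otimes> (\<one> \<ominus> n) = \<one>"
    using N by (auto simp: a_minus_def)
  then show ?thesis using n by (auto simp: Units_def)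
qed

lemma Units_of_chi_one:
  assumes "u \<in> carrier A" "\<And>p. p \<in> P \<Longrightarrow> chi p u = \<one>\<^bsub>k\<^esub>"
  shows "u \<in> Units A"
proof -
  have "\<one> \<ominus> u \<in> J" using assms by (auto simp: J_def k.minus_eq k.r_neg)
  then have "\<one> \<ominus> (\<one> \<ominus> u) \<in> Units A" by (rule one_minus_J_Units)
  moreover have "\<one> \<ominus> (\<one> \<ominus> u) = u"
    using assms(1) by (simp add: a_minus_def minus_add r_neg2)
  ultimately show ?thesis by simp
qed

lemma chi_idempotent:
  assumes "idempotent_elem A f" "p \<in> P"
  shows "chi p f = \<zero>\<^bsub>k\<^esub> \<or> chi p f = \<one>\<^bsub>k\<^esub>"
proof -
  have f: "f \<in> carrier A" "f \<otimes> f = f" using assms by (auto simp: idempotent_elem_def)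
  then have c: "chi p f \<in> carrier k" "chi p f \<otimes>\<^bsub>k\<^esub> chi p f = chi p f"
    using assms chi_simps(2)[OF assms(2), of f f] by auto
  then show ?thesis
    by (metis k.m_rcancel k.one_closed k.l_one)
qed

lemma idempotent_chi_one:
  assumes "idempotent_elem A f" "f \<noteq> \<zero>"
  shows "\<exists>p \<in> P. chi p f = \<one>\<^bsub>k\<^esub>"
proof (rule ccontr)
  assume "\<not> ?thesis"
  then have "f \<in> J" using chi_idempotent[OF assms(1)] assms(1) by (auto simp: J_def idempotent_elem_def)
  then show False using assms idempotent_in_J by blast
qed

lemma e_idempotent: "p \<in> P \<Longrightarrow> idempotent_elem A (e p)"
  by (simp add: idempotent_elem_def e_mult)

text \<open>If \<open>e p\<close> splits as \<open>f \<oplus> g\<close>, each nonzero summand has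
  the value one under some character. The values of the summands add up to that of
  \<open>e p\<close>, so this character is \<open>chi p\<close> in both cases, contradicting
  \<open>f \<otimes> g = \<zero>\<close>.\<close>

lemma e_primitive:
  assumes p: "p \<in> P"
  shows "primitive_idempotent A (e p)"
  unfolding primitive_idempotent_def
proof (intro conjI e_idempotent e_nonzero p notI)
  assume "\<exists>f g. idempotent_elem A f \<and> idempotent_elem A g \<and> f \<noteq> \<zero> \<and> g \<noteq> \<zero> \<and>
        f \<otimes> g = \<zero> \<and> g \<otimes> f = \<zero> \<and> e p = f \<oplus> g"
  then obtain f g where fg: "idempotent_elem A f" "idempotent_elem A g" "f \<noteq> \<zero>" "g \<noteq> \<zero>"
    "f \<otimes> g = \<zero>" "g \<otimes> f = \<zero>" "e p = f \<oplus> g" by blast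
  have c: "f \<in> carrier A" "g \<in> carrier A" using fg by (auto simp: idempotent_elem_def)
  have z: "chi q f \<otimes>\<^bsub>k\<^esub> chi q g = \<zero>\<^bsub>k\<^esub>" if "q \<in> P" for q
    using chi_simps(2)[OF that c] fg(5) that by simp
  have s: "chi q f \<oplus>\<^bsub>k\<^esub> chi q g = (if q = p then \<one>\<^bsub>k\<^esub> else \<zero>\<^bsub>k\<^esub>)" if "q \<in> P" for q
    using chi_simps(3)[OF that c] fg(7) chi_e[OF that p] by simp
  obtain q where q: "q \<in> P" "chi q f = \<one>\<^bsub>k\<^esub>" using idempotent_chi_one fg by blast
  obtain r where r: "r \<in> P" "chi r g = \<one>\<^bsub>k\<^esub>" using idempotent_chi_one fg by blast
  have "chi q g = \<zero>\<^bsub>k\<^esub>" using z[of q] q c by simp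
  then have "q = p" using s[of q] q by (auto split: if_splits)
  have "chi r f = \<zero>\<^bsub>k\<^esub>" using z[of r] r c by simp
  then have "r = p" using s[of r] r by (auto split: if_splits)
  then show False using \<open>q = p\<close> q \<open>chi r f = \<zero>\<^bsub>k\<^esub>\<close> by simp
qed

lemma e_inj: "inj_on e P"
proof (rule inj_onI)
  fix p q assume "p \<in> P" "q \<in> P" "e p = e q"
  then show "p = q" using chi_e[of p q] chi_e[of p p] by (auto split: if_splits)
qed

lemma complete_primitive_system_e: "complete_primitive_system A (e ` P)"
  unfolding complete_primitive_system_def
proof (intro conjI ballI impI)
  show "finsum A (\<lambda>e. e) (e ` P) = \<one>"
  proof -
    have "finsum A (\<lambda>e. e) (e ` P) = (\<Oplus>p\<in>P. e p)"
      by (rule add.finprod_reindex) (auto simp: e_inj)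
    then show ?thesis using e_sum by simp
  qed
qed (auto simp: e_primitive e_mult)

lemma chi_finsum:
  assumes "p \<in> P" "finite S" "f \<in> S \<rightarrow> carrier A"
  shows "chi p (\<Oplus>s\<in>S. f s) = (\<Oplus>\<^bsub>k\<^esub>s\<in>S. chi p (f s))"
  using assms(2,3)
proof (induction S rule: finite_induct)
  case empty
  then show ?case using assms(1) by simp
next
  case (insert x F)
  then have "f \<in> F \<rightarrow> carrier A" "f x \<in> carrier A" by auto
  moreover from this have "(\<lambda>s. chi p (f s)) \<in> F \<rightarrow> carrier k" using assms(1) by (simp add: Pi_iff)
  ultimately show ?case using insert assms(1) by simp
qed

lemma chi_sum_e:
  assumes "p \<in> P" "S \<subseteq> P" "c \<in> S \<rightarrow> carrier k"
  shows "chi p (\<Oplus>q\<in>S. c q \<odot> e q) = (if p \<in> S then c p else \<zero>\<^bsub>k\<^esub>)"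
proof -
  have fin: "finite S" using assms(2) finite_P finite_subset by blast
  have "chi p (\<Oplus>q\<in>S. c q \<odot> e q) = (\<Oplus>\<^bsub>k\<^esub>q\<in>S. chi p (c q \<odot> e q))"
    using assms by (intro chi_finsum fin) (auto simp: Pi_iff subset_iff)
  also have "\<dots> = (\<Oplus>\<^bsub>k\<^esub>q\<in>S. if p = q then c q else \<zero>\<^bsub>k\<^esub>)"
    using assms by (intro k.add.finprod_cong') (auto simp: chi_smult chi_e subset_iff Pi_iff)
  also have "\<dots> = (if p \<in> S then c p else \<zero>\<^bsub>k\<^esub>)"
  proof (cases "p \<in> S")
    case True
    then show ?thesis using k.add.finprod_singleton[OF True fin assms(3)] by simp
  next
    case False
    then have "(\<Oplus>\<^bsub>k\<^esub>q\<in>S. if p = q then c q else \<zero>\<^bsub>k\<^esub>) = \<zero>\<^bsub>k\<^esub>"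
      by (intro k.add.finprod_one_eqI) auto
    then show ?thesis using False by simp
  qed
  finally show ?thesis .
qed

text \<open>The element \<open>u = f e' + (1 - f) (1 - e')\<close>, where \<open>e'\<close> is the sum of the \<open>e p\<close> with
  \<open>chi p f = 1\<close>, is a unit with \<open>f u = u e'\<close>; so \<open>f\<close> is conjugate to \<open>e'\<close>.\<close>

lemma primitive_chi_unique:
  assumes prim: "primitive_idempotent A f" and pq: "p \<in> P" "q \<in> P" "chi p f = \<one>\<^bsub>k\<^esub>" "chi q f = \<one>\<^bsub>k\<^esub>"
  shows "p = q"
proof (rule ccontr)
  assume ne: "p \<noteq> q"
  have idf: "idempotent_elem A f" and f: "f \<in> carrier A" "f \<otimes> f = f"
    using prim by (auto simp: primitive_idempotent_def idempotent_elem_def)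
  define S where "S = {r \<in> P. chi r f = \<one>\<^bsub>k\<^esub>}"
  have S: "S \<subseteq> P" "p \<in> S" "q \<in> S" "finite S" using pq finite_P by (auto simp: S_def)
  define s where "s = (\<Oplus>r\<in>S. e r)"
  have sc: "s \<in> carrier A" unfolding s_def using S by (intro finsum_closed) auto
  have "s = (\<Oplus>r\<in>S. \<one>\<^bsub>k\<^esub> \<odot> e r)" unfolding s_def using S by (intro finsum_cong') auto
  then have chis: "chi r s = (if r \<in> S then \<one>\<^bsub>k\<^esub> else \<zero>\<^bsub>k\<^esub>)" if "r \<in> P" for r
    using chi_sum_e[OF that S(1), of "\<lambda>_. \<one>\<^bsub>k\<^esub>"] by simp
  have eS: "e \<in> S \<rightarrow> carrier A" using S by auto
  have se: "s \<otimes> e r = e r" if r: "r \<in> S" for r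
  proof -
    have "s \<otimes> e r = (\<Oplus>t\<in>S. e t \<otimes> e r)"
      unfolding s_def using S r eS by (intro finsum_ldistr) auto
    also have "\<dots> = (\<Oplus>t\<in>S. if r = t then e t else \<zero>)"
      using S r by (intro finsum_cong') (auto simp: e_mult subset_iff)
    also have "\<dots> = e r" using add.finprod_singleton[OF r S(4) eS] by simp
    finally show ?thesis .
  qed
  have es: "e r \<otimes> s = e r" if r: "r \<in> S" for r
  proof -
    have "e r \<otimes> s = (\<Oplus>t\<in>S. e r \<otimes> e t)"
      unfolding s_def using S r eS by (intro finsum_rdistr) auto
    also have "\<dots> = (\<Oplus>t\<in>S. if r = t then e t else \<zero>)"
      using S r by (intro finsum_cong') (auto simp: e_mult subset_iff)
    also have "\<dots> = e r" using add.finprod_singleton[OF r S(4) eS] by simp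
    finally show ?thesis .
  qed
  have ss: "s \<otimes> s = s"
  proof -
    have "s \<otimes> s = (\<Oplus>t\<in>S. s \<otimes> e t)"
      using finsum_rdistr[OF S(4) sc eS] by (simp add: s_def[symmetric])
    also have "\<dots> = s" unfolding s_def using S se[unfolded s_def] by (intro finsum_cong') (auto simp: Pi_iff)
    finally show ?thesis .
  qed
  define u where "u = f \<otimes> s \<oplus> (\<one> \<ominus> f) \<otimes> (\<one> \<ominus> s)"
  have uc: "u \<in> carrier A" unfolding u_def using f sc by simp
  have uU: "u \<in> Units A"
  proof (rule Units_of_chi_one[OF uc])
    fix r assume r: "r \<in> P"
    show "chi r u = \<one>\<^bsub>k\<^esub>"
      using chi_idempotent[OF idf r] r f sc chis[OF r]
      by (auto simp: u_def S_def k.minus_eq k.r_neg)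
  qed
  have fu: "f \<otimes> u = f \<otimes> s"
  proof -
    have "f \<otimes> (\<one> \<ominus> f) = \<zero>" using f by (simp add: a_minus_def r_distr r_minus r_neg)
    then have "f \<otimes> ((\<one> \<ominus> f) \<otimes> (\<one> \<ominus> s)) = \<zero>" using f sc by (simp add: m_assoc[symmetric])
    then show ?thesis unfolding u_def using f sc by (simp add: r_distr m_assoc[symmetric])
  qed
  have us: "u \<otimes> s = f \<otimes> s"
  proof -
    have "(\<one> \<ominus> s) \<otimes> s = \<zero>" using sc ss by (simp add: a_minus_def l_distr l_minus r_neg)
    then show ?thesis unfolding u_def using f sc ss by (simp add: l_distr m_assoc)
  qed
  define v where "v = inv u"
  have v: "v \<in> carrier A" "u \<otimes> v = \<one>" "v \<otimes> u = \<one>" using uU by (auto simp: v_def)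
  have f_eq: "f = u \<otimes> s \<otimes> v"
  proof -
    have "f = f \<otimes> u \<otimes> v" using f uc v by (simp add: m_assoc)
    then show ?thesis using fu us by simp
  qed
  define cj where "cj x = u \<otimes> x \<otimes> v" for x
  have cj_closed: "cj x \<in> carrier A" if "x \<in> carrier A" for x using that uc v by (simp add: cj_def)
  have cj_mult: "cj x \<otimes> cj y = cj (x \<otimes> y)" if "x \<in> carrier A" "y \<in> carrier A" for x y
  proof -
    have "cj x \<otimes> cj y = u \<otimes> x \<otimes> (v \<otimes> u) \<otimes> y \<otimes> v"
      using that uc v(1) unfolding cj_def by (simp only: m_assoc m_closed)
    then show ?thesis using that uc v by (simp add: cj_def m_assoc)
  qed
  have chi_cj: "chi r (cj x) = chi r x" if "r \<in> P" "x \<in> carrier A" for r x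
  proof -
    have "chi r u \<otimes>\<^bsub>k\<^esub> chi r v = \<one>\<^bsub>k\<^esub>" using chi_simps(2)[OF that(1) uc v(1)] v that by simp
    moreover have "chi r (cj x) = (chi r u \<otimes>\<^bsub>k\<^esub> chi r v) \<otimes>\<^bsub>k\<^esub> chi r x"
      using that uc v(1) by (simp add: cj_def k.m_ac)
    ultimately show ?thesis using that by simp
  qed
  \<comment> \<open>The decomposition of \<open>s\<close> into \<open>e p\<close> and
    \<open>y\<close> is conjugated to one of \<open>f\<close>. The second summand is nonzero because
    \<open>chi q\<close> is one on it, so \<open>f\<close> is not primitive.\<close>
  define y where "y = s \<ominus> e p"
  have pc: "p \<in> P" "e p \<in> carrier A" using pq by auto
  have yc: "y \<in> carrier A" using sc pc by (simp add: y_def)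
  have epp: "e p \<otimes> e p = e p" using e_mult pq by simp
  have yy: "y \<otimes> y = y"
    unfolding y_def using sc pc epp ss se[OF S(2)] es[OF S(2)]
    by (simp add: a_minus_def l_distr r_distr l_minus r_minus a_assoc r_neg minus_add)
  have ey: "e p \<otimes> y = \<zero>" "y \<otimes> e p = \<zero>"
    unfolding y_def using sc pc epp se[OF S(2)] es[OF S(2)]
    by (simp_all add: a_minus_def l_distr r_distr l_minus r_minus r_neg)
  have cj0: "cj \<zero> = \<zero>" using uc v by (simp add: cj_def)
  have "idempotent_elem A (cj (e p))" "idempotent_elem A (cj y)"
    using cj_mult pc yc epp yy cj_closed by (auto simp: idempotent_elem_def)
  moreover have "cj (e p) \<noteq> \<zero>"
    using chi_cj[OF pq(1) pc(2)] chi_e[OF pq(1,1)] pq(1) by auto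
  moreover have "chi q y = \<one>\<^bsub>k\<^esub>"
    using pq ne chis[OF pq(2)] S chi_e[OF pq(2,1)] sc pc by (simp add: y_def k.minus_eq)
  then have "cj y \<noteq> \<zero>" using chi_cj[OF pq(2) yc] pq(2) by auto
  moreover have "cj (e p) \<otimes> cj y = \<zero>" "cj y \<otimes> cj (e p) = \<zero>"
    using cj_mult[OF pc(2) yc] cj_mult[OF yc pc(2)] ey cj0 by auto
  moreover have "f = cj (e p) \<oplus> cj y"
  proof -
    have "e p \<oplus> y = s" 
      unfolding y_def using sc pc a_comm[of "e p" "s \<ominus> e p"] by (simp add: a_minus_def a_assoc l_neg)
    then show ?thesis unfolding cj_def f_eq using uc v pc yc
      by (metis r_distr l_distr m_closed)
  qed
  ultimately show False using prim unfolding primitive_idempotent_def by blast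
qed

end

context nilpotent_dual_characters begin

text \<open>A primitive idempotent has the value one under exactly one character. Orthogonality
  makes this assignment injective, the sum \<open>\<one>\<close> makes it surjective, and
  \<open>f\<close> agrees with \<open>e (\<beta> f)\<close> under all characters.\<close>

lemma primitive_system_chi:
  assumes "complete_primitive_system A E"
  shows "\<exists>\<beta>. bij_betw \<beta> E P \<and> (\<forall>f \<in> E. f \<in> carrier A \<and> f \<ominus> e (\<beta> f) \<in> J)"
proof -
  have fin: "finite E" and prim: "\<And>f. f \<in> E \<Longrightarrow> primitive_idempotent A f"
    and orth: "\<And>f g. f \<in> E \<Longrightarrow> g \<in> E \<Longrightarrow> f \<noteq> g \<Longrightarrow> f \<otimes> g = \<zero>"
    and sum: "finsum A (\<lambda>e. e) E = \<one>"
    using assms by (auto simp: complete_primitive_system_def)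
  have idem: "idempotent_elem A f" "f \<in> carrier A" "f \<noteq> \<zero>" if "f \<in> E" for f
    using prim[OF that] by (auto simp: primitive_idempotent_def idempotent_elem_def)
  have "\<exists>p. p \<in> P \<and> chi p f = \<one>\<^bsub>k\<^esub>" if "f \<in> E" for f
    using idempotent_chi_one idem that by blast
  then obtain \<beta> where \<beta>: "\<And>f. f \<in> E \<Longrightarrow> \<beta> f \<in> P \<and> chi (\<beta> f) f = \<one>\<^bsub>k\<^esub>" by metis
  have chi: "chi p f = (if p = \<beta> f then \<one>\<^bsub>k\<^esub> else \<zero>\<^bsub>k\<^esub>)" if "f \<in> E" "p \<in> P" for f p
    using chi_idempotent[OF idem(1)[OF that(1)] that(2)] \<beta>[OF that(1)]
      primitive_chi_unique[OF prim[OF that(1)] that(2)] by auto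
  have "inj_on \<beta> E"
  proof (rule inj_onI, rule ccontr)
    fix f g assume fg: "f \<in> E" "g \<in> E" "\<beta> f = \<beta> g" "f \<noteq> g"
    then have "chi (\<beta> f) (f \<otimes> g) = \<zero>\<^bsub>k\<^esub>" using orth \<beta> by simp
    then show False using fg idem \<beta>[OF fg(1)] \<beta>[OF fg(2)] by simp
  qed
  moreover have "\<beta> ` E = P"
  proof
    show "\<beta> ` E \<subseteq> P" using \<beta> by auto
    show "P \<subseteq> \<beta> ` E"
    proof (rule subsetI, rule ccontr)
      fix p assume p: "p \<in> P" "p \<notin> \<beta> ` E"
      have "chi p (finsum A (\<lambda>e. e) E) = (\<Oplus>\<^bsub>k\<^esub>f\<in>E. chi p f)"
        using p idem by (intro chi_finsum fin) auto
      also have "\<dots> = \<zero>\<^bsub>k\<^esub>" using p chi by (intro k.add.finprod_one_eqI) auto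
      finally show False using sum p by simp
    qed
  qed
  moreover have "f \<ominus> e (\<beta> f) \<in> J" if "f \<in> E" for f
    using that idem \<beta> by (auto simp: J_def chi chi_e k.minus_eq k.r_neg)
  ultimately show ?thesis using idem by (auto simp: bij_betw_def)
qed

section \<open>The quotient by the radical and the arrow numbers\<close>

lemma map_chi_ring_hom:
  "set ps \<subseteq> P \<Longrightarrow> (\<lambda>a. map (\<lambda>p. chi p a) ps) \<in> ring_hom A (RDirProd_list (replicate (length ps) k))"
proof (induction ps)
  case Nil
  show ?case by (auto intro!: ring_hom_memI simp: monoid.defs)
next
  case (Cons p ps)
  let ?S = "RDirProd_list (replicate (length ps) k)"
  have IH: "(\<lambda>a. map (\<lambda>p. chi p a) ps) \<in> ring_hom A ?S" using Cons by simp
  have p: "p \<in> P" using Cons by simp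
  have "(\<lambda>a. (chi p a, map (\<lambda>p. chi p a) ps)) \<in> ring_hom A (RDirProd k ?S)"
    using ring_hom_memE[OF IH] p
    by (intro ring_hom_memI) (auto simp: RDirProd_def DirProd_def monoid.defs)
  from ring_hom_trans[OF this RDirProd_list_hom1]
  show ?case by (simp add: comp_def)
qed

text \<open>The list of all characters is a homomorphism with kernel \<open>J\<close>; it is onto
  because a vector of scalars is attained on the corresponding combination of the
  \<open>e p\<close>.\<close>

lemma split_basic:
  assumes "finite_dimension (scalars k A) (carrier A)"
  shows "split_basic k A"
proof -
  obtain ps where ps: "set ps = P" "distinct ps" using finite_P finite_distinct_list by blast
  let ?S = "RDirProd_list (replicate (length ps) k)"
  define h where "h a = map (\<lambda>p. chi p a) ps" for a
  have hom: "h \<in> ring_hom A ?S" using map_chi_ring_hom[of ps] ps by (simp add: h_def[abs_def])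
  have ringS: "ring ?S" by (rule RDirProd_list_is_ring) (simp add: k.ring_axioms)
  have hr: "ring_hom_ring A ?S h"
    by (rule ring_hom_ringI2[OF ring_axioms ringS hom])
  have zero: "\<zero>\<^bsub>RDirProd_list (replicate n k)\<^esub> = replicate n \<zero>\<^bsub>k\<^esub>" for n
    by (induction n) (auto simp: RDirProd_list_zero monoid.defs)
  have "(map (\<lambda>p. chi p a) ps = replicate (length ps) \<zero>\<^bsub>k\<^esub>) \<longleftrightarrow> (\<forall>p \<in> set ps. chi p a = \<zero>\<^bsub>k\<^esub>)" for a
    by (induction ps) auto
  then have ker: "a_kernel A ?S h = J"
    by (auto simp: a_kernel_def kernel_def zero h_def J_def ps(1))
  have surj: "h ` carrier A = carrier ?S"
  proof
    show "h ` carrier A \<subseteq> carrier ?S" using ring_hom_memE(1)[OF hom] by auto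
    show "carrier ?S \<subseteq> h ` carrier A"
    proof
      fix xs assume xs: "xs \<in> carrier ?S"
      have len: "length xs = length ps" and mem: "\<And>i. i < length ps \<Longrightarrow> xs ! i \<in> carrier k"
        using RDirProd_list_carrier_mem[OF xs] by auto
      \<comment> \<open>The entry of \<open>xs\<close> at the position of \<open>p\<close> in
        \<open>ps\<close>, unambiguous because \<open>ps\<close> is distinct.\<close>
      define c where "c p = the (map_of (zip ps xs) p)" for p
      have c: "c (ps ! i) = xs ! i" if "i < length ps" for i
        using that len ps(2) by (simp add: c_def map_of_zip_nth)
      then have cc: "c \<in> P \<rightarrow> carrier k" using mem ps(1) by (auto simp: in_set_conv_nth)
      let ?a = "\<Oplus>q\<in>P. c q \<odot> e q"
      have "h ?a = map c ps"
        unfolding h_def using chi_sum_e[OF _ subset_refl cc] ps(1) by auto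
      also have "map c ps = xs" using c len by (auto simp: list_eq_iff_nth_eq)
      finally have "h ?a = xs" .
      moreover have "?a \<in> carrier A" using cc by (intro finsum_closed) auto
      ultimately show "xs \<in> h ` carrier A" by blast
    qed
  qed
  define \<phi> where "\<phi> C = the_elem (h ` C)" for C
  have iso: "\<phi> \<in> ring_iso (A Quot J) ?S"
    using ring_hom_ring.FactRing_iso_set[OF hr surj] by (simp add: ker \<phi>_def[abs_def])
  have \<phi>: "\<phi> (J +> a) = h a" if a: "a \<in> carrier A" for a
  proof -
    have J0: "\<zero> \<in> J" by (simp add: J_def)
    have "h ` (J +> a) = {h a}"
    proof
      show "h ` (J +> a) \<subseteq> {h a}"
        using a ps(1) by (auto simp: a_r_coset_def' h_def J_def)
      show "{h a} \<subseteq> h ` (J +> a)"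
        using J0 a l_zero[OF a] by (force simp: a_r_coset_def')
    qed
    then show ?thesis by (simp add: \<phi>_def)
  qed
  have "\<exists>\<phi> \<in> ring_iso (A Quot jacobson_radical A) ?S.
      \<forall>c \<in> carrier k. \<forall>a \<in> carrier A.
        \<phi> (jacobson_radical A +> (c \<odot> a)) =
          map (\<lambda>t. c \<otimes>\<^bsub>k\<^esub> t) (\<phi> (jacobson_radical A +> a))"
  proof (rule bexI[of _ \<phi>])
    show "\<phi> \<in> ring_iso (A Quot jacobson_radical A) ?S" using iso by (simp add: jacobson_radical_eq)
    show "\<forall>c \<in> carrier k. \<forall>a \<in> carrier A. \<phi> (jacobson_radical A +> (c \<odot> a)) =
          map (\<lambda>t. c \<otimes>\<^bsub>k\<^esub> t) (\<phi> (jacobson_radical A +> a))"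
      using ps(1) by (auto simp: jacobson_radical_eq \<phi> h_def chi_smult)
  qed
  then show ?thesis using assms assoc_algebra unfolding split_basic_def by blast
qed

text \<open>For \<open>x\<close> in \<open>J\<close>, changing either idempotent by an element of
  \<open>J\<close> changes \<open>b \<otimes> x \<otimes> a\<close> by an element of
  \<open>J \<cdot> J\<close>. Together with \<open>primitive_system_chi\<close> this reduces every
  complete system to the \<open>e p\<close>.\<close>

lemma arrow_number_cong:
  assumes "a \<in> carrier A" "a' \<in> carrier A" "b \<in> carrier A" "b' \<in> carrier A"
    and "a \<ominus> a' \<in> J" "b \<ominus> b' \<in> J"
  shows "arrow_number k A a b = arrow_number k A a' b'"
proof -
  have "J \<cdot> J +> (b \<otimes> x \<otimes> a) = J \<cdot> J +> (b' \<otimes> x \<otimes> a')" if x: "x \<in> J" for x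
  proof -
    have xc: "x \<in> carrier A" using x by (rule J_carrier)
    have can: "u \<ominus> v \<oplus> (v \<ominus> w) = u \<ominus> w" if "u \<in> carrier A" "v \<in> carrier A" "w \<in> carrier A" for u v w
      using that by (simp add: a_minus_def a_assoc r_neg1)
    have "(b \<ominus> b') \<otimes> (x \<otimes> a) \<in> J \<cdot> J" "(b' \<otimes> x) \<otimes> (a \<ominus> a') \<in> J \<cdot> J"
      using assms x J_mult by (auto intro: ideal_prod.prod)
    then have "(b \<ominus> b') \<otimes> (x \<otimes> a) \<oplus> (b' \<otimes> x) \<otimes> (a \<ominus> a') \<in> J \<cdot> J" by (rule ideal_prod.sum)
    moreover have "(b \<ominus> b') \<otimes> (x \<otimes> a) = b \<otimes> x \<otimes> a \<ominus> b' \<otimes> x \<otimes> a"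
      using assms xc by (simp add: a_minus_def l_distr l_minus m_assoc)
    moreover have "(b' \<otimes> x) \<otimes> (a \<ominus> a') = b' \<otimes> x \<otimes> a \<ominus> b' \<otimes> x \<otimes> a'"
      using assms xc by (simp add: a_minus_def r_distr r_minus)
    ultimately have "b \<otimes> x \<otimes> a \<ominus> b' \<otimes> x \<otimes> a' \<in> J \<cdot> J"
      using can assms xc by simp
    then show ?thesis using quotient_eq_iff_same_a_r_cos[OF ideal_J2] assms xc by simp
  qed
  then show ?thesis
    unfolding arrow_number_def jacobson_radical_eq Let_def by (metis (no_types, lifting) image_cong)
qed

text \<open>The only danger is that the quotient is zero; any character shows that
  \<open>\<one>\<close> is not in \<open>J\<close> and hence not in
  \<open>J \<cdot> J\<close>.\<close>

lemma quotient_scalars_subfield: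
  assumes "P \<noteq> {}"
  shows "subfield ((\<lambda>c. J \<cdot> J +> c) ` scalars k A) (A Quot (J \<cdot> J))"
proof -
  let ?Q = "A Quot (J \<cdot> J)"
  have ringQ: "ring ?Q" by (rule ideal.quotient_is_ring[OF ideal_J2])
  have h1: "(\<lambda>c. c \<odot> \<one>) \<in> ring_hom k A"
    using scalar_ring_hom by (simp add: ring_hom_ring_def ring_hom_ring_axioms_def)
  have "(\<lambda>c. J \<cdot> J +> c) \<circ> (\<lambda>c. c \<odot> \<one>) \<in> ring_hom k ?Q"
    by (rule ring_hom_trans[OF h1 ideal.rcos_ring_hom[OF ideal_J2]])
  then have hr: "ring_hom_ring k ?Q ((\<lambda>c. J \<cdot> J +> c) \<circ> (\<lambda>c. c \<odot> \<one>))"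
    by (rule ring_hom_ringI2[OF k.ring_axioms ringQ])
  obtain p where p: "p \<in> P" using assms by blast
  have "\<one> \<notin> J \<cdot> J"
  proof
    assume "\<one> \<in> J \<cdot> J"
    then have "\<one> \<in> J" using J2_subset by blast
    then show False using p by (simp add: J_def)
  qed
  then have "J \<cdot> J +> \<one> \<noteq> J \<cdot> J"
    using abelian_subgroup.a_rcos_self[OF abelian_subgroupI3[OF ideal.axioms(1)[OF ideal_J2] is_abelian_group]] by fastforce
  then have "\<one>\<^bsub>?Q\<^esub> \<noteq> \<zero>\<^bsub>?Q\<^esub>" by (simp add: FactRing_def)
  from ring_hom_ring.img_is_subfield(2)[OF hr k.carrier_is_subfield this]
  show ?thesis by (simp add: scalars_def image_comp)
qed

lemma arrow_number_eq:
  "arrow_number k A a b = ring.dim (A Quot (J \<cdot> J)) ((\<lambda>c. J \<cdot> J +> c) ` scalars k A)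
    ((\<lambda>x. J \<cdot> J +> (b \<otimes> x \<otimes> a)) ` J)"
  by (simp add: arrow_number_def Let_def jacobson_radical_eq)

lemma zero_in_J: "\<zero> \<in> J"
  by (simp add: J_def)

lemma arrow_number_zero:
  assumes "p \<in> P" "q \<in> P" "\<And>x. x \<in> J \<Longrightarrow> e q \<otimes> x \<otimes> e p \<in> J \<cdot> J"
  shows "arrow_number k A (e p) (e q) = 0"
proof -
  let ?Q = "A Quot (J \<cdot> J)"
  interpret Q: ring ?Q by (rule ideal.quotient_is_ring[OF ideal_J2])
  have "J \<cdot> J +> (e q \<otimes> x \<otimes> e p) = J \<cdot> J" if "x \<in> J" for x
    using assms(3)[OF that] a_rcos_zero[OF ideal_J2] by blast
  then have "(\<lambda>x. J \<cdot> J +> (e q \<otimes> x \<otimes> e p)) ` J = {\<zero>\<^bsub>?Q\<^esub>}"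
    using zero_in_J by (auto simp: FactRing_def)
  moreover have "Q.dim ((\<lambda>c. J \<cdot> J +> c) ` scalars k A) {\<zero>\<^bsub>?Q\<^esub>} = 0"
    using Q.dimI[OF quotient_scalars_subfield Q.zero_dim] assms(1) by (auto simp: over_def)
  ultimately show ?thesis by (simp add: arrow_number_eq)
qed

text \<open>Modulo \<open>J \<cdot> J\<close> the corner is the line through the coset of
  \<open>r\<close>, which is not zero.\<close>

lemma arrow_number_one:
  assumes "p \<in> P" "q \<in> P" "r \<in> J" "e q \<otimes> r \<otimes> e p = r" "r \<notin> J \<cdot> J"
    and "\<And>x. x \<in> J \<Longrightarrow> \<exists>c \<in> carrier k. e q \<otimes> x \<otimes> e p \<ominus> c \<odot> r \<in> J \<cdot> J"
  shows "arrow_number k A (e p) (e q) = 1"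
proof -
  let ?Q = "A Quot (J \<cdot> J)" and ?K = "(\<lambda>c. J \<cdot> J +> c) ` scalars k A" and ?r = "J \<cdot> J +> r"
  interpret Q: ring ?Q by (rule ideal.quotient_is_ring[OF ideal_J2])
  have rc: "r \<in> carrier A" using assms(3) by (rule J_carrier)
  have hom: "(\<lambda>c. J \<cdot> J +> c) \<in> ring_hom A ?Q" by (rule ideal.rcos_ring_hom[OF ideal_J2])
  \<comment> \<open>The shape that membership in a \<open>line_extension\<close> of the zero space
    takes: a scalar times the coset, plus zero.\<close>
  have sc: "(J \<cdot> J +> (c \<odot> \<one>)) \<otimes>\<^bsub>?Q\<^esub> ?r \<oplus>\<^bsub>?Q\<^esub> \<zero>\<^bsub>?Q\<^esub> = J \<cdot> J +> (c \<odot> r)" if "c \<in> carrier k" for c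
    using that rc ring_hom_memE(1,2)[OF hom] Q.r_zero scalar_mult
    by (metis one_closed smult_closed)
  have rQ: "?r \<in> carrier ?Q" by (rule ring_hom_memE(1)[OF hom rc])
  have "?r \<noteq> \<zero>\<^bsub>?Q\<^esub>"
    using assms(5) rc abelian_subgroup.a_rcos_self[OF abelian_subgroupI3[OF ideal.axioms(1)[OF ideal_J2] is_abelian_group]]
    by (fastforce simp: FactRing_def)
  then have "Q.dimension (Suc 0) ?K (Q.line_extension ?K ?r {\<zero>\<^bsub>?Q\<^esub>})"
    using rQ by (intro Q.Suc_dim Q.zero_dim) auto
  then have "Q.dim ?K (Q.line_extension ?K ?r {\<zero>\<^bsub>?Q\<^esub>}) = 1"
    using Q.dimI[OF quotient_scalars_subfield] assms(1) by (auto simp: over_def)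
  moreover have "(\<lambda>x. J \<cdot> J +> (e q \<otimes> x \<otimes> e p)) ` J = Q.line_extension ?K ?r {\<zero>\<^bsub>?Q\<^esub>}"
  proof (intro equalityI subsetI)
    fix Y assume "Y \<in> (\<lambda>x. J \<cdot> J +> (e q \<otimes> x \<otimes> e p)) ` J"
    then obtain x where x: "x \<in> J" "Y = J \<cdot> J +> (e q \<otimes> x \<otimes> e p)" by blast
    obtain c where c: "c \<in> carrier k" "e q \<otimes> x \<otimes> e p \<ominus> c \<odot> r \<in> J \<cdot> J" using assms(6)[OF x(1)] by blast
    then have "Y = J \<cdot> J +> (c \<odot> r)"
      using quotient_eq_iff_same_a_r_cos[OF ideal_J2] x rc assms(1,2) J_carrier by simp
    then show "Y \<in> Q.line_extension ?K ?r {\<zero>\<^bsub>?Q\<^esub>}"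
      unfolding Q.line_extension_mem_iff using sc[OF c(1)] c(1) by (auto simp: scalars_def)
  next
    fix Y assume "Y \<in> Q.line_extension ?K ?r {\<zero>\<^bsub>?Q\<^esub>}"
    then obtain c where c: "c \<in> carrier k" "Y = J \<cdot> J +> (c \<odot> r)"
      unfolding Q.line_extension_mem_iff using sc by (auto simp: scalars_def)
    have "c \<odot> r = (c \<odot> \<one>) \<otimes> r" using c rc by (simp add: scalar_mult)
    then have "c \<odot> r \<in> J" using J_mult(2)[OF assms(3)] c by simp
    moreover have "e q \<otimes> (c \<odot> r) \<otimes> e p = c \<odot> r"
      using c rc assms(1,2,4) by (simp add: smult_mult_left smult_mult_right)
    ultimately show "Y \<in> (\<lambda>x. J \<cdot> J +> (e q \<otimes> x \<otimes> e p)) ` J" using c(2) by (intro image_eqI[of _ _ "c \<odot> r"]) simp_all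
  qed
  ultimately show ?thesis by (simp add: arrow_number_eq)
qed

end

text \<open>The arrows out of \<open>p\<close> are required to generate the kernel times
  \<open>e p\<close> as a left module. As \<open>adj\<close> lowers \<open>len\<close> by one,
  nilpotency of the kernel follows and is not among the assumptions.\<close>

locale quiver_data = dual_characters k A P chi e
  for k :: "('k, 'm) ring_scheme" and A :: "('k, 'a) module" (structure)
    and P :: "'p set" and chi :: "'p \<Rightarrow> 'a \<Rightarrow> 'k" and e :: "'p \<Rightarrow> 'a" +
  fixes len :: "'p \<Rightarrow> nat" and adj :: "'p \<Rightarrow> 'p \<Rightarrow> bool" and r :: "'p \<Rightarrow> 'p \<Rightarrow> 'a"
  assumes adj_len: "adj p q \<Longrightarrow> len p = Suc (len q)"
    and r_closed: "p \<in> P \<Longrightarrow> q \<in> P \<Longrightarrow> adj p q \<Longrightarrow> r p q \<in> carrier A"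
    and r_left: "p \<in> P \<Longrightarrow> q \<in> P \<Longrightarrow> adj p q \<Longrightarrow> e q \<otimes> r p q = r p q"
    and r_right: "p \<in> P \<Longrightarrow> q \<in> P \<Longrightarrow> adj p q \<Longrightarrow> r p q \<otimes> e p = r p q"
    and r_nonzero: "p \<in> P \<Longrightarrow> q \<in> P \<Longrightarrow> adj p q \<Longrightarrow> r p q \<noteq> \<zero>"
    and J_generated: "a \<in> carrier A \<Longrightarrow> (\<And>p. p \<in> P \<Longrightarrow> chi p a = \<zero>\<^bsub>k\<^esub>) \<Longrightarrow> p \<in> P \<Longrightarrow>
      \<exists>b. (\<forall>q. b q \<in> carrier A) \<and> a \<otimes> e p = (\<Oplus>q\<in>{q \<in> P. adj p q}. b q \<otimes> r p q)"
begin

section \<open>Nilpotency and corners from generating arrows\<close>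

definition succs :: "'p \<Rightarrow> 'p set" where
  "succs p = {q \<in> P. adj p q}"

lemma succs [simp]: "finite (succs p)" "q \<in> succs p \<Longrightarrow> q \<in> P" "q \<in> succs p \<Longrightarrow> adj p q"
  by (auto simp: succs_def)

lemma r_succs_closed [simp]: "p \<in> P \<Longrightarrow> q \<in> succs p \<Longrightarrow> r p q \<in> carrier A"
  by (simp add: r_closed)

lemma J_succs:
  assumes "j \<in> J" "p \<in> P"
  obtains b where "\<And>q. b q \<in> carrier A" "j \<otimes> e p = (\<Oplus>q\<in>succs p. b q \<otimes> r p q)"
proof -
  have "j \<in> carrier A" "\<And>p. p \<in> P \<Longrightarrow> chi p j = \<zero>\<^bsub>k\<^esub>" using assms by (auto simp: J_def)
  from J_generated[OF this assms(2)]
  obtain b where "\<forall>q. b q \<in> carrier A" "j \<otimes> e p = (\<Oplus>q\<in>succs p. b q \<otimes> r p q)"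
    unfolding succs_def by blast
  then show thesis using that by blast
qed

lemma sum_mult_e:
  assumes "a \<in> carrier A"
  shows "a = (\<Oplus>p\<in>P. a \<otimes> e p)"
proof -
  have "a \<otimes> (\<Oplus>p\<in>P. e p) = (\<Oplus>p\<in>P. a \<otimes> e p)"
    using assms by (intro finsum_rdistr) auto
  then show ?thesis using assms e_sum by simp
qed

text \<open>Since \<open>r p q\<close> begins with \<open>e q\<close>, this idempotent can be
  inserted before it. The coefficients then end in \<open>e q\<close>, which is where inductions on
  \<open>len\<close> apply.\<close>

lemma mult_succs:
  assumes "a \<in> carrier A" "p \<in> P" "\<And>q. b q \<in> carrier A"
  shows "a \<otimes> (\<Oplus>q\<in>succs p. b q \<otimes> r p q) = (\<Oplus>q\<in>succs p. (a \<otimes> b q \<otimes> e q) \<otimes> r p q)"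
proof -
  have "a \<otimes> (\<Oplus>q\<in>succs p. b q \<otimes> r p q) = (\<Oplus>q\<in>succs p. a \<otimes> (b q \<otimes> r p q))"
    using assms by (intro finsum_rdistr) auto
  also have "\<dots> = (\<Oplus>q\<in>succs p. (a \<otimes> b q \<otimes> e q) \<otimes> r p q)"
    using assms r_left by (intro finsum_cong') (auto simp: m_assoc)
  finally show ?thesis .
qed

text \<open>Products of one arbitrary element with \<open>m\<close> elements of \<open>J\<close>,
  without forming sums: this suffices for the powers of a single element and permits induction on
  the last factor.\<close>

primrec J_power :: "nat \<Rightarrow> 'a set" where
  "J_power 0 = carrier A"
| "J_power (Suc m) = {a \<otimes> j | a j. a \<in> J_power m \<and> j \<in> J}"

lemma J_power_closed: "a \<in> J_power m \<Longrightarrow> a \<in> carrier A"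
  by (induction m arbitrary: a) (auto dest: J_carrier)

lemma J_power_mult: "a \<in> J_power m \<Longrightarrow> b \<in> carrier A \<Longrightarrow> a \<otimes> b \<in> J_power m"
proof (cases m)
  case (Suc n)
  assume "a \<in> J_power m" and b: "b \<in> carrier A"
  then obtain a' j where "a = a' \<otimes> j" "a' \<in> J_power n" "j \<in> J" using Suc by auto
  then have "a \<otimes> b = a' \<otimes> (j \<otimes> b)" "j \<otimes> b \<in> J"
    using b J_power_closed J_carrier J_mult(1) by (auto simp: m_assoc)
  then show ?thesis using Suc \<open>a' \<in> J_power n\<close> by auto
qed auto

text \<open>The last factor from \<open>J\<close> leads along arrows from \<open>p\<close> to some
  \<open>q\<close> with smaller \<open>len\<close>, where one factor less remains; more than
  \<open>len p\<close> factors exhaust all paths.\<close>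

lemma J_power_e: "p \<in> P \<Longrightarrow> len p < m \<Longrightarrow> a \<in> J_power m \<Longrightarrow> a \<otimes> e p = \<zero>"
proof (induction m arbitrary: p a)
  case 0
  then show ?case by simp
next
  case (Suc m)
  then obtain a' j where a: "a = a' \<otimes> j" "a' \<in> J_power m" "j \<in> J" by auto
  obtain b where b: "\<And>q. b q \<in> carrier A" "j \<otimes> e p = (\<Oplus>q\<in>succs p. b q \<otimes> r p q)"
    using J_succs[OF a(3) Suc.prems(1)] by blast
  have ac: "a' \<in> carrier A" "j \<in> carrier A" using a J_power_closed J_carrier by auto
  have "a \<otimes> e p = (\<Oplus>q\<in>succs p. (a' \<otimes> b q \<otimes> e q) \<otimes> r p q)"
    using a ac Suc.prems b mult_succs by (simp add: m_assoc)
  also have "\<dots> = \<zero>"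
  proof (rule add.finprod_one_eqI)
    fix q assume q: "q \<in> succs p"
    have "a' \<otimes> b q \<otimes> e q = \<zero>"
      using q Suc.prems adj_len[of p q] b(1) a(2) by (intro Suc.IH J_power_mult) auto
    then show "a' \<otimes> b q \<otimes> e q \<otimes> r p q = \<zero>" using q Suc.prems by simp
  qed
  finally show ?case .
qed

lemma J_nilpotent_aux:
  assumes j: "j \<in> J"
  shows "\<exists>N::nat. j [^] N = \<zero>"
proof -
  have mem: "j [^] m \<in> J_power m" for m :: nat
    by (induction m) (use j in auto)
  obtain N where N: "\<And>p. p \<in> P \<Longrightarrow> len p < N"
    using finite_nat_set_iff_bounded[of "len ` P"] by auto
  have "j [^] N = (\<Oplus>p\<in>P. j [^] N \<otimes> e p)"
    using j by (intro sum_mult_e) (auto dest: J_carrier)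
  also have "\<dots> = \<zero>" by (intro add.finprod_one_eqI J_power_e[OF _ N mem])
  finally show ?thesis by blast
qed

sublocale nilpotent_dual_characters k A P chi e
  by unfold_locales (rule J_nilpotent_aux)

text \<open>Expanding \<open>j \<otimes> e p\<close> in arrows leaves coefficients in corners
  between \<open>q\<close> and some \<open>s\<close> with \<open>len s < len q\<close>. These are
  off the diagonal, hence in \<open>J\<close>, and vanish by induction.\<close>

lemma J_corner_zero:
  "p \<in> P \<Longrightarrow> q \<in> P \<Longrightarrow> len p \<le> len q \<Longrightarrow> j \<in> J \<Longrightarrow> e q \<otimes> j \<otimes> e p = \<zero>"
proof (induction "len p" arbitrary: p j rule: less_induct)
  case less
  obtain b where b: "\<And>q. b q \<in> carrier A" "j \<otimes> e p = (\<Oplus>q\<in>succs p. b q \<otimes> r p q)"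
    using J_succs less.prems by blast
  have jc: "j \<in> carrier A" using less.prems J_carrier by simp
  have "e q \<otimes> j \<otimes> e p = (\<Oplus>s\<in>succs p. (e q \<otimes> b s \<otimes> e s) \<otimes> r p s)"
    using less.prems jc b mult_succs by (simp add: m_assoc)
  also have "\<dots> = \<zero>"
  proof (rule add.finprod_one_eqI)
    fix s assume s: "s \<in> succs p"
    then have len: "len p = Suc (len s)" and sP: "s \<in> P" using adj_len by auto
    let ?x = "e q \<otimes> b s \<otimes> e s"
    have xc: "?x \<in> carrier A" using less.prems sP b by simp
    have "s \<noteq> q" using len less.prems by auto
    then have "?x \<in> J" using corner_decomposition[OF sP less.prems(2) b(1)[of s]] xc
      by (simp add: a_minus_def)
    then have "e q \<otimes> ?x \<otimes> e s = \<zero>" using less.hyps[of s] len sP less.prems by simp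
    moreover have "e q \<otimes> ?x \<otimes> e s = ?x"
    proof -
      have "e q \<otimes> ?x \<otimes> e s = (e q \<otimes> e q) \<otimes> b s \<otimes> (e s \<otimes> e s)"
        using less.prems sP b(1) by (simp only: m_assoc m_closed e_closed)
      then show ?thesis using less.prems sP by (simp add: e_mult)
    qed
    ultimately show "?x \<otimes> r p s = \<zero>" using s less.prems by simp
  qed
  finally show ?case .
qed

text \<open>Inserting the sum of all \<open>e s\<close> between the two factors gives products of
  two corners. No \<open>s\<close> lies strictly between \<open>q\<close> and \<open>p\<close> in
  \<open>len\<close>, so one of the corners is zero by \<open>J_corner_zero\<close>.\<close>

lemma J2_corner_zero:
  assumes "p \<in> P" "q \<in> P" "len p = Suc (len q)" "z \<in> J \<cdot> J"
  shows "e q \<otimes> z \<otimes> e p = \<zero>"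
  using assms(4)
proof (induction z rule: ideal_prod.induct)
  case (prod i j)
  then have c: "i \<in> carrier A" "j \<in> carrier A" by (auto dest: J_carrier)
  have "i = (\<Oplus>s\<in>P. i \<otimes> e s)" using c by (intro sum_mult_e)
  then have "e q \<otimes> (i \<otimes> j) \<otimes> e p = e q \<otimes> ((\<Oplus>s\<in>P. i \<otimes> e s) \<otimes> (j \<otimes> e p))"
    using c assms by (simp add: m_assoc)
  also have "(\<Oplus>s\<in>P. i \<otimes> e s) \<otimes> (j \<otimes> e p) = (\<Oplus>s\<in>P. (i \<otimes> e s) \<otimes> (j \<otimes> e p))"
    using c assms by (intro finsum_ldistr) auto
  also have "e q \<otimes> \<dots> = (\<Oplus>s\<in>P. e q \<otimes> ((i \<otimes> e s) \<otimes> (j \<otimes> e p)))"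
    using c assms by (intro finsum_rdistr) auto
  also have "\<dots> = \<zero>"
  proof (rule add.finprod_one_eqI)
    fix s assume s: "s \<in> P"
    have "e q \<otimes> ((i \<otimes> e s) \<otimes> (j \<otimes> e p)) = (e q \<otimes> i \<otimes> e s) \<otimes> (e s \<otimes> j \<otimes> e p)"
    proof -
      have "(e q \<otimes> i \<otimes> e s) \<otimes> (e s \<otimes> j \<otimes> e p) = e q \<otimes> (i \<otimes> (e s \<otimes> e s) \<otimes> (j \<otimes> e p))"
        using c assms s by (simp only: m_assoc m_closed e_closed)
      then show ?thesis using s by (simp add: e_mult)
    qed
    moreover have "e q \<otimes> i \<otimes> e s = \<zero> \<or> e s \<otimes> j \<otimes> e p = \<zero>"
    proof (cases "len s \<le> len q")
      case True
      then show ?thesis using J_corner_zero[OF s assms(2) _ prod(1)] by simp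
    next
      case False
      then show ?thesis using J_corner_zero[OF assms(1) s _ prod(2)] assms(3) by simp
    qed
    ultimately show "e q \<otimes> ((i \<otimes> e s) \<otimes> (j \<otimes> e p)) = \<zero>" using s assms c by auto
  qed
  finally show ?case .
next
  case (sum a b)
  then have "a \<in> carrier A" "b \<in> carrier A"
    using J2_subset J_carrier by blast+
  then show ?case using sum assms by (simp add: l_distr r_distr)
qed

lemma r_in_J:
  assumes "p \<in> P" "q \<in> P" "adj p q"
  shows "r p q \<in> J"
proof -
  have ne: "p \<noteq> q" using adj_len[OF assms(3)] by auto
  have "chi s (r p q) = \<zero>\<^bsub>k\<^esub>" if s: "s \<in> P" for s
  proof (cases "s = q")
    case True
    have "chi s (r p q \<otimes> e p) = \<zero>\<^bsub>k\<^esub>" using True ne s assms r_closed by (simp add: chi_e)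
    then show ?thesis using r_right assms by simp
  next
    case False
    have "chi s (e q \<otimes> r p q) = \<zero>\<^bsub>k\<^esub>" using False s assms r_closed by (simp add: chi_e)
    then show ?thesis using r_left assms by simp
  qed
  then show ?thesis using assms r_closed by (simp add: J_def)
qed

lemma r_not_in_J2:
  assumes "p \<in> P" "q \<in> P" "adj p q"
  shows "r p q \<notin> J \<cdot> J"
  using J2_corner_zero[OF assms(1,2) adj_len[OF assms(3)], of "r p q"]
    r_left[OF assms] r_right[OF assms] r_nonzero[OF assms] by auto

text \<open>The coefficient of \<open>r p s\<close> in the corner is, modulo \<open>J\<close>, a
  multiple of \<open>e q\<close> if \<open>s = q\<close> and zero otherwise; elements of
  \<open>J\<close> times an arrow lie in \<open>J \<cdot> J\<close>. The scalar is the value of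
  \<open>chi q\<close> on the coefficient.\<close>

lemma J_corner_mod_J2:
  assumes "p \<in> P" "q \<in> P" "x \<in> J"
  shows "\<exists>c \<in> carrier k. e q \<otimes> x \<otimes> e p \<ominus> (if adj p q then c \<odot> r p q else \<zero>) \<in> J \<cdot> J"
proof -
  obtain b where b: "\<And>q. b q \<in> carrier A" "x \<otimes> e p = (\<Oplus>q\<in>succs p. b q \<otimes> r p q)"
    using J_succs assms by blast
  have xc: "x \<in> carrier A" using assms J_carrier by simp
  interpret J2: ideal "J \<cdot> J" A by (rule ideal_J2)
  let ?t = "\<lambda>s. (e q \<otimes> b s \<otimes> e s) \<otimes> r p s" and ?c = "chi q (b q)"
  \<comment> \<open>The expected value of a partial sum over \<open>S\<close>, so that the
    congruence can be proved by induction on subsets of \<open>succs p\<close>.\<close>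
  let ?d = "\<lambda>S. if q \<in> S then ?c \<odot> r p q else \<zero>"
  have eq: "e q \<otimes> x \<otimes> e p = (\<Oplus>s\<in>succs p. ?t s)"
    using assms xc b mult_succs by (simp add: m_assoc)
  have tJ: "?t s \<ominus> ?d {s} \<in> J \<cdot> J" if s: "s \<in> succs p" for s
  proof -
    have sP: "s \<in> P" "adj p s" using s by auto
    note rs = r_closed[OF assms(1) sP]
    have "(e q \<otimes> b s \<otimes> e s \<ominus> (if s = q then chi s (b s) \<odot> e s else \<zero>)) \<otimes> r p s \<in> J \<cdot> J"
      using corner_decomposition[OF sP(1) assms(2) b(1)] r_in_J[OF assms(1) sP]
      by (rule ideal_prod.prod)
    moreover have "(e q \<otimes> b s \<otimes> e s \<ominus> (if s = q then chi s (b s) \<odot> e s else \<zero>)) \<otimes> r p s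
      = ?t s \<ominus> ?d {s}"
    proof (cases "s = q")
      case True
      have "e q \<otimes> b q \<otimes> e q \<in> carrier A" "chi q (b q) \<in> carrier k" "e q \<in> carrier A" using assms(2) b(1) by simp_all
      then show ?thesis
        using rs r_left[OF assms(1) sP] unfolding True
        by (simp add: a_minus_def l_distr l_minus smult_mult_left)
    next
      case False
      then show ?thesis
        using rs b(1)[of s] assms(2) sP(1) by (simp add: a_minus_def)
    qed
    ultimately show ?thesis by simp
  qed
  have "(\<Oplus>s\<in>S. ?t s) \<ominus> ?d S \<in> J \<cdot> J" if "S \<subseteq> succs p" for S
  proof -
    have "finite S" using that succs(1) by (rule finite_subset)
    then show ?thesis using that
    proof (induction S rule: finite_induct)
      case empty
      then show ?case by (simp add: a_minus_def)
    next
      case (insert s S)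
      have tc: "?t u \<in> carrier A" if "u \<in> insert s S" for u
      proof -
        have "u \<in> succs p" using that insert by blast
        then show ?thesis using assms b by simp
      qed
      have Sc: "(\<Oplus>u\<in>S. ?t u) \<in> carrier A" using tc by (intro finsum_closed) auto
      have dc: "?d T \<in> carrier A" if "T \<subseteq> succs p" for T
        using that assms b(1) by auto
      have dsum: "?d (insert s S) = ?d {s} \<oplus> ?d S"
        using insert dc[of "{s}"] dc[of S] by auto
      have "(\<Oplus>u\<in>insert s S. ?t u) \<ominus> ?d (insert s S) = (?t s \<ominus> ?d {s}) \<oplus> ((\<Oplus>u\<in>S. ?t u) \<ominus> ?d S)"
      proof -
        have four: "(y \<oplus> z) \<ominus> (v \<oplus> w) = (y \<ominus> v) \<oplus> (z \<ominus> w)"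
          if "y \<in> carrier A" "z \<in> carrier A" "v \<in> carrier A" "w \<in> carrier A" for y z v w
          using that by (simp add: a_minus_def minus_add a_ac)
        have "(\<Oplus>u\<in>insert s S. ?t u) = ?t s \<oplus> (\<Oplus>u\<in>S. ?t u)"
          using insert tc by (intro finsum_insert) auto
        then show ?thesis unfolding dsum
          using four[OF tc[of s] Sc dc[of "{s}"] dc[of S]] insert.prems by simp
      qed
      moreover have "?t s \<ominus> ?d {s} \<in> J \<cdot> J" using tJ insert.prems by blast
      ultimately show ?case using insert J2.a_closed by simp
    qed
  qed
  from this[OF subset_refl] have "e q \<otimes> x \<otimes> e p \<ominus> ?d (succs p) \<in> J \<cdot> J" by (simp only: eq)
  moreover have "?d (succs p) = (if adj p q then ?c \<odot> r p q else \<zero>)"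
    using assms(2) by (simp add: succs_def del: succs(2,3))
  moreover have "?c \<in> carrier k" using assms b by simp
  ultimately show ?thesis by (intro bexI[of _ ?c]) (simp_all only:)
qed

lemma arrow_number_e:
  assumes "p \<in> P" "q \<in> P"
  shows "arrow_number k A (e p) (e q) = (if adj p q then 1 else 0)"
proof (cases "adj p q")
  case True
  have "e q \<otimes> r p q \<otimes> e p = r p q" using r_left r_right assms True by simp
  then show ?thesis
    using arrow_number_one[OF assms r_in_J[OF assms True] _ r_not_in_J2[OF assms True]]
      J_corner_mod_J2[OF assms] True by simp
next
  case False
  have "e q \<otimes> x \<otimes> e p \<in> J \<cdot> J" if "x \<in> J" for x
    using J_corner_mod_J2[OF assms that] False assms that J_carrier[OF that] by (simp add: a_minus_def)
  then show ?thesis using arrow_number_zero[OF assms] False by simp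
qed

text \<open>The bijection of \<open>primitive_system_chi\<close> is the isomorphism on vertices, for
  any complete system.\<close>

theorem has_quiver_data:
  assumes "finite_dimension (scalars k A) (carrier A)"
  shows "has_quiver k A \<lparr>verts = P, arcs = {(p, q). p \<in> P \<and> q \<in> P \<and> adj p q}, tail = fst, head = snd\<rparr>"
    (is "has_quiver k A ?G")
  unfolding has_quiver_def
proof (intro conjI allI impI)
  show "split_basic k A" by (rule split_basic[OF assms])
  show "\<exists>E. complete_primitive_system A E" using complete_primitive_system_e by blast
  fix E assume "complete_primitive_system A E"
  then obtain \<beta> where bij: "bij_betw \<beta> E P" and E: "\<And>f. f \<in> E \<Longrightarrow> f \<in> carrier A \<and> f \<ominus> e (\<beta> f) \<in> J"
    using primitive_system_chi by blast
  have \<beta>P: "f \<in> E \<Longrightarrow> \<beta> f \<in> P" for f using bij by (auto simp: bij_betw_def)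
  have an: "arrow_number k A f g = (if adj (\<beta> f) (\<beta> g) then 1 else 0)" if "f \<in> E" "g \<in> E" for f g
    using arrow_number_cong[of f "e (\<beta> f)" g "e (\<beta> g)"] E that arrow_number_e \<beta>P by simp
  let ?H = "quiver_of_system k A E"
  \<comment> \<open>Forgetting the index of an arc is injective since all arrow numbers are at most
    one.\<close>
  define iso where "iso = \<lparr>iso_verts = \<beta>, iso_arcs = (\<lambda>(f, g, i :: nat). (\<beta> f, \<beta> g)),
    iso_head = snd, iso_tail = fst\<rparr>"
  have "wf_digraph ?H" by unfold_locales (auto simp: quiver_of_system_def)
  moreover have "inj_on (iso_verts iso) (verts ?H)"
    using bij by (simp add: iso_def quiver_of_system_def bij_betw_def)
  moreover have "inj_on (iso_arcs iso) (arcs ?H)"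
    using bij by (auto simp: iso_def quiver_of_system_def bij_betw_def an inj_on_def split: if_splits)
  ultimately have "pre_digraph.digraph_isomorphism ?H iso"
    by (auto simp: pre_digraph.digraph_isomorphism_def iso_def quiver_of_system_def)
  moreover have "?G = app_iso iso ?H"
  proof -
    have "\<beta> ` E = P" using bij by (simp add: bij_betw_def)
    moreover have "(\<lambda>(f, g, i :: nat). (\<beta> f, \<beta> g)) ` {(f, g, i). f \<in> E \<and> g \<in> E \<and> i < arrow_number k A f g}
      = {(p, q). p \<in> P \<and> q \<in> P \<and> adj p q}" (is "?L = ?R")
    proof
      show "?L \<subseteq> ?R" using \<beta>P by (auto simp: an split: if_splits)
      show "?R \<subseteq> ?L"
      proof
        fix z assume "z \<in> ?R"
        then obtain f g where "f \<in> E" "g \<in> E" "z = (\<beta> f, \<beta> g)" "adj (\<beta> f) (\<beta> g)"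
          using \<open>\<beta> ` E = P\<close> by auto
        then show "z \<in> ?L" by (intro image_eqI[of _ _ "(f, g, 0)"]) (auto simp: an)
      qed
    qed
    ultimately show ?thesis by (simp add: app_iso_def iso_def quiver_of_system_def)
  qed
  ultimately show "digraph_iso ?H ?G" unfolding digraph_iso_def by blast
qed

end

section \<open>Faces as weak orders\<close>

text \<open>Faces are handled as weak orders: a face consists of all vectors that order the
  coordinates like \<open>v\<close>. The labelling of half spaces and the order of \<open>'n\<close>
  disappear from here on.\<close>

definition vec_face :: "real ^ ('n::{finite,linorder}) \<Rightarrow> 'n region" where
  "vec_face v = {w. \<forall>i j. w $ i < w $ j \<longleftrightarrow> v $ i < v $ j}"

definition face_lt :: "('n::{finite,linorder}) region \<Rightarrow> 'n \<Rightarrow> 'n \<Rightarrow> bool" where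
  "face_lt x i j \<longleftrightarrow> (\<forall>v \<in> x. v $ i < v $ j)"

definition vec_side :: "real ^ ('n::finite) \<Rightarrow> 'n \<Rightarrow> 'n \<Rightarrow> side" where
  "vec_side v i j = (if v $ i > v $ j then Plus else if v $ i = v $ j then Zero else Minus)"

lemma half_space_iff: "v \<in> half_space i j s \<longleftrightarrow> s = vec_side v i j"
  by (cases s) (auto simp: vec_side_def)

lemma vec_side_eq_iff:
  "vec_side v i j = vec_side w i j \<longleftrightarrow> (v $ i < v $ j \<longleftrightarrow> w $ i < w $ j) \<and> (v $ j < v $ i \<longleftrightarrow> w $ j < w $ i)"
  by (auto simp: vec_side_def)

lemma vec_in_vec_face [simp]: "v \<in> vec_face v"
  by (simp add: vec_face_def)

lemma cell_iff: "v \<in> cell \<sigma> \<longleftrightarrow> (\<forall>i j. i < j \<longrightarrow> \<sigma> i j = vec_side v i j)"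
  by (auto simp: cell_def half_space_iff)

lemma cell_eq_vec_face:
  assumes "v \<in> cell \<sigma>"
  shows "cell \<sigma> = vec_face v"
proof (rule Set.set_eqI)
  fix w
  have "w \<in> cell \<sigma> \<longleftrightarrow> (\<forall>i j. i < j \<longrightarrow> vec_side v i j = vec_side w i j)"
    using assms by (auto simp: cell_iff)
  also have "\<dots> \<longleftrightarrow> w \<in> vec_face v"
  proof
    assume "w \<in> vec_face v"
    then show "\<forall>i j. i < j \<longrightarrow> vec_side v i j = vec_side w i j"
      by (auto simp: vec_face_def vec_side_eq_iff)
  next
    assume *: "\<forall>i j. i < j \<longrightarrow> vec_side v i j = vec_side w i j"
    have "w $ i < w $ j \<longleftrightarrow> v $ i < v $ j" for i j
      using *[rule_format, of i j] *[rule_format, of j i]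
      by (cases i j rule: linorder_cases) (auto simp: vec_side_eq_iff)
    then show "w \<in> vec_face v" by (simp add: vec_face_def)
  qed
  finally show "w \<in> cell \<sigma> \<longleftrightarrow> w \<in> vec_face v" .
qed

lemma vec_face_eq_cell: "vec_face v = cell (vec_side v)"
  using cell_eq_vec_face[of v "vec_side v"] by (simp add: cell_iff)

lemma faces_eq: "faces = range vec_face"
proof
  show "faces \<subseteq> range vec_face" using cell_eq_vec_face by (fastforce simp: faces_def)
  show "range vec_face \<subseteq> faces"
  proof clarify
    fix v show "vec_face v \<in> faces"
      using vec_face_eq_cell[of v] vec_in_vec_face[of v] unfolding faces_def by blast
  qed
qed

lemma vec_face_in_faces [simp]: "vec_face v \<in> faces"
  by (simp add: faces_eq)

lemma face_lt_vec_face [simp]: "face_lt (vec_face v) i j \<longleftrightarrow> v $ i < v $ j"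
  using vec_in_vec_face by (fastforce simp: face_lt_def vec_face_def)

lemma face_eqI:
  assumes "x \<in> faces" "y \<in> faces" "\<And>i j. face_lt x i j \<longleftrightarrow> face_lt y i j"
  shows "x = y"
proof -
  obtain v w where x: "x = vec_face v" and y: "y = vec_face w" using assms by (auto simp: faces_eq)
  have "v $ i < v $ j \<longleftrightarrow> w $ i < w $ j" for i j
    using assms(3)[of i j] by (simp add: x y)
  then show ?thesis by (simp add: x y vec_face_def)
qed

lemma face_side_vec_face: "face_side (vec_face v) i j = vec_side v i j"
proof -
  have "vec_face v \<subseteq> half_space i j s \<longleftrightarrow> s = vec_side v i j" for s
  proof -
    have "vec_side w i j = vec_side v i j" if "w \<in> vec_face v" for w
      using that by (auto simp: vec_face_def vec_side_eq_iff)
    then show ?thesis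
      unfolding subset_iff half_space_iff using vec_in_vec_face[of v] by metis
  qed
  then show ?thesis by (simp add: face_side_def)
qed

lemma face_lt_asym: "x \<in> faces \<Longrightarrow> face_lt x i j \<Longrightarrow> \<not> face_lt x j i"
  by (auto simp: faces_eq)

text \<open>The number of predecessors realises the order, because negative transitivity makes the
  sets of predecessors nested.\<close>

lemma strict_weak_order_vector:
  fixes L :: "'n::finite \<Rightarrow> 'n \<Rightarrow> bool"
  assumes irrefl: "\<And>i. \<not> L i i" and trans: "\<And>i j l. L i j \<Longrightarrow> L j l \<Longrightarrow> L i l"
    and neg: "\<And>i j l. L i l \<Longrightarrow> L i j \<or> L j l"
  shows "\<exists>u :: real ^ 'n. \<forall>i j. u $ i < u $ j \<longleftrightarrow> L i j"
proof -
  have less: "card {l. L l i} < card {l. L l j}" if "L i j" for i j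
  proof (rule psubset_card_mono)
    show "{l. L l i} \<subset> {l. L l j}" using that irrefl trans by blast
  qed simp
  have "card {l. L l i} < card {l. L l j} \<longleftrightarrow> L i j" for i j
  proof
    assume a: "card {l. L l i} < card {l. L l j}"
    then have "\<not> {l. L l j} \<subseteq> {l. L l i}" by (meson card_mono finite leD)
    then show "L i j" using neg by blast
  qed (rule less)
  then show ?thesis by (intro exI[of _ "\<chi> i. real (card {l. L l i})"]) simp
qed

text \<open>The product is the lexicographic combination in which \<open>y\<close> only breaks the
  ties of \<open>x\<close>. It is again a strict weak order, so the cell prescribed by the
  definition is not empty.\<close>

lemma face_mult_props:
  fixes x y :: "('n::{finite,linorder}) region"
  assumes "x \<in> faces" "y \<in> faces"
  shows face_mult_closed: "face_mult x y \<in> faces"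
    and face_lt_mult: "face_lt (face_mult x y) i j \<longleftrightarrow> face_lt x i j \<or> \<not> face_lt x j i \<and> face_lt y i j"
proof -
  obtain v w where x: "x = vec_face v" and y: "y = vec_face w" using assms by (auto simp: faces_eq)
  define L where "L i j \<longleftrightarrow> v $ i < v $ j \<or> v $ i = v $ j \<and> w $ i < w $ j" for i j
  have "\<exists>u :: (real, 'n) vec. \<forall>i j. u $ i < u $ j \<longleftrightarrow> L i j"
    by (rule strict_weak_order_vector) (auto simp: L_def)
  then obtain u :: "(real, 'n) vec" where u: "\<And>i j. u $ i < u $ j \<longleftrightarrow> L i j" by blast
  have "u \<in> cell (\<lambda>i j. if vec_side v i j \<noteq> Zero then vec_side v i j else vec_side w i j)"
    using u by (auto simp: cell_iff vec_side_def L_def) (metis not_less_iff_gr_or_eq)+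
  then have eq: "face_mult x y = vec_face u"
    unfolding face_mult_def x y face_side_vec_face by (rule cell_eq_vec_face)
  show "face_mult x y \<in> faces" by (simp add: eq)
  show "face_lt (face_mult x y) i j \<longleftrightarrow> face_lt x i j \<or> \<not> face_lt x j i \<and> face_lt y i j"
    unfolding eq by (auto simp: x y u L_def)
qed

definition face_one :: "('n::{finite,linorder}) region" where
  "face_one = cell (\<lambda>i j. Zero)"

lemma face_one_eq: "face_one = vec_face 0"
  unfolding face_one_def by (rule cell_eq_vec_face) (simp add: cell_iff vec_side_def)

lemma face_one [simp]: "face_one \<in> faces" "\<not> face_lt face_one i j"
  by (simp_all add: face_one_eq)

lemma face_mult_assoc:
  assumes "x \<in> faces" "y \<in> faces" "z \<in> faces"
  shows "face_mult (face_mult x y) z = face_mult x (face_mult y z)"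
  by (rule face_eqI) (use assms in \<open>auto simp: face_mult_closed face_lt_mult dest: face_lt_asym\<close>)

lemma face_mult_one:
  assumes "x \<in> faces"
  shows "face_mult x face_one = x" "face_mult face_one x = x"
  by (rule face_eqI; use assms in \<open>simp add: face_mult_closed face_lt_mult face_one\<close>)+

lemma finite_faces [simp]: "finite (faces :: ('n::{finite,linorder}) region set)"
proof (rule inj_on_finite)
  show "inj_on face_lt (faces :: 'n region set)"
    by (intro inj_onI face_eqI) (auto simp: fun_eq_iff)
  show "face_lt ` faces \<subseteq> (UNIV :: ('n \<Rightarrow> 'n \<Rightarrow> bool) set)" by simp
  show "finite (UNIV :: ('n \<Rightarrow> 'n \<Rightarrow> bool) set)" by simp
qed

subsection \<open>Height functions\<close>

text \<open>The blocks of a face are numbered from \<open>0\<close> in increasing order; \<open>height x i\<close> is the number of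
  the block of \<open>i\<close>.\<close>

definition height :: "('n::{finite,linorder}) region \<Rightarrow> 'n \<Rightarrow> nat" where
  "height x i = (let v = SOME v. v \<in> x in card ((\<lambda>j. v $ j) ` {j. v $ j < v $ i}))"

definition nblocks :: "('n::{finite,linorder}) region \<Rightarrow> nat" where
  "nblocks x = card (range (height x))"

lemma some_vec_face:
  assumes "x \<in> faces"
  shows "x = vec_face (SOME v. v \<in> x)"
proof -
  obtain v where v: "x = vec_face v" using assms by (auto simp: faces_eq)
  have "(SOME v. v \<in> x) \<in> x" using v someI[of "\<lambda>v. v \<in> x" v] by simp
  then show ?thesis using v by (auto simp: vec_face_def)
qed

text \<open>The rank of a value is the number of attained values below it. Ranks increase strictly
  with the value and stay below the number of attained values, so they fill an initial
  segment.\<close>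

lemma height_props:
  assumes "x \<in> faces"
  shows height_less: "height x i < height x j \<longleftrightarrow> face_lt x i j"
    and range_height: "range (height x) = {..<nblocks x}"
proof -
  define v where "v = (SOME v. v \<in> x)"
  have x: "x = vec_face v" using some_vec_face[OF assms] by (simp add: v_def)
  let ?T = "range (\<lambda>j. v $ j)" and ?c = "\<lambda>t. card {s \<in> range (\<lambda>j. v $ j). s < t}"
  have h: "height x i = ?c (v $ i)" for i
    unfolding height_def Let_def v_def[symmetric] by (rule arg_cong[of _ _ card]) auto
  have less: "?c s < ?c t" if "s < t" "s \<in> ?T" for s t
    by (rule psubset_card_mono) (use that in auto)
  have "face_lt x i j \<longleftrightarrow> v $ i < v $ j" by (subst x) simp
  then show "height x i < height x j \<longleftrightarrow> face_lt x i j"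
    using less[of "v $ i" "v $ j"] less[of "v $ j" "v $ i"] h
    by (cases "v $ i" "v $ j" rule: linorder_cases) auto
  have inj: "inj_on ?c ?T"
  proof (rule inj_onI)
    fix s t assume "s \<in> ?T" "t \<in> ?T" "?c s = ?c t"
    then show "s = t" using less[of s t] less[of t s] by (cases s t rule: linorder_cases) auto
  qed
  have "?c ` ?T \<subseteq> {..<card ?T}"
  proof
    fix p assume "p \<in> ?c ` ?T"
    then obtain t where t: "p = ?c t" "t \<in> ?T" by blast
    have "?c t < card ?T" by (rule psubset_card_mono) (use t in auto)
    then show "p \<in> {..<card ?T}" by (simp add: t)
  qed
  moreover have "card (?c ` ?T) = card {..<card ?T}" using card_image[OF inj] by simp
  ultimately have "?c ` ?T = {..<card ?T}" by (intro card_subset_eq) auto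
  moreover have "range (height x) = ?c ` ?T" by (auto simp: h)
  ultimately show "range (height x) = {..<nblocks x}" by (simp add: nblocks_def)
qed

lemma height_bound: "x \<in> faces \<Longrightarrow> height x i < nblocks x"
  using range_height by blast

lemma height_surj: "x \<in> faces \<Longrightarrow> p < nblocks x \<Longrightarrow> \<exists>i. height x i = p"
  using range_height by (metis (full_types) imageE lessThan_iff)

lemma height_eq_iff: "x \<in> faces \<Longrightarrow> height x i = height x j \<longleftrightarrow> \<not> face_lt x i j \<and> \<not> face_lt x j i"
  by (metis height_less linorder_less_linear less_irrefl)

lemma card_image_cong_kernel:
  assumes "\<And>a b. a \<in> S \<Longrightarrow> b \<in> S \<Longrightarrow> f a = f b \<longleftrightarrow> g a = g b"
  shows "card (f ` S) = card (g ` S)"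
proof (rule bij_betw_same_card)
  have img: "(\<lambda>t. g (inv_into S f t)) (f a) = g a" if "a \<in> S" for a
    using that assms by (metis f_inv_into_f image_eqI inv_into_into)
  show "bij_betw (\<lambda>t. g (inv_into S f t)) (f ` S) (g ` S)"
    unfolding bij_betw_def
  proof
    show "inj_on (\<lambda>t. g (inv_into S f t)) (f ` S)"
    proof (rule inj_onI)
      fix s t assume "s \<in> f ` S" "t \<in> f ` S" and eq: "g (inv_into S f s) = g (inv_into S f t)"
      then obtain a b where ab: "a \<in> S" "b \<in> S" "s = f a" "t = f b" by blast
      then show "s = t" using eq img[of a] img[of b] assms[of a b] by simp
    qed
    have "(\<lambda>t. g (inv_into S f t)) ` f ` S = (\<lambda>a. g (inv_into S f (f a))) ` S" by (simp add: image_image)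
    also have "\<dots> = g ` S" by (rule image_cong) (simp_all add: img)
    finally show "(\<lambda>t. g (inv_into S f t)) ` f ` S = g ` S" .
  qed
qed

text \<open>If the range is an initial segment, \<open>h i\<close> is the number of values that
  \<open>h\<close> takes on the predecessors of \<open>i\<close>, and the weak order determines this
  number.\<close>

lemma height_unique:
  fixes h :: "'n::{finite,linorder} \<Rightarrow> nat"
  assumes x: "x \<in> faces" and r: "range h = {..<m}" and less: "\<And>i j. h i < h j \<longleftrightarrow> face_lt x i j"
  shows "height x = h" "nblocks x = m"
proof -
  have key: "g i = card (g ` {j. face_lt x j i})"
    if "range g = {..<b}" "\<And>i j. g i < g j \<longleftrightarrow> face_lt x i j" for g :: "'n \<Rightarrow> nat" and b i
  proof -
    have "g ` {j. face_lt x j i} = {..<g i}"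
    proof
      show "g ` {j. face_lt x j i} \<subseteq> {..<g i}" using that(2) by auto
      show "{..<g i} \<subseteq> g ` {j. face_lt x j i}"
      proof
        fix p assume p: "p \<in> {..<g i}"
        have "g i < b" using that(1) by blast
        then have "p \<in> range g" using p that(1) by simp
        then show "p \<in> g ` {j. face_lt x j i}" using p that(2) by auto
      qed
    qed
    then show ?thesis by simp
  qed
  have "h a = h b \<longleftrightarrow> height x a = height x b" for a b
    using less[of a b] less[of b a] height_eq_iff[OF x, of a b] by auto
  then have "card (h ` S) = card (height x ` S)" for S by (intro card_image_cong_kernel) auto
  then have "h i = height x i" for i
    using key[OF r less, of i] key[OF range_height[OF x] height_less[OF x], of i] by simp
  then show eq: "height x = h" by auto
  show "nblocks x = m" using r by (simp add: nblocks_def eq)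
qed

definition height_face :: "('n::{finite,linorder} \<Rightarrow> nat) \<Rightarrow> 'n region" where
  "height_face h = vec_face (\<chi> i. real (h i))"

lemma height_face [simp]: "height_face h \<in> faces" "face_lt (height_face h) i j \<longleftrightarrow> h i < h j"
  by (simp_all add: height_face_def)

lemma height_height_face:
  assumes "range h = {..<m}"
  shows "height (height_face h) = h" "nblocks (height_face h) = m"
  using height_unique[OF height_face(1) assms] by auto

lemma face_height_eqI:
  assumes "x \<in> faces" "y \<in> faces" "height x = height y"
  shows "x = y"
  by (rule face_eqI[OF assms(1,2)]) (simp add: height_less[symmetric] assms)

section \<open>Refinement of the underlying set partitions, ignoring the order of the blocks\<close>

definition face_refines :: "('n::{finite,linorder}) region \<Rightarrow> 'n region \<Rightarrow> bool" where
  "face_refines z x \<longleftrightarrow> (\<forall>i j. height z i = height z j \<longrightarrow> height x i = height x j)"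

lemma face_refinesD: "face_refines z x \<Longrightarrow> height z i = height z j \<Longrightarrow> height x i = height x j"
  unfolding face_refines_def by (elim allE impE)

lemma refines_trans: "face_refines x y \<Longrightarrow> face_refines y z \<Longrightarrow> face_refines x z"
  by (metis face_refines_def)

text \<open>The heights of \<open>x\<close> factor through those of \<open>z\<close> by a surjection
  \<open>g\<close>; with equally many blocks it is a bijection and can be reversed.\<close>

lemma refines_nblocks:
  assumes "z \<in> faces" "x \<in> faces" "face_refines z x"
  shows "nblocks x \<le> nblocks z" and "nblocks x = nblocks z \<Longrightarrow> face_refines x z"
proof -
  define g where "g p = height x (SOME i. height z i = p)" for p
  have g: "height x i = g (height z i)" for i
  proof -
    have "height z (SOME j. height z j = height z i) = height z i"
      by (rule someI[of "\<lambda>j. height z j = height z i" i]) (rule refl)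
    then have "height x (SOME j. height z j = height z i) = height x i"
      using assms(3) unfolding face_refines_def by blast
    then show ?thesis by (simp only: g_def)
  qed
  then have img: "range (height x) = g ` range (height z)" by auto
  then show "nblocks x \<le> nblocks z" by (simp add: nblocks_def card_image_le)
  assume "nblocks x = nblocks z"
  then have "inj_on g (range (height z))"
    using img by (intro eq_card_imp_inj_on) (auto simp: nblocks_def)
  then show "face_refines x z" unfolding face_refines_def g by (auto simp: inj_on_def)
qed

lemma height_mult_eq_iff:
  assumes "x \<in> faces" "y \<in> faces"
  shows "height (face_mult x y) i = height (face_mult x y) j \<longleftrightarrow> height x i = height x j \<and> height y i = height y j"
  using assms by (auto simp: height_eq_iff face_mult_closed face_lt_mult)

lemma mult_refines:
  assumes "x \<in> faces" "y \<in> faces"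
  shows "face_refines (face_mult x y) x" "face_refines (face_mult x y) y"
    and "face_refines z (face_mult x y) \<longleftrightarrow> face_refines z x \<and> face_refines z y"
  unfolding face_refines_def height_mult_eq_iff[OF assms]
  by (simp, simp, simp only: imp_conjR all_conj_distrib)

text \<open>Multiplication by \<open>y\<close> alters \<open>x\<close> only where \<open>y\<close>
  breaks a tie of \<open>x\<close>.\<close>

lemma mult_eq_left_iff:
  assumes "x \<in> faces" "y \<in> faces"
  shows "face_mult x y = x \<longleftrightarrow> face_refines x y"
proof
  show "face_mult x y = x \<Longrightarrow> face_refines x y" using mult_refines(2)[OF assms] by simp
  assume r: "face_refines x y"
  show "face_mult x y = x"
  proof (rule face_eqI)
    fix i j
    have "\<not> face_lt y i j" if "\<not> face_lt x i j" "\<not> face_lt x j i"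
      using that r height_eq_iff[OF assms(1), of i j] height_eq_iff[OF assms(2), of i j]
      unfolding face_refines_def by blast
    then show "face_lt (face_mult x y) i j \<longleftrightarrow> face_lt x i j"
      unfolding face_lt_mult[OF assms] by blast
  qed (use assms in \<open>auto simp: face_mult_closed\<close>)
qed

lemma mult_nblocks:
  assumes "x \<in> faces" "y \<in> faces"
  shows "nblocks x \<le> nblocks (face_mult x y)" "nblocks y \<le> nblocks (face_mult x y)"
  using refines_nblocks(1) face_mult_closed mult_refines assms by blast+

text \<open>The source of all triangularity: a left factor with as many blocks as the product is the
  product itself. For right factors only the set partitions agree, see
  \<open>mult_same_blocks\<close>.\<close>

lemma mult_eq_same_nblocks:
  assumes "x \<in> faces" "y \<in> faces" "nblocks (face_mult x y) \<le> nblocks x"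
  shows "face_mult x y = x"
proof -
  have "nblocks x = nblocks (face_mult x y)" using mult_nblocks(1)[OF assms(1,2)] assms(3) by simp
  then have "face_refines x (face_mult x y)"
    using refines_nblocks(2) face_mult_closed mult_refines(1) assms by blast
  then have "face_refines x y" using mult_refines(2)[OF assms(1,2)] refines_trans by blast
  then show ?thesis using mult_eq_left_iff assms by blast
qed

subsection \<open>Blocks and compositions\<close>

definition blocks :: "('n::{finite,linorder}) region \<Rightarrow> 'n set list" where
  "blocks x = map (\<lambda>p. {i. height x i = p}) [0..<nblocks x]"

definition composition :: "('n::{finite,linorder}) region \<Rightarrow> nat list" where
  "composition x = map card (blocks x)"

lemma length_blocks [simp]: "length (blocks x) = nblocks x"
  by (simp add: blocks_def)

lemma length_composition [simp]: "length (composition x) = nblocks x"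
  by (simp add: composition_def)

lemma nth_blocks [simp]: "p < nblocks x \<Longrightarrow> blocks x ! p = {i. height x i = p}"
  by (simp add: blocks_def)

lemma nth_composition [simp]: "p < nblocks x \<Longrightarrow> composition x ! p = card {i. height x i = p}"
  by (simp add: composition_def)

lemma set_blocks: "x \<in> faces \<Longrightarrow> set (blocks x) = range (\<lambda>i. {j. height x j = height x i})"
proof -
  assume x: "x \<in> faces"
  have "set (blocks x) = (\<lambda>p. {i. height x i = p}) ` {..<nblocks x}"
    by (simp add: blocks_def atLeast0LessThan)
  then show ?thesis unfolding range_height[OF x, symmetric] image_image .
qed

lemma distinct_blocks: "x \<in> faces \<Longrightarrow> distinct (blocks x)"
proof -
  assume x: "x \<in> faces"
  have "inj_on (\<lambda>p. {i. height x i = p}) {0..<nblocks x}"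
  proof (rule inj_onI)
    fix p q assume p: "p \<in> {0..<nblocks x}" and eq: "{i. height x i = p} = {i. height x i = q}"
    obtain i where "height x i = p" using height_surj[OF x, of p] p by auto
    then show "p = q" using eq by blast
  qed
  then show ?thesis by (simp add: blocks_def distinct_map)
qed

lemma blocks_inj:
  assumes "x \<in> faces" "y \<in> faces" "blocks x = blocks y"
  shows "x = y"
proof (rule face_height_eqI[OF assms(1,2)])
  have len: "nblocks x = nblocks y" using assms(3) length_blocks by metis
  show "height x = height y"
  proof
    fix i
    have "i \<in> blocks x ! height x i" using height_bound[OF assms(1)] by simp
    then show "height x i = height y i" using assms(3) len height_bound[OF assms(1), of i] by simp
  qed
qed

lemma blocks_eq_iff_refines:
  assumes x: "x \<in> faces" and y: "y \<in> faces"
  shows "set (blocks x) = set (blocks y) \<longleftrightarrow> face_refines x y \<and> face_refines y x"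
proof
  have key: "face_refines u v" if uv: "u \<in> faces" "v \<in> faces" "set (blocks u) = set (blocks v)" for u v :: "'a region"
    unfolding face_refines_def
  proof (intro allI impI)
    fix i j assume "height u i = height u j"
    have "{l. height u l = height u i} \<in> set (blocks v)"
      using uv set_blocks[of u] by auto
    then obtain m where "{l. height u l = height u i} = {l. height v l = height v m}"
      using set_blocks[OF uv(2)] by auto
    moreover have "i \<in> {l. height u l = height u i}" "j \<in> {l. height u l = height u i}"
      using \<open>height u i = height u j\<close> by simp_all
    ultimately show "height v i = height v j" by simp
  qed
  show "set (blocks x) = set (blocks y) \<Longrightarrow> face_refines x y \<and> face_refines y x"
    using key x y by simp
  assume "face_refines x y \<and> face_refines y x"
  then have "height x j = height x i \<longleftrightarrow> height y j = height y i" for i j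
    unfolding face_refines_def by blast
  then show "set (blocks x) = set (blocks y)" by (simp add: set_blocks x y)
qed

lemma ordered_set_partition_face:
  fixes bs :: "('n::{finite,linorder}) set list"
  assumes dist: "distinct bs" and ne: "{} \<notin> set bs"
    and disj: "\<And>B C i. B \<in> set bs \<Longrightarrow> C \<in> set bs \<Longrightarrow> i \<in> B \<Longrightarrow> i \<in> C \<Longrightarrow> B = C"
    and cover: "\<And>i. \<exists>B \<in> set bs. i \<in> B"
  shows "\<exists>x \<in> faces. blocks x = bs"
proof -
  have "\<exists>p. p < length bs \<and> i \<in> bs ! p" for i
    using cover[of i] by (auto simp: in_set_conv_nth)
  then obtain h where h: "\<And>i. h i < length bs" "\<And>i. i \<in> bs ! h i" by metis
  have h_eq: "h i = p" if "p < length bs" "i \<in> bs ! p" for i p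
    using disj[of "bs ! p" "bs ! h i" i] that h[of i] nth_eq_iff_index_eq[OF dist] by simp
  have "range h = {..<length bs}"
  proof
    show "range h \<subseteq> {..<length bs}" using h by auto
    show "{..<length bs} \<subseteq> range h"
    proof
      fix p assume p: "p \<in> {..<length bs}"
      then have "bs ! p \<noteq> {}" using ne by (metis lessThan_iff nth_mem)
      then obtain i where "i \<in> bs ! p" by blast
      then show "p \<in> range h" using h_eq p by (metis lessThan_iff rangeI)
    qed
  qed
  from height_height_face[OF this] have hh: "height (height_face h) = h" "nblocks (height_face h) = length bs" .
  have "{i. h i = p} = bs ! p" if "p < length bs" for p
    using that h h_eq by blast
  then have "blocks (height_face h) = bs"
    by (intro nth_equalityI) (simp_all add: hh)
  then show ?thesis using height_face(1) by blast
qed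

text \<open>Turns counts of faces with given blocks into counts of orderings of a finite
  set.\<close>

lemma bij_betw_blocks:
  assumes z: "z \<in> faces"
  shows "bij_betw blocks {y \<in> faces. set (blocks y) = set (blocks z)} (permutations_of_set (set (blocks z)))"
  unfolding bij_betw_def
proof
  show "inj_on blocks {y \<in> faces. set (blocks y) = set (blocks z)}"
    by (rule inj_onI) (use blocks_inj in blast)
  show "blocks ` {y \<in> faces. set (blocks y) = set (blocks z)} = permutations_of_set (set (blocks z))"
  proof
    show "blocks ` {y \<in> faces. set (blocks y) = set (blocks z)} \<subseteq> permutations_of_set (set (blocks z))"
      by (auto simp: permutations_of_set_def distinct_blocks)
    show "permutations_of_set (set (blocks z)) \<subseteq> blocks ` {y \<in> faces. set (blocks y) = set (blocks z)}"
    proof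
      fix bs assume "bs \<in> permutations_of_set (set (blocks z))"
      then have bs: "set bs = set (blocks z)" "distinct bs" by (auto simp: permutations_of_set_def)
      have "\<exists>x \<in> faces. blocks x = bs"
      proof (rule ordered_set_partition_face[OF bs(2)])
        show "{} \<notin> set bs" by (auto simp: bs(1) set_blocks[OF z])
        show "\<And>B C i. B \<in> set bs \<Longrightarrow> C \<in> set bs \<Longrightarrow> i \<in> B \<Longrightarrow> i \<in> C \<Longrightarrow> B = C"
          by (auto simp: bs(1) set_blocks[OF z])
        show "\<And>i. \<exists>B \<in> set bs. i \<in> B" by (auto simp: bs(1) set_blocks[OF z])
      qed
      then show "bs \<in> blocks ` {y \<in> faces. set (blocks y) = set (blocks z)}" using bs by blast
    qed
  qed
qed

lemma card_same_blocks:
  assumes "z \<in> faces"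
  shows "card {y \<in> faces. set (blocks y) = set (blocks z)} = fact (nblocks z)"
  using bij_betw_same_card[OF bij_betw_blocks[OF assms]] distinct_card[OF distinct_blocks[OF assms]] by simp

lemma nblocks_card: "x \<in> faces \<Longrightarrow> nblocks x = card (set (blocks x))"
  by (metis distinct_card distinct_blocks length_blocks)

lemma mset_composition: "x \<in> faces \<Longrightarrow> mset (composition x) = image_mset card (mset_set (set (blocks x)))"
  by (simp add: composition_def mset_set_set[OF distinct_blocks] flip: mset_map)

lemma composition_pos: "x \<in> faces \<Longrightarrow> c \<in> set (composition x) \<Longrightarrow> 0 < c"
  by (auto simp: composition_def set_blocks card_gt_0_iff)

lemma sum_composition:
  fixes x :: "('n::{finite,linorder}) region"
  assumes x: "x \<in> faces"
  shows "sum_list (composition x) = CARD('n)"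
proof -
  have "sum_list (composition x) = (\<Sum>p<nblocks x. card {i. height x i = p})"
    by (simp add: composition_def blocks_def comp_def interv_sum_list_conv_sum_set_nat atLeast0LessThan)
  also have "\<dots> = card (\<Union>p\<in>{..<nblocks x}. {i. height x i = p})"
    by (rule card_UN_disjoint[symmetric]) auto
  also have "(\<Union>p\<in>{..<nblocks x}. {i. height x i = p}) = UNIV"
    using height_bound[OF x] by auto
  finally show ?thesis .
qed

lemma nblocks_bounds:
  fixes x :: "('n::{finite,linorder}) region"
  assumes x: "x \<in> faces"
  shows "0 < nblocks x" "nblocks x \<le> CARD('n)"
proof -
  show "0 < nblocks x" using height_bound[OF x] gr_zeroI by fastforce
  show "nblocks x \<le> CARD('n)" unfolding nblocks_def by (rule card_image_le) simp
qed

lemma exists_blocks_of_sizes: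
  assumes "finite U" "sum_list c = card U" "\<And>a. a \<in> set c \<Longrightarrow> 0 < a"
  shows "\<exists>bs. map card bs = c \<and> distinct bs \<and> partition_on U (set bs)"
  using assms
proof (induction c arbitrary: U)
  case Nil
  then show ?case by (intro exI[of _ "[]"]) (simp add: partition_on_def)
next
  case (Cons a c)
  then have "a \<le> card U" by simp
  then obtain B where B: "B \<subseteq> U" "card B = a" "finite B"
    using obtain_subset_with_card_n by metis
  have card: "card (U - B) = card U - card B" using B by (intro card_Diff_subset) auto
  have "\<exists>bs. map card bs = c \<and> distinct bs \<and> partition_on (U - B) (set bs)"
  proof (rule Cons.IH)
    show "finite (U - B)" using Cons.prems(1) by simp
    show "sum_list c = card (U - B)" using Cons.prems(2) B card by simp
    show "\<And>a. a \<in> set c \<Longrightarrow> 0 < a" by (rule Cons.prems(3)) simp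
  qed
  then obtain bs where bs: "map card bs = c" "distinct bs" "partition_on (U - B) (set bs)" by blast
  have ne: "B \<noteq> {}" using B Cons.prems(3)[of a] by auto
  have un: "\<Union>(set bs) = U - B" using bs(3) by (simp add: partition_on_def)
  have out: "disjnt B C" if "C \<in> set bs" for C using that un by (auto simp: disjnt_def)
  have "B \<notin> set bs" using ne out[of B] by (auto simp: disjnt_def)
  moreover have "partition_on U (set (B # bs))"
    using bs(3) B(1) ne un out
    by (auto simp: partition_on_def disjoint_def pairwise_insert disjnt_def)
  ultimately show ?case using bs B by (intro exI[of _ "B # bs"]) simp
qed

lemma exists_face_of_composition:
  assumes "sum_list c = CARD('n)" "\<And>a. a \<in> set c \<Longrightarrow> 0 < a"
  shows "\<exists>x :: ('n::{finite,linorder}) region \<in> faces. composition x = c"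
proof -
  obtain bs :: "'n set list" where bs: "map card bs = c" "distinct bs" "partition_on UNIV (set bs)"
    using exists_blocks_of_sizes[of "UNIV :: 'n set" c] assms by auto
  have "\<exists>x \<in> faces. blocks x = bs"
  proof (rule ordered_set_partition_face[OF bs(2)])
    show "{} \<notin> set bs" using bs(3) by (simp add: partition_on_def)
    show "\<And>B C i. B \<in> set bs \<Longrightarrow> C \<in> set bs \<Longrightarrow> i \<in> B \<Longrightarrow> i \<in> C \<Longrightarrow> B = C"
      using partition_onD2[OF bs(3)] unfolding disjoint_def by blast
    show "\<exists>B \<in> set bs. i \<in> B" for i
      using bs(3) by (auto simp: partition_on_def)
  qed
  then show ?thesis using bs by (auto simp: composition_def)
qed

subsection \<open>Orbits\<close>

lemma perm_vec_face:
  fixes x :: "('n::{finite,linorder}) region"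
  assumes w: "bij \<omega>" and x: "x \<in> faces"
  shows perm_vec_closed: "perm_vec \<omega> ` x \<in> faces"
    and perm_vec_face_lt: "face_lt (perm_vec \<omega> ` x) i j \<longleftrightarrow> face_lt x (inv_into UNIV \<omega> i) (inv_into UNIV \<omega> j)"
proof -
  obtain v where v: "x = vec_face v" using x by (auto simp: faces_eq)
  have eq: "perm_vec \<omega> ` x = vec_face (perm_vec \<omega> v)"
  proof (intro equalityI subsetI)
    fix u assume "u \<in> perm_vec \<omega> ` x"
    then show "u \<in> vec_face (perm_vec \<omega> v)" by (auto simp: v vec_face_def perm_vec_def)
  next
    fix u assume u: "u \<in> vec_face (perm_vec \<omega> v)"
    define u' where "u' = (\<chi> i. u $ \<omega> i)"
    have "u' \<in> x"
      using u w by (auto simp: v vec_face_def perm_vec_def u'_def bij_is_inj inv_f_f)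
    moreover have "u = perm_vec \<omega> u'"
      using w by (simp add: perm_vec_def u'_def vec_eq_iff bij_is_surj surj_f_inv_f)
    ultimately show "u \<in> perm_vec \<omega> ` x" by blast
  qed
  show "perm_vec \<omega> ` x \<in> faces" by (simp add: eq)
  show "face_lt (perm_vec \<omega> ` x) i j \<longleftrightarrow> face_lt x (inv_into UNIV \<omega> i) (inv_into UNIV \<omega> j)"
    unfolding eq by (simp add: v perm_vec_def)
qed

lemma height_perm_vec:
  fixes x :: "('n::{finite,linorder}) region"
  assumes w: "bij \<omega>" and x: "x \<in> faces"
  shows "height (perm_vec \<omega> ` x) = height x \<circ> inv_into UNIV \<omega>" "nblocks (perm_vec \<omega> ` x) = nblocks x"
proof -
  have r: "range (height x \<circ> inv_into UNIV \<omega>) = {..<nblocks x}"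
    using range_height[OF x] bij_is_surj[OF bij_imp_bij_inv[OF w]] by (metis image_comp)
  show "height (perm_vec \<omega> ` x) = height x \<circ> inv_into UNIV \<omega>" "nblocks (perm_vec \<omega> ` x) = nblocks x"
    using height_unique[OF perm_vec_closed[OF w x] r] by (simp_all add: perm_vec_face_lt[OF w x] height_less[OF x])
qed

lemma composition_perm_vec:
  fixes x :: "('n::{finite,linorder}) region"
  assumes w: "bij \<omega>" and x: "x \<in> faces"
  shows "composition (perm_vec \<omega> ` x) = composition x"
proof (rule nth_equalityI)
  fix p assume "p < length (composition (perm_vec \<omega> ` x))"
  then have p: "p < nblocks x" using height_perm_vec[OF w x] by simp
  have "{i. height x (inv_into UNIV \<omega> i) = p} = \<omega> ` {i. height x i = p}"
    using w by (auto simp: image_iff bij_is_inj inv_f_f) (metis bij_is_surj surj_f_inv_f)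
  then have "card {i. height x (inv_into UNIV \<omega> i) = p} = card {i. height x i = p}"
    using card_image[OF inj_on_subset[OF bij_is_inj[OF w] subset_UNIV], of "{i. height x i = p}"] by simp
  then show "composition (perm_vec \<omega> ` x) ! p = composition x ! p"
    using p height_perm_vec[OF w x] by simp
qed (simp add: height_perm_vec[OF w x])

text \<open>Bijections between blocks of the same position, which have the same size, combine to a
  permutation. Hence compositions index the orbits.\<close>

lemma composition_orbit:
  fixes x y :: "('n::{finite,linorder}) region"
  assumes x: "x \<in> faces" and y: "y \<in> faces" and c: "composition x = composition y"
  shows "\<exists>\<omega>. bij \<omega> \<and> perm_vec \<omega> ` x = y"
proof -
  have len: "nblocks x = nblocks y" using c length_composition by metis
  have "\<exists>f. bij_betw f {i. height x i = p} {i. height y i = p}" if "p < nblocks x" for p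
  proof -
    have "card {i. height x i = p} = card {i. height y i = p}"
      using that len c nth_composition by metis
    then show ?thesis by (simp add: finite_same_card_bij)
  qed
  then obtain f where f: "\<And>p. p < nblocks x \<Longrightarrow> bij_betw (f p) {i. height x i = p} {i. height y i = p}" by metis
  define \<omega> where "\<omega> i = f (height x i) i" for i
  have h: "height y (\<omega> i) = height x i" for i
    using bij_betwE[OF f[OF height_bound[OF x, of i]]] by (auto simp: \<omega>_def)
  have "inj \<omega>"
  proof (rule injI)
    fix i j assume eq: "\<omega> i = \<omega> j"
    then have hij: "height x i = height x j" using h by metis
    then show "i = j" using eq f[OF height_bound[OF x, of i]] unfolding \<omega>_def bij_betw_def inj_on_def by auto
  qed
  then have w: "bij \<omega>" by (simp add: bij_def finite_UNIV_inj_surj)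
  have "height x \<circ> inv_into UNIV \<omega> = height y"
  proof
    fix i
    show "(height x \<circ> inv_into UNIV \<omega>) i = height y i"
      using h[of "inv_into UNIV \<omega> i"] surj_f_inv_f[OF bij_is_surj[OF w], of i] by simp
  qed
  then have "height (perm_vec \<omega> ` x) = height y" using height_perm_vec[OF w x] by simp
  then have "perm_vec \<omega> ` x = y" using face_height_eqI perm_vec_closed[OF w x] y by blast
  then show ?thesis using w by blast
qed

lemma perm_vec_mult:
  fixes x y :: "('n::{finite,linorder}) region"
  assumes w: "bij \<omega>" and x: "x \<in> faces" and y: "y \<in> faces"
  shows "perm_vec \<omega> ` face_mult x y = face_mult (perm_vec \<omega> ` x) (perm_vec \<omega> ` y)"
  by (rule face_eqI) (use assms in \<open>simp_all add: perm_vec_closed perm_vec_face_lt face_mult_closed face_lt_mult\<close>)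

subsection \<open>Merging adjacent blocks\<close>

definition merge_adjacent :: "nat list \<Rightarrow> nat \<Rightarrow> nat list" where
  "merge_adjacent c j = take j c @ (c ! j + c ! Suc j) # drop (j + 2) c"

definition merge_face :: "('n::{finite,linorder}) region \<Rightarrow> nat \<Rightarrow> 'n region" where
  "merge_face z j = height_face (\<lambda>i. if height z i \<le> j then height z i else height z i - 1)"

lemma merge_face_props:
  fixes z :: "('n::{finite,linorder}) region"
  assumes z: "z \<in> faces" and j: "Suc j < nblocks z"
  shows merge_face_closed: "merge_face z j \<in> faces"
    and height_merge_face: "height (merge_face z j) = (\<lambda>i. if height z i \<le> j then height z i else height z i - 1)"
    and nblocks_merge_face: "nblocks (merge_face z j) = nblocks z - 1"
    and composition_merge_face: "composition (merge_face z j) = merge_adjacent (composition z) j"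
proof -
  let ?h = "\<lambda>i. if height z i \<le> j then height z i else height z i - 1"
  show "merge_face z j \<in> faces" by (simp add: merge_face_def)
  have r: "range ?h = {..<nblocks z - 1}"
  proof
    show "range ?h \<subseteq> {..<nblocks z - 1}"
    proof
      fix p assume "p \<in> range ?h"
      then obtain i where "p = ?h i" by blast
      then show "p \<in> {..<nblocks z - 1}" using height_bound[OF z, of i] j by auto
    qed
    show "{..<nblocks z - 1} \<subseteq> range ?h"
    proof
      fix p assume p: "p \<in> {..<nblocks z - 1}"
      have "(if p \<le> j then p else Suc p) < nblocks z" using p j by auto
      then obtain i where i: "height z i = (if p \<le> j then p else Suc p)"
        using height_surj[OF z] by blast
      then show "p \<in> range ?h" by (intro image_eqI[of _ _ i]) auto
    qed
  qed
  show h: "height (merge_face z j) = ?h" and n: "nblocks (merge_face z j) = nblocks z - 1"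
    using height_height_face[OF r] by (simp_all add: merge_face_def)
  show "composition (merge_face z j) = merge_adjacent (composition z) j"
  proof (rule nth_equalityI)
    show "length (composition (merge_face z j)) = length (merge_adjacent (composition z) j)"
      using j by (simp add: n merge_adjacent_def)
    fix p assume "p < length (composition (merge_face z j))"
    then have p: "p < nblocks z - 1" by (simp add: n)
    consider "p < j" | "p = j" | "p > j" by linarith
    then show "composition (merge_face z j) ! p = merge_adjacent (composition z) j ! p"
    proof cases
      case 1
      then have "{i. ?h i = p} = {i. height z i = p}" by auto
      then show ?thesis using 1 p j by (simp add: n h merge_adjacent_def nth_append)
    next
      case 2
      have "{i. ?h i = p} = {i. height z i = j} \<union> {i. height z i = Suc j}" using 2 by auto
      moreover have "card ({i. height z i = j} \<union> {i. height z i = Suc j})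
        = card {i. height z i = j} + card {i. height z i = Suc j}"
        by (rule card_Un_disjoint) auto
      ultimately show ?thesis using 2 p j by (simp add: n h merge_adjacent_def nth_append)
    next
      case 3
      then have "{i. ?h i = p} = {i. height z i = Suc p}" by auto
      moreover have "merge_adjacent (composition z) j ! p = composition z ! Suc p"
      proof -
        have "p - j = Suc (p - Suc j)" using 3 by simp
        then show ?thesis using 3 p j by (simp add: merge_adjacent_def nth_append min_def)
      qed
      ultimately show ?thesis using 3 p by (simp add: n h)
    qed
  qed
qed

lemma merge_face_inj:
  assumes z: "z \<in> faces" and j: "Suc j < nblocks z" and j': "Suc j' < nblocks z"
    and eq: "merge_face z j = merge_face z j'"
  shows "j = j'"
proof -
  obtain a where a: "height z a = j" using height_surj[OF z, of j] j by auto
  obtain b where b: "height z b = Suc j" using height_surj[OF z, of "Suc j"] j by auto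
  have "height (merge_face z j) a = height (merge_face z j) b"
    using a b by (simp add: height_merge_face[OF z j])
  then have "height (merge_face z j') a = height (merge_face z j') b" using eq by simp
  then show ?thesis using a b by (auto simp: height_merge_face[OF z j'] split: if_splits)
qed

text \<open>The order of \<open>x\<close> is contained in that of the product \<open>z\<close>. If
  \<open>x\<close> separated all adjacent blocks of \<open>z\<close>, it would separate all blocks
  and have as many; so it fuses an adjacent pair, and the block numbers leave room for no further
  fusion.\<close>

lemma mult_codim_one:
  assumes x: "x \<in> faces" and y: "y \<in> faces" and n: "Suc (nblocks x) = nblocks (face_mult x y)"
  shows "\<exists>j. Suc j < nblocks (face_mult x y) \<and> x = merge_face (face_mult x y) j"
proof -
  define z where "z = face_mult x y"
  have z: "z \<in> faces" using x y face_mult_closed by (simp add: z_def)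
  have sub: "face_lt x i j \<Longrightarrow> face_lt z i j" for i j by (simp add: z_def face_lt_mult x y)
  have ref: "face_refines z x" using mult_refines(1)[OF x y] by (simp add: z_def)
  have nz: "nblocks z = Suc (nblocks x)" using n by (simp add: z_def)
  have "\<exists>j. Suc j < nblocks z \<and> (\<exists>a b. height z a = j \<and> height z b = Suc j \<and> height x a = height x b)"
  proof (rule ccontr)
    assume no: "\<not> ?thesis"
    have step: "height x a < height x b" if "height z b = Suc (height z a)" for a b
    proof -
      have "height x a \<noteq> height x b" using no that height_bound[OF z, of b] by auto
      moreover have "\<not> height x b < height x a"
        using sub[of b a] that height_less[OF z, of b a] height_less[OF x, of b a] by auto
      ultimately show ?thesis by simp
    qed
    have mono: "height z b = height z a + Suc d \<Longrightarrow> height x a < height x b" for a b d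
    proof (induction d arbitrary: b)
      case 0
      then show ?case using step by simp
    next
      case (Suc d)
      obtain c where c: "height z c = height z a + Suc d"
        using height_surj[OF z, of "height z a + Suc d"] Suc.prems height_bound[OF z, of b] by auto
      have "height x a < height x c" using Suc.IH[OF c] .
      also have "height x c < height x b" using step[of b c] c Suc.prems by simp
      finally show ?case .
    qed
    have "face_refines x z"
      unfolding face_refines_def
    proof (intro allI impI)
      fix a b assume eq: "height x a = height x b"
      show "height z a = height z b"
      proof (rule ccontr)
        assume "height z a \<noteq> height z b"
        then consider d where "height z b = height z a + Suc d" | d where "height z a = height z b + Suc d"
          by (metis less_iff_Suc_add linorder_neqE_nat add_Suc_right)
        then show False using mono eq by (cases) (metis less_irrefl)+
      qed
    qed
    then have "nblocks z \<le> nblocks x" using refines_nblocks(1) x z by blast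
    then show False using nz by simp
  qed
  then obtain j a b where j: "Suc j < nblocks z" and ab: "height z a = j" "height z b = Suc j" "height x a = height x b" by blast
  let ?m = "merge_face z j"
  note m = merge_face_closed[OF z j]
  have "face_refines ?m x"
    unfolding face_refines_def
  proof (intro allI impI)
    fix p q assume "height ?m p = height ?m q"
    then consider "height z p = height z q" | "height z p = j" "height z q = Suc j" | "height z p = Suc j" "height z q = j"
      unfolding height_merge_face[OF z j] by (fastforce split: if_splits)
    then show "height x p = height x q"
    proof cases
      case 1
      then show ?thesis by (rule face_refinesD[OF ref])
    next
      case 2
      then have "height x p = height x a" "height x q = height x b"
        using ab by (intro face_refinesD[OF ref]; simp)+
      then show ?thesis using ab by simp
    next
      case 3
      then have "height x p = height x b" "height x q = height x a"
        using ab by (intro face_refinesD[OF ref]; simp)+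
      then show ?thesis using ab by simp
    qed
  qed
  moreover have "nblocks x = nblocks ?m" using nblocks_merge_face[OF z j] nz by simp
  ultimately have ref2: "face_refines x ?m" using refines_nblocks(2) m x by blast
  have ltm: "face_lt ?m p q \<Longrightarrow> face_lt z p q" for p q
    unfolding height_less[OF z, symmetric] height_less[OF m, symmetric] height_merge_face[OF z j]
    by (auto split: if_splits)
  have "x = ?m"
  proof (rule face_eqI[OF x m])
    fix p q
    have same: "height x p = height x q \<longleftrightarrow> height ?m p = height ?m q"
      using face_refinesD[OF ref2] face_refinesD[OF \<open>face_refines ?m x\<close>] by blast
    show "face_lt x p q \<longleftrightarrow> face_lt ?m p q"
      using same sub[of p q] sub[of q p] ltm[of p q] ltm[of q p] face_lt_asym[OF z, of p q]
      unfolding height_eq_iff[OF x] height_eq_iff[OF m] by blast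
  qed
  then show ?thesis using j by (auto simp: z_def)
qed

text \<open>As \<open>y\<close> has the blocks of \<open>z\<close>, the ties of the merged face that
  it breaks lie between the blocks \<open>j\<close> and \<open>Suc j\<close> only. It must order
  these two as \<open>z\<close> does, and the rest of its order has no influence.\<close>

lemma merge_face_mult:
  assumes z: "z \<in> faces" and j: "Suc j < nblocks z" and y: "y \<in> faces" "set (blocks y) = set (blocks z)"
  shows "face_mult (merge_face z j) y = z \<longleftrightarrow>
    (\<forall>a b. height z a = j \<longrightarrow> height z b = Suc j \<longrightarrow> face_lt y a b)"
proof
  let ?m = "merge_face z j"
  note m = merge_face_closed[OF z j]
  have hm: "face_lt ?m p q \<longleftrightarrow> height z p < height z q \<and> \<not> (height z p = j \<and> height z q = Suc j)" for p q
    unfolding height_less[OF m, symmetric] height_merge_face[OF z j] by auto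
  show "\<forall>a b. height z a = j \<longrightarrow> height z b = Suc j \<longrightarrow> face_lt y a b" if eq: "face_mult ?m y = z"
  proof (intro allI impI)
    fix a b assume ab: "height z a = j" "height z b = Suc j"
    then have "face_lt (face_mult ?m y) a b" using height_less[OF z, of a b] eq by simp
    then show "face_lt y a b" using hm[of a b] ab by (simp add: face_lt_mult m y)
  qed
  assume *: "\<forall>a b. height z a = j \<longrightarrow> height z b = Suc j \<longrightarrow> face_lt y a b"
  have yz: "height y p = height y q \<longleftrightarrow> height z p = height z q" for p q
    using blocks_eq_iff_refines[OF y(1) z] y(2) face_refinesD by blast
  show "face_mult ?m y = z"
  proof (rule face_eqI[OF face_mult_closed[OF m y(1)] z])
    fix p q
    show "face_lt (face_mult ?m y) p q \<longleftrightarrow> face_lt z p q"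
    proof (cases "height z p" "height z q" rule: linorder_cases)
      case less
      then show ?thesis using * height_less[OF z, of p q]
        by (auto simp: face_lt_mult m y hm)
    next
      case equal
      then have "\<not> face_lt y p q" using yz[of p q] height_eq_iff[OF y(1), of p q] by blast
      then show ?thesis using equal height_less[OF z, of p q]
        by (auto simp: face_lt_mult m y hm)
    next
      case greater
      have "face_lt ?m q p \<or> \<not> face_lt ?m p q \<and> \<not> face_lt y p q"
      proof (cases "height z q = j \<and> height z p = Suc j")
        case True
        then have "face_lt y q p" using * by blast
        then show ?thesis using face_lt_asym[OF y(1)] hm[of p q] greater by auto
      next
        case False
        then show ?thesis using hm[of q p] greater by auto
      qed
      then show ?thesis using greater height_less[OF z, of p q] face_lt_asym[OF m]
        unfolding face_lt_mult[OF m y(1)] by auto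
    qed
  qed
qed

subsection \<open>Counting orderings with prescribed first two blocks\<close>

text \<open>Intended for distinct lists and different \<open>P\<close>, \<open>Q\<close>. The
  recursion lets simplification evaluate the effect of exchanging two leading entries.\<close>

fun before :: "'a list \<Rightarrow> 'a \<Rightarrow> 'a \<Rightarrow> bool" where
  "before [] P Q \<longleftrightarrow> False"
| "before (B # bs) P Q \<longleftrightarrow> (if B = P then Q \<in> set bs else if B = Q then False else before bs P Q)"

lemma before_nth:
  "distinct bs \<Longrightarrow> P \<noteq> Q \<Longrightarrow> before bs P Q \<longleftrightarrow> (\<exists>p q. p < q \<and> q < length bs \<and> bs ! p = P \<and> bs ! q = Q)"
proof (induction bs)
  case Nil
  then show ?case by simp
next
  case (Cons B bs)
  have "(\<exists>p q. p < q \<and> q < length (B # bs) \<and> (B # bs) ! p = P \<and> (B # bs) ! q = Q) \<longleftrightarrow>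
      (B = P \<and> Q \<in> set bs) \<or> (\<exists>p q. p < q \<and> q < length bs \<and> bs ! p = P \<and> bs ! q = Q)" (is "?L \<longleftrightarrow> ?R")
  proof
    assume ?L
    then obtain p q where pq: "p < q" "q < length (B # bs)" "(B # bs) ! p = P" "(B # bs) ! q = Q" by blast
    obtain q' where q': "q = Suc q'" using pq(1) by (cases q) auto
    show ?R
    proof (cases p)
      case 0
      then show ?thesis using pq q' by auto
    next
      case (Suc p')
      then have "p' < q'" "q' < length bs" "bs ! p' = P" "bs ! q' = Q" using pq q' by auto
      then show ?thesis by blast
    qed
  next
    assume ?R
    then show ?L
    proof
      assume "B = P \<and> Q \<in> set bs"
      then obtain q where "q < length bs" "bs ! q = Q" "B = P" by (auto simp: in_set_conv_nth)
      then show ?L by (intro exI[of _ 0] exI[of _ "Suc q"]) simp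
    next
      assume "\<exists>p q. p < q \<and> q < length bs \<and> bs ! p = P \<and> bs ! q = Q"
      then obtain p q where "p < q" "q < length bs" "bs ! p = P" "bs ! q = Q" by blast
      then show ?L by (intro exI[of _ "Suc p"] exI[of _ "Suc q"]) simp
    qed
  qed
  moreover have "\<not> (\<exists>p q. p < q \<and> q < length bs \<and> bs ! p = P \<and> bs ! q = Q)" if "B = P \<or> B = Q"
    using that Cons.prems(1) by auto
  ultimately show ?case using Cons by auto
qed

definition starts :: "nat \<Rightarrow> nat \<Rightarrow> 'a set list \<Rightarrow> bool" where
  "starts a b bs \<longleftrightarrow> (\<exists>B C rest. bs = B # C # rest \<and> card B = a \<and> card C = b)"

text \<open>Exchanging the first two blocks matches the orderings starting with sizes \<open>a, b\<close> with those
  starting with sizes \<open>b, a\<close>, except for those which start with \<open>P\<close> and \<open>Q\<close>.\<close>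

lemma card_starts_before:
  fixes S :: "'a set set"
  assumes S: "finite S" "P \<in> S" "Q \<in> S" "P \<noteq> Q" and ab: "a \<noteq> b"
  defines "N \<equiv> \<lambda>a b. card {bs \<in> permutations_of_set S. starts a b bs \<and> before bs P Q}"
  shows "N a b + fact (card S - 2) * (if card P = b \<and> card Q = a then 1 else 0)
    = N b a + fact (card S - 2) * (if card P = a \<and> card Q = b then 1 else 0)"
proof -
  define PQ where "PQ bs \<longleftrightarrow> (\<exists>rest. bs = P # Q # rest)" for bs
  define Y where "Y a b = {bs \<in> permutations_of_set S. starts a b bs \<and> before bs P Q \<and> \<not> PQ bs}" for a b
  define Z where "Z a b = {bs \<in> permutations_of_set S. starts a b bs \<and> before bs P Q \<and> PQ bs}" for a b
  have fin: "finite (Y a b)" "finite (Z a b)" for a b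
    by (simp_all add: Y_def Z_def)
  have N: "N a b = card (Y a b) + card (Z a b)" for a b
  proof -
    have "{bs \<in> permutations_of_set S. starts a b bs \<and> before bs P Q} = Y a b \<union> Z a b"
      by (auto simp: Y_def Z_def)
    moreover have "Y a b \<inter> Z a b = {}" by (auto simp: Y_def Z_def)
    ultimately show ?thesis using fin by (simp add: N_def card_Un_disjoint)
  qed
  have Z: "card (Z a b) = fact (card S - 2) * (if card P = a \<and> card Q = b then 1 else 0)" for a b
  proof (cases "card P = a \<and> card Q = b")
    case True
    have "Z a b = (\<lambda>rest. P # Q # rest) ` permutations_of_set (S - {P, Q})"
    proof (intro equalityI subsetI)
      fix bs assume "bs \<in> Z a b"
      then obtain rest where bs: "bs = P # Q # rest" "set bs = S" "distinct bs"
        by (auto simp: Z_def PQ_def permutations_of_set_def)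
      then have "set rest = S - {P, Q}" by auto
      then have "rest \<in> permutations_of_set (S - {P, Q})" using bs by (simp add: permutations_of_set_def)
      then show "bs \<in> (\<lambda>rest. P # Q # rest) ` permutations_of_set (S - {P, Q})" using bs(1) by (rule rev_image_eqI)
    next
      fix bs assume "bs \<in> (\<lambda>rest. P # Q # rest) ` permutations_of_set (S - {P, Q})"
      then obtain rest where bs: "bs = P # Q # rest" "set rest = S - {P, Q}" "distinct rest"
        by (auto simp: permutations_of_set_def)
      then have "set bs = S" "distinct bs" using S by auto
      then show "bs \<in> Z a b" using S(4) True bs(1)
        by (simp add: permutations_of_set_def Z_def PQ_def starts_def)
    qed
    then have "card (Z a b) = card (permutations_of_set (S - {P, Q}))"
      by (simp add: card_image inj_on_def)
    also have "\<dots> = fact (card S - 2)" using S by (simp add: card_Diff_subset numeral_2_eq_2)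
    finally show ?thesis using True by simp
  next
    case False
    then have "Z a b = {}" by (auto simp: Z_def PQ_def starts_def)
    then show ?thesis using False by auto
  qed
  \<comment> \<open>The exchange reverses the order of \<open>P\<close> and \<open>Q\<close> only if
    they are the two leading blocks, which is excluded in \<open>Y\<close>; so it is an involution
    between \<open>Y a b\<close> and \<open>Y b a\<close>.\<close>
  define sw where "sw bs = (case bs of B # C # rest \<Rightarrow> C # B # rest | _ \<Rightarrow> bs)" for bs :: "'a set list"
  have sw: "sw bs \<in> Y b a" if mem: "bs \<in> Y a b" for a b bs
  proof -
    obtain B C rest where bs: "bs = B # C # rest" "card B = a" "card C = b"
      using mem by (auto simp: Y_def starts_def)
    have "distinct bs" "set bs = S" "before bs P Q" "\<not> PQ bs" using mem by (auto simp: Y_def permutations_of_set_def)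
    then show ?thesis using bs by (auto simp: Y_def starts_def permutations_of_set_def sw_def PQ_def split: if_splits)
  qed
  have swsw: "sw (sw bs) = bs" for bs by (simp add: sw_def split: list.split)
  have "card (Y a b) = card (Y b a)"
    by (rule bij_betw_same_card[of sw]) (rule bij_betw_byWitness[of _ sw], auto simp: swsw sw)
  then show ?thesis by (simp add: N Z)
qed

section \<open>Factorisations whose left factor has one block less\<close>

lemma same_blocks_height:
  assumes "y \<in> faces" "z \<in> faces" "set (blocks y) = set (blocks z)"
  shows "height y p = height y q \<longleftrightarrow> height z p = height z q"
  using blocks_eq_iff_refines[OF assms(1,2)] assms(3) face_refinesD by blast

lemma mult_same_blocks:
  assumes "x \<in> faces" "y \<in> faces" "nblocks y = nblocks (face_mult x y)"
  shows "set (blocks y) = set (blocks (face_mult x y))"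
  using blocks_eq_iff_refines[OF assms(2) face_mult_closed[OF assms(1,2)]]
    refines_nblocks(2)[OF face_mult_closed[OF assms(1,2)] assms(2) mult_refines(2)[OF assms(1,2)] assms(3)]
    mult_refines(2)[OF assms(1,2)] by blast

text \<open>Translates positions in the list of blocks into the criterion of
  \<open>merge_face_mult\<close>. Single representatives \<open>a0\<close>, \<open>b0\<close>
  suffice because the heights of \<open>y\<close> are constant on the blocks of
  \<open>z\<close>.\<close>

lemma before_blocks:
  assumes z: "z \<in> faces" and j: "Suc j < nblocks z" and y: "y \<in> faces" "set (blocks y) = set (blocks z)"
  shows "before (blocks y) (blocks z ! j) (blocks z ! Suc j) \<longleftrightarrow>
    (\<forall>a b. height z a = j \<longrightarrow> height z b = Suc j \<longrightarrow> face_lt y a b)"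
proof -
  note yz = same_blocks_height[OF y(1) z y(2)]
  obtain a0 where a0: "height z a0 = j" using height_surj[OF z, of j] j by auto
  obtain b0 where b0: "height z b0 = Suc j" using height_surj[OF z, of "Suc j"] j by auto
  have blk: "blocks y ! height y i = blocks z ! height z i" for i
    using height_bound[OF y(1)] height_bound[OF z] yz by simp
  have ne: "blocks z ! j \<noteq> blocks z ! Suc j"
    using distinct_blocks[OF z] j by (simp add: nth_eq_iff_index_eq del: nth_blocks)
  have idx: "p = height y i" if "p < nblocks y" "blocks y ! p = blocks z ! height z i" for p i
  proof -
    have "blocks y ! p = blocks y ! height y i" using that(2) by (simp only: blk)
    then show ?thesis
      using nth_eq_iff_index_eq[OF distinct_blocks[OF y(1)], of p "height y i"] that(1) height_bound[OF y(1), of i]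
      unfolding length_blocks by blast
  qed
  have "before (blocks y) (blocks z ! j) (blocks z ! Suc j) \<longleftrightarrow> height y a0 < height y b0"
  proof -
    have "(\<exists>p q. p < q \<and> q < length (blocks y) \<and> blocks y ! p = blocks z ! j \<and> blocks y ! q = blocks z ! Suc j)
      \<longleftrightarrow> height y a0 < height y b0" (is "?L \<longleftrightarrow> ?R")
    proof
      assume ?L
      then obtain p q where pq: "p < q" "q < nblocks y" "blocks y ! p = blocks z ! j" "blocks y ! q = blocks z ! Suc j"
        unfolding length_blocks by blast
      have "p = height y a0" by (rule idx) (use pq(1,2) in simp, simp only: pq(3) a0)
      moreover have "q = height y b0" by (rule idx) (rule pq(2), simp only: pq(4) b0)
      ultimately show ?R using pq(1) by simp
    next
      assume ?R
      then show ?L using blk[of a0] blk[of b0] a0 b0 height_bound[OF y(1), of b0]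
        unfolding length_blocks by metis
    qed
    then show ?thesis using before_nth[OF distinct_blocks[OF y(1)] ne] by blast
  qed
  also have "\<dots> \<longleftrightarrow> (\<forall>a b. height z a = j \<longrightarrow> height z b = Suc j \<longrightarrow> face_lt y a b)"
  proof
    assume less: "height y a0 < height y b0"
    show "\<forall>a b. height z a = j \<longrightarrow> height z b = Suc j \<longrightarrow> face_lt y a b"
    proof (intro allI impI)
      fix a b assume "height z a = j" "height z b = Suc j"
      then have "height y a = height y a0" "height y b = height y b0" using yz a0 b0 by simp_all
      then show "face_lt y a b" using less height_less[OF y(1), of a b] by simp
    qed
  next
    assume "\<forall>a b. height z a = j \<longrightarrow> height z b = Suc j \<longrightarrow> face_lt y a b"
    then show "height y a0 < height y b0" using a0 b0 height_less[OF y(1), of a0 b0] by simp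
  qed
  finally show ?thesis .
qed

text \<open>If \<open>z = x y\<close> where \<open>x\<close> has one block less than \<open>z\<close> and \<open>y\<close> as many as \<open>z\<close>, then \<open>y\<close> consists of the blocks of
  \<open>z\<close>, in an order which only has to agree with \<open>z\<close> on the two blocks merged in \<open>x\<close>.\<close>

lemma codim_one_count:
  fixes z :: "('n::{finite,linorder}) region" and d :: "nat list"
  assumes z: "z \<in> faces" and d: "Suc (length d) = nblocks z" and ab: "a \<noteq> b"
  defines "M \<equiv> \<lambda>a b. card {(x, y). x \<in> faces \<and> y \<in> faces \<and> face_mult x y = z \<and> composition x = d \<and>
      nblocks y = nblocks z \<and> starts a b (blocks y)}"
    and "T \<equiv> \<lambda>a b. card {j. Suc j < nblocks z \<and> merge_adjacent (composition z) j = d \<and>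
      composition z ! j = a \<and> composition z ! Suc j = b}"
  shows "M a b + fact (nblocks z - 2) * T b a = M b a + fact (nblocks z - 2) * T a b"
proof -
  \<comment> \<open>The positions at which merging turns \<open>z\<close> into a face of composition
    \<open>d\<close>; they parametrise the possible left factors.\<close>
  define Jd where "Jd = {j. Suc j < nblocks z \<and> merge_adjacent (composition z) j = d}"
  define S where "S = set (blocks z)"
  define Y where "Y j a b = {y \<in> faces. set (blocks y) = S \<and> starts a b (blocks y) \<and>
    before (blocks y) (blocks z ! j) (blocks z ! Suc j)}" for j a b
  define N where "N j a b = card {bs \<in> permutations_of_set S. starts a b bs \<and> before bs (blocks z ! j) (blocks z ! Suc j)}" for j a b
  have finJ: "finite Jd" by (rule finite_subset[of _ "{..<nblocks z}"]) (auto simp: Jd_def)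
  have finY: "finite (Y j a b)" for j a b by (rule finite_subset[OF _ finite_faces]) (auto simp: Y_def)
  have j: "Suc j < nblocks z" if "j \<in> Jd" for j using that by (simp add: Jd_def)
  have YN: "card (Y j a b) = N j a b" for j a b
  proof -
    have bij: "bij_betw blocks {y \<in> faces. set (blocks y) = S} (permutations_of_set S)"
      unfolding S_def by (rule bij_betw_blocks[OF z])
    have "blocks ` Y j a b = {bs \<in> permutations_of_set S. starts a b bs \<and> before bs (blocks z ! j) (blocks z ! Suc j)}"
      unfolding bij_betw_imp_surj_on[OF bij, symmetric] by (auto simp: Y_def)
    moreover have "inj_on blocks (Y j a b)"
      by (rule inj_on_subset[OF bij_betw_imp_inj_on[OF bij]]) (auto simp: Y_def)
    ultimately show ?thesis unfolding N_def by (metis card_image)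
  qed
  \<comment> \<open>A factorisation corresponds to a position \<open>j\<close> together with an
    ordering of the blocks of \<open>z\<close> that keeps the two merged blocks in order.\<close>
  have M: "M a b = (\<Sum>j\<in>Jd. N j a b)" for a b
  proof -
    let ?f = "\<lambda>(j, y). (merge_face z j, y)"
    have "{(x, y). x \<in> faces \<and> y \<in> faces \<and> face_mult x y = z \<and> composition x = d \<and>
      nblocks y = nblocks z \<and> starts a b (blocks y)} = ?f ` (SIGMA j:Jd. Y j a b)" (is "?A = ?B")
    proof
      show "?A \<subseteq> ?B"
      proof
        fix w assume "w \<in> ?A"
        then obtain x y where w: "w = (x, y)" "x \<in> faces" "y \<in> faces" "face_mult x y = z" "composition x = d"
          "nblocks y = nblocks z" "starts a b (blocks y)" by blast
        have "nblocks x = length d" using w(5) length_composition by metis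
        then have "Suc (nblocks x) = nblocks (face_mult x y)" using d w(4) by simp
        from mult_codim_one[OF w(2,3) this] obtain j where j: "Suc j < nblocks z" "x = merge_face z j"
          using w(4) by auto
        have same: "set (blocks y) = set (blocks z)" using mult_same_blocks[OF w(2,3)] w(4,6) by simp
        have "before (blocks y) (blocks z ! j) (blocks z ! Suc j)"
          using before_blocks[OF z j(1) w(3) same] merge_face_mult[OF z j(1) w(3) same] w(4) j(2) by simp
        then have "y \<in> Y j a b" using w same by (simp add: Y_def S_def)
        moreover have "j \<in> Jd" using j w(5) composition_merge_face[OF z j(1)] by (simp add: Jd_def)
        ultimately show "w \<in> ?B" using w(1) j(2) by (intro image_eqI[of _ _ "(j, y)"]) simp_all
      qed
      show "?B \<subseteq> ?A"
      proof
        fix w assume "w \<in> ?B"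
        then obtain j y where w: "w = (merge_face z j, y)" "j \<in> Jd" "y \<in> Y j a b" by auto
        have y: "y \<in> faces" "set (blocks y) = set (blocks z)" "starts a b (blocks y)"
          "before (blocks y) (blocks z ! j) (blocks z ! Suc j)" using w(3) by (simp_all add: Y_def S_def)
        have "face_mult (merge_face z j) y = z"
          using before_blocks[OF z j[OF w(2)] y(1,2)] merge_face_mult[OF z j[OF w(2)] y(1,2)] y(4) by simp
        moreover have "composition (merge_face z j) = d"
          using composition_merge_face[OF z j[OF w(2)]] w(2) by (simp add: Jd_def)
        moreover have "nblocks y = nblocks z" using nblocks_card y z by metis
        ultimately show "w \<in> ?A" using w(1) y merge_face_closed[OF z j[OF w(2)]] by simp
      qed
    qed
    moreover have "inj_on ?f (SIGMA j:Jd. Y j a b)"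
      using merge_face_inj[OF z j j] by (auto simp: inj_on_def)
    ultimately have "M a b = card (SIGMA j:Jd. Y j a b)" by (simp add: M_def card_image)
    also have "\<dots> = (\<Sum>j\<in>Jd. N j a b)" using finJ finY YN by (simp add: card_SigmaI)
    finally show ?thesis .
  qed
  have T: "T a b = (\<Sum>j\<in>Jd. if composition z ! j = a \<and> composition z ! Suc j = b then 1 else 0)" for a b
  proof -
    have "{j. Suc j < nblocks z \<and> merge_adjacent (composition z) j = d \<and>
      composition z ! j = a \<and> composition z ! Suc j = b} = {j \<in> Jd. composition z ! j = a \<and> composition z ! Suc j = b}"
      by (auto simp: Jd_def)
    then have "T a b = (\<Sum>j\<in>{j \<in> Jd. composition z ! j = a \<and> composition z ! Suc j = b}. 1)"
      unfolding T_def by (simp only: card_eq_sum)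
    also have "\<dots> = (\<Sum>j\<in>Jd. if composition z ! j = a \<and> composition z ! Suc j = b then 1 else 0)"
      by (rule sum.inter_filter[OF finJ])
    finally show ?thesis .
  qed
  have cs: "card S = nblocks z" using nblocks_card[OF z] by (simp add: S_def)
  have step: "N j a b + fact (nblocks z - 2) * (if composition z ! j = b \<and> composition z ! Suc j = a then 1 else 0)
    = N j b a + fact (nblocks z - 2) * (if composition z ! j = a \<and> composition z ! Suc j = b then 1 else 0)"
    if "j \<in> Jd" for j
  proof -
    have "blocks z ! j \<in> S" "blocks z ! Suc j \<in> S" "blocks z ! j \<noteq> blocks z ! Suc j"
      using j[OF that] distinct_blocks[OF z] by (simp_all add: S_def nth_eq_iff_index_eq del: nth_blocks)
    moreover have "composition z ! j = card (blocks z ! j)" "composition z ! Suc j = card (blocks z ! Suc j)"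
      using j[OF that] by simp_all
    ultimately show ?thesis
      using card_starts_before[of S "blocks z ! j" "blocks z ! Suc j" a b] ab cs
      unfolding N_def S_def by simp
  qed
  have "M a b + fact (nblocks z - 2) * T b a = (\<Sum>j\<in>Jd. N j a b + fact (nblocks z - 2) *
      (if composition z ! j = b \<and> composition z ! Suc j = a then 1 else 0))"
    by (simp add: M T sum.distrib sum_distrib_left)
  also have "\<dots> = (\<Sum>j\<in>Jd. N j b a + fact (nblocks z - 2) *
      (if composition z ! j = a \<and> composition z ! Suc j = b then 1 else 0))"
    by (rule sum.cong[OF refl step])
  also have "\<dots> = M b a + fact (nblocks z - 2) * T a b"
    by (simp add: M T sum.distrib sum_distrib_left)
  finally show ?thesis .
qed

section \<open>The face semigroup algebra\<close>

lemma (in abelian_monoid) finsum_single: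
  assumes "finite S" "s \<in> S" "g s \<in> carrier G" "\<And>t. t \<in> S \<Longrightarrow> t \<noteq> s \<Longrightarrow> g t = \<zero>"
  shows "finsum G g S = g s"
proof -
  have "g \<in> S \<rightarrow> carrier G"
  proof
    fix t assume "t \<in> S"
    then show "g t \<in> carrier G" using assms(3,4) by (cases "t = s") simp_all
  qed
  then have "finsum G g S = finsum G g {s}"
    by (intro add.finprod_mono_neutral_cong_right) (use assms in auto)
  also have "\<dots> = g s" using assms(3) by simp
  finally show ?thesis .
qed

lemma (in abelian_monoid) finsum_Sigma:
  assumes "finite I" "\<And>i. i \<in> I \<Longrightarrow> finite (B i)" "\<And>i j. i \<in> I \<Longrightarrow> j \<in> B i \<Longrightarrow> g (i, j) \<in> carrier G"
  shows "(\<Oplus>i\<in>I. \<Oplus>j\<in>B i. g (i, j)) = (\<Oplus>p\<in>Sigma I B. g p)"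
proof -
  have "(\<Oplus>p\<in>(\<Union>i\<in>I. Pair i ` B i). g p) = (\<Oplus>i\<in>I. \<Oplus>p\<in>Pair i ` B i. g p)"
    using assms by (intro add.finprod_UN_disjoint) (auto simp: pairwise_def disjnt_def)
  also have "\<dots> = (\<Oplus>i\<in>I. \<Oplus>j\<in>B i. g (i, j))"
  proof (rule finsum_cong')
    show "(\<Oplus>p\<in>Pair i ` B i. g p) = (\<Oplus>j\<in>B i. g (i, j))" if "i \<in> I" for i
      using assms(3)[OF that] by (intro add.finprod_reindex) (auto simp: inj_on_def)
    show "(\<lambda>i. \<Oplus>j\<in>B i. g (i, j)) \<in> I \<rightarrow> carrier G"
      using assms(3) by (intro Pi_I finsum_closed) auto
  qed simp
  also have "(\<Union>i\<in>I. Pair i ` B i) = Sigma I B" by auto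
  finally show ?thesis by simp
qed

lemma (in abelian_monoid) finsum_bij:
  assumes "bij_betw h S T" "g \<in> T \<rightarrow> carrier G"
  shows "(\<Oplus>s\<in>S. g (h s)) = finsum G g T"
  using add.finprod_reindex[of g h S] assms by (auto simp: bij_betw_def)

text \<open>A signed count: sums with values \<open>u\<close>, \<open>\<ominus> u\<close> and zero
  become differences of two cardinalities, to which the combinatorial counts apply.\<close>

lemma (in abelian_group) finsum_signs:
  assumes "finite S" "u \<in> carrier G" "P \<subseteq> S" "N \<subseteq> S" "P \<inter> N = {}"
    "\<And>s. s \<in> P \<Longrightarrow> g s = u" "\<And>s. s \<in> N \<Longrightarrow> g s = \<ominus> u" "\<And>s. s \<in> S \<Longrightarrow> s \<notin> P \<Longrightarrow> s \<notin> N \<Longrightarrow> g s = \<zero>"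
  shows "finsum G g S = add_pow G (card P) u \<ominus> add_pow G (card N) u"
proof -
  have fin: "finite P" "finite N" using assms(1,3,4) finite_subset by blast+
  have g: "g \<in> S \<rightarrow> carrier G"
  proof
    fix s assume "s \<in> S"
    then show "g s \<in> carrier G" using assms(2,6-8) by (cases "s \<in> P"; cases "s \<in> N") simp_all
  qed
  have "finsum G g S = finsum G g (P \<union> N)"
    by (rule add.finprod_mono_neutral_cong_right) (use assms g in \<open>auto\<close>)
  also have "\<dots> = finsum G g P \<oplus> finsum G g N"
    by (rule add.finprod_Un_disjoint) (use assms fin g in auto)
  also have "finsum G g P = (\<Oplus>s\<in>P. u)" by (rule finsum_cong') (use assms in auto)
  also have "\<dots> = add_pow G (card P) u" using assms(2) by (rule add.finprod_const)
  also have "finsum G g N = (\<Oplus>s\<in>N. \<ominus> u)" by (rule finsum_cong') (use assms in auto)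
  also have "\<dots> = \<ominus> (\<Oplus>s\<in>N. u)"
    using fin(2)
  proof (induction N rule: finite_induct)
    case empty
    show ?case unfolding finsum_empty by (rule sym, rule minus_equality) simp_all
  qed (use assms(2) in \<open>auto simp: minus_add\<close>)
  also have "(\<Oplus>s\<in>N. u) = add_pow G (card N) u" using assms(2) by (rule add.finprod_const)
  finally show ?thesis by (simp add: a_minus_def)
qed

definition face_pairs :: "('n::{finite,linorder}) region \<Rightarrow> ('n region \<times> 'n region) set" where
  "face_pairs z = {(x, y). x \<in> faces \<and> y \<in> faces \<and> face_mult x y = z}"

lemma face_pairs_iff [simp]: "(x, y) \<in> face_pairs z \<longleftrightarrow> x \<in> faces \<and> y \<in> faces \<and> face_mult x y = z"
  by (simp add: face_pairs_def)

lemma finite_face_pairs [simp]: "finite (face_pairs z)"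
  by (rule finite_subset[of _ "faces \<times> faces"]) (auto simp: face_pairs_def)

lemma face_pairsD:
  assumes "p \<in> face_pairs z"
  shows "fst p \<in> faces" "snd p \<in> faces" "face_mult (fst p) (snd p) = z"
  using assms by (auto simp: face_pairs_def)

lemma face_algebra_simps [simp]:
  "carrier (face_algebra k) = faces \<rightarrow>\<^sub>E carrier k"
  "\<one>\<^bsub>face_algebra k\<^esub> = (\<lambda>z \<in> faces. if z = face_one then \<one>\<^bsub>k\<^esub> else \<zero>\<^bsub>k\<^esub>)"
  "\<zero>\<^bsub>face_algebra k\<^esub> = (\<lambda>z \<in> faces. \<zero>\<^bsub>k\<^esub>)"
  "a \<otimes>\<^bsub>face_algebra k\<^esub> b = (\<lambda>z \<in> faces. finsum k (\<lambda>p. a (fst p) \<otimes>\<^bsub>k\<^esub> b (snd p)) (face_pairs z))"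
  "a \<oplus>\<^bsub>face_algebra k\<^esub> b = (\<lambda>z \<in> faces. a z \<oplus>\<^bsub>k\<^esub> b z)"
  "c \<odot>\<^bsub>face_algebra k\<^esub> a = (\<lambda>z \<in> faces. c \<otimes>\<^bsub>k\<^esub> a z)"
  by (simp_all add: face_algebra_def face_one_def face_pairs_def case_prod_unfold)

context field begin

lemma face_coeff_closed: "a \<in> faces \<rightarrow>\<^sub>E carrier R \<Longrightarrow> x \<in> faces \<Longrightarrow> a x \<in> carrier R"
  by (auto simp: PiE_iff)

lemma face_products_closed:
  assumes "a \<in> faces \<rightarrow>\<^sub>E carrier R" "b \<in> faces \<rightarrow>\<^sub>E carrier R"
  shows "(\<lambda>p. a (fst p) \<otimes> b (snd p)) \<in> face_pairs z \<rightarrow> carrier R"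
  using assms by (auto simp: face_coeff_closed)

text \<open>Both sides are reindexed to the same sum over all triples of faces with product
  \<open>z\<close>.\<close>

lemma face_algebra_assoc:
  fixes a b c :: "('n::{finite,linorder}) region \<Rightarrow> 'a"
  assumes a: "a \<in> faces \<rightarrow>\<^sub>E carrier R" and b: "b \<in> faces \<rightarrow>\<^sub>E carrier R" and c: "c \<in> faces \<rightarrow>\<^sub>E carrier R"
  shows "(a \<otimes>\<^bsub>face_algebra R\<^esub> b) \<otimes>\<^bsub>face_algebra R\<^esub> c = a \<otimes>\<^bsub>face_algebra R\<^esub> (b \<otimes>\<^bsub>face_algebra R\<^esub> c)"
proof -
  have ac: "x \<in> faces \<Longrightarrow> a x \<in> carrier R" and bc: "x \<in> faces \<Longrightarrow> b x \<in> carrier R"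
    and cc: "x \<in> faces \<Longrightarrow> c x \<in> carrier R" for x using a b c by (auto simp: PiE_iff)
  have "((a \<otimes>\<^bsub>face_algebra R\<^esub> b) \<otimes>\<^bsub>face_algebra R\<^esub> c) z = (a \<otimes>\<^bsub>face_algebra R\<^esub> (b \<otimes>\<^bsub>face_algebra R\<^esub> c)) z"
    if z: "z \<in> faces" for z
  proof -
    define T where "T = {(x, y, v). x \<in> faces \<and> y \<in> faces \<and> v \<in> faces \<and> face_mult (face_mult x y) v = z}"
    define t where "t = (\<lambda>(x, y, v). a x \<otimes> b y \<otimes> c v)"
    have tT: "t \<in> T \<rightarrow> carrier R" using ac bc cc by (auto simp: T_def t_def)
    have tc: "x \<in> faces \<Longrightarrow> y \<in> faces \<Longrightarrow> v \<in> faces \<Longrightarrow> t (x, y, v) \<in> carrier R" for x y v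
      using ac bc cc by (auto simp: t_def)
    have "((a \<otimes>\<^bsub>face_algebra R\<^esub> b) \<otimes>\<^bsub>face_algebra R\<^esub> c) z
      = (\<Oplus>p\<in>face_pairs z. \<Oplus>q\<in>face_pairs (fst p). t (fst q, snd q, snd p))"
    proof -
      have inner: "(\<Oplus>q\<in>face_pairs (fst p). a (fst q) \<otimes> b (snd q)) \<otimes> c (snd p)
        = (\<Oplus>q\<in>face_pairs (fst p). t (fst q, snd q, snd p))" if "p \<in> face_pairs z" for p
        unfolding t_def prod.case
        by (rule finsum_ldistr[OF _ cc face_products_closed[OF a b]]) (use face_pairsD[OF that] in simp_all)
      show ?thesis
        unfolding face_algebra_simps restrict_apply if_P[OF z]
      proof (rule finsum_cong'[OF refl])
        show "(\<lambda>p. \<Oplus>q\<in>face_pairs (fst p). t (fst q, snd q, snd p)) \<in> face_pairs z \<rightarrow> carrier R"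
          using face_pairsD(1,2) by (auto intro!: finsum_closed tc)
        show "(if fst p \<in> faces then \<Oplus>q\<in>face_pairs (fst p). a (fst q) \<otimes> b (snd q) else undefined) \<otimes> c (snd p)
            = (\<Oplus>q\<in>face_pairs (fst p). t (fst q, snd q, snd p))"
          if "p \<in> face_pairs z" for p
          using inner[OF that] face_pairsD(1)[OF that] by simp
      qed
    qed
    also have "\<dots> = (\<Oplus>p\<in>Sigma (face_pairs z) (\<lambda>p. face_pairs (fst p)). t (fst (snd p), snd (snd p), snd (fst p)))"
      by (subst finsum_Sigma[symmetric]) (use face_pairsD tc in auto)
    also have "\<dots> = finsum R t T"
      by (rule finsum_bij[OF _ tT], rule bij_betw_byWitness[of _ "\<lambda>(x, y, v). ((face_mult x y, v), (x, y))"])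
        (auto simp: T_def face_mult_closed)
    also have "\<dots> = (\<Oplus>p\<in>Sigma (face_pairs z) (\<lambda>p. face_pairs (snd p)). t (fst (fst p), fst (snd p), snd (snd p)))"
      by (rule finsum_bij[OF _ tT, symmetric], rule bij_betw_byWitness[of _ "\<lambda>(x, y, v). ((x, face_mult y v), (y, v))"])
        (auto simp: T_def face_mult_closed face_mult_assoc)
    also have "\<dots> = (\<Oplus>p\<in>face_pairs z. \<Oplus>q\<in>face_pairs (snd p). t (fst p, fst q, snd q))"
      by (subst finsum_Sigma[symmetric]) (use face_pairsD tc in auto)
    also have "\<dots> = (a \<otimes>\<^bsub>face_algebra R\<^esub> (b \<otimes>\<^bsub>face_algebra R\<^esub> c)) z"
    proof -
      have inner: "(\<Oplus>q\<in>face_pairs (snd p). t (fst p, fst q, snd q))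
        = a (fst p) \<otimes> (\<Oplus>q\<in>face_pairs (snd p). b (fst q) \<otimes> c (snd q))" if p: "p \<in> face_pairs z" for p
      proof -
        have "(\<Oplus>q\<in>face_pairs (snd p). t (fst p, fst q, snd q))
          = (\<Oplus>q\<in>face_pairs (snd p). a (fst p) \<otimes> (b (fst q) \<otimes> c (snd q)))"
          by (rule finsum_cong') (use face_pairsD[OF p] face_pairsD ac bc cc in \<open>auto simp: t_def m_assoc\<close>)
        also have "\<dots> = a (fst p) \<otimes> (\<Oplus>q\<in>face_pairs (snd p). b (fst q) \<otimes> c (snd q))"
          by (rule finsum_rdistr[OF _ ac face_products_closed[OF b c], symmetric]) (use face_pairsD[OF p] in simp_all)
        finally show ?thesis .
      qed
      show ?thesis
        unfolding face_algebra_simps restrict_apply if_P[OF z]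
      proof (rule finsum_cong'[OF refl])
        show "(\<lambda>p. a (fst p) \<otimes> (if snd p \<in> faces then \<Oplus>q\<in>face_pairs (snd p). b (fst q) \<otimes> c (snd q) else undefined)) \<in> face_pairs z \<rightarrow> carrier R"
          using face_pairsD(1,2) by (auto intro!: m_closed ac finsum_closed bc cc)
        show "(\<Oplus>q\<in>face_pairs (snd p). t (fst p, fst q, snd q))
            = a (fst p) \<otimes> (if snd p \<in> faces then \<Oplus>q\<in>face_pairs (snd p). b (fst q) \<otimes> c (snd q) else undefined)"
          if "p \<in> face_pairs z" for p
          using inner[OF that] face_pairsD(2)[OF that] by simp
      qed
    qed
    finally show ?thesis .
  qed
  moreover have "((a \<otimes>\<^bsub>face_algebra R\<^esub> b) \<otimes>\<^bsub>face_algebra R\<^esub> c) z = (a \<otimes>\<^bsub>face_algebra R\<^esub> (b \<otimes>\<^bsub>face_algebra R\<^esub> c)) z"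
    if "z \<notin> faces" for z using that by simp
  ultimately show ?thesis by blast
qed

lemma face_algebra_one:
  fixes a :: "('n::{finite,linorder}) region \<Rightarrow> 'a"
  assumes a: "a \<in> faces \<rightarrow>\<^sub>E carrier R"
  shows "\<one>\<^bsub>face_algebra R\<^esub> \<otimes>\<^bsub>face_algebra R\<^esub> a = a" "a \<otimes>\<^bsub>face_algebra R\<^esub> \<one>\<^bsub>face_algebra R\<^esub> = a"
proof -
  let ?u = "\<one>\<^bsub>face_algebra R\<^esub> :: 'n region \<Rightarrow> 'a"
  have ac: "x \<in> faces \<Longrightarrow> a x \<in> carrier R" for x using a by (auto simp: PiE_iff)
  have u: "?u face_one = \<one>" "\<And>x. x \<in> faces \<Longrightarrow> x \<noteq> face_one \<Longrightarrow> ?u x = \<zero>" by simp_all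
  have "(\<Oplus>p\<in>face_pairs z. ?u (fst p) \<otimes> a (snd p)) = a z" if z: "z \<in> faces" for z
  proof -
    have "?u (fst p) \<otimes> a (snd p) = \<zero>" if p: "p \<in> face_pairs z" "p \<noteq> (face_one, z)" for p
    proof -
      have "fst p \<noteq> face_one"
        using p(2) face_pairsD[OF p(1)] face_mult_one(2)[of "snd p"] by (metis prod.collapse)
      then show ?thesis using u(2) face_pairsD[OF p(1)] ac by simp
    qed
    then have "(\<Oplus>p\<in>face_pairs z. ?u (fst p) \<otimes> a (snd p)) = (\<lambda>p. ?u (fst p) \<otimes> a (snd p)) (face_one, z)"
      using z ac u(1) face_mult_one(2)[OF z]
      by (intro finsum_single) (simp_all del: face_algebra_simps)
    then show ?thesis using u z ac by simp
  qed
  then show "?u \<otimes>\<^bsub>face_algebra R\<^esub> a = a"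
    unfolding face_algebra_simps(4) using a by (intro extensionalityI[of _ faces]) (auto simp: PiE_iff simp del: face_algebra_simps)
  have "(\<Oplus>p\<in>face_pairs z. a (fst p) \<otimes> ?u (snd p)) = a z" if z: "z \<in> faces" for z
  proof -
    have "a (fst p) \<otimes> ?u (snd p) = \<zero>" if p: "p \<in> face_pairs z" "p \<noteq> (z, face_one)" for p
    proof -
      have "snd p \<noteq> face_one"
        using p(2) face_pairsD[OF p(1)] face_mult_one(1)[of "fst p"] by (metis prod.collapse)
      then show ?thesis using u(2) face_pairsD[OF p(1)] ac by simp
    qed
    then have "(\<Oplus>p\<in>face_pairs z. a (fst p) \<otimes> ?u (snd p)) = (\<lambda>p. a (fst p) \<otimes> ?u (snd p)) (z, face_one)"
      using z ac u(1) face_mult_one(1)[OF z]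
      by (intro finsum_single) (simp_all del: face_algebra_simps)
    then show ?thesis using u z ac by simp
  qed
  then show "a \<otimes>\<^bsub>face_algebra R\<^esub> ?u = a"
    unfolding face_algebra_simps(4) using a by (intro extensionalityI[of _ faces]) (auto simp: PiE_iff simp del: face_algebra_simps)
qed

lemma face_algebra_ring: "ring (face_algebra R :: ('a, ('n::{finite,linorder}) region \<Rightarrow> 'a) module)"
proof (rule ringI)
  let ?F = "face_algebra R :: ('a, 'n region \<Rightarrow> 'a) module"
  show "abelian_group ?F"
  proof (rule abelian_groupI)
    fix x assume x: "x \<in> carrier ?F"
    show "\<exists>y\<in>carrier ?F. y \<oplus>\<^bsub>?F\<^esub> x = \<zero>\<^bsub>?F\<^esub>"
      using x by (intro bexI[of _ "\<lambda>z\<in>faces. \<ominus> x z"]) (auto simp: PiE_iff l_neg intro!: restrict_ext)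
  qed (auto simp: PiE_iff a_ac extensional_def fun_eq_iff)
  show "Group.monoid ?F"
  proof (rule monoidI)
    fix x y z assume "x \<in> carrier ?F" "y \<in> carrier ?F" "z \<in> carrier ?F"
    then show "x \<otimes>\<^bsub>?F\<^esub> y \<otimes>\<^bsub>?F\<^esub> z = x \<otimes>\<^bsub>?F\<^esub> (y \<otimes>\<^bsub>?F\<^esub> z)"
      using face_algebra_assoc[of x y z] by simp
  next
    fix x y assume "x \<in> carrier ?F" "y \<in> carrier ?F"
    then show "x \<otimes>\<^bsub>?F\<^esub> y \<in> carrier ?F"
      using face_products_closed[of x y] by (auto intro!: finsum_closed)
  next
    fix x assume x: "x \<in> carrier ?F"
    show "\<one>\<^bsub>?F\<^esub> \<otimes>\<^bsub>?F\<^esub> x = x" "x \<otimes>\<^bsub>?F\<^esub> \<one>\<^bsub>?F\<^esub> = x"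
      using face_algebra_one[of x] x by (simp_all del: face_algebra_simps(2,4))
  qed auto
  fix x y z assume xyz: "x \<in> carrier ?F" "y \<in> carrier ?F" "z \<in> carrier ?F"
  then have c: "v \<in> faces \<Longrightarrow> x v \<in> carrier R" "v \<in> faces \<Longrightarrow> y v \<in> carrier R" "v \<in> faces \<Longrightarrow> z v \<in> carrier R" for v
    by (auto simp: PiE_iff)
  have "(\<Oplus>p\<in>face_pairs w. (\<lambda>v\<in>faces. x v \<oplus> y v) (fst p) \<otimes> z (snd p))
    = (\<Oplus>p\<in>face_pairs w. x (fst p) \<otimes> z (snd p)) \<oplus> (\<Oplus>p\<in>face_pairs w. y (fst p) \<otimes> z (snd p))" for w
  proof -
    have "(\<Oplus>p\<in>face_pairs w. (\<lambda>v\<in>faces. x v \<oplus> y v) (fst p) \<otimes> z (snd p))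
      = (\<Oplus>p\<in>face_pairs w. x (fst p) \<otimes> z (snd p) \<oplus> y (fst p) \<otimes> z (snd p))"
      by (rule finsum_cong') (use face_pairsD c in \<open>auto simp: l_distr\<close>)
    also have "\<dots> = (\<Oplus>p\<in>face_pairs w. x (fst p) \<otimes> z (snd p)) \<oplus> (\<Oplus>p\<in>face_pairs w. y (fst p) \<otimes> z (snd p))"
      by (rule finsum_addf) (use xyz face_products_closed[of x z w] face_products_closed[of y z w] in simp_all)
    finally show ?thesis .
  qed
  then show "(x \<oplus>\<^bsub>?F\<^esub> y) \<otimes>\<^bsub>?F\<^esub> z = x \<otimes>\<^bsub>?F\<^esub> z \<oplus>\<^bsub>?F\<^esub> y \<otimes>\<^bsub>?F\<^esub> z"
    by (simp add: restrict_def fun_eq_iff)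
  have "(\<Oplus>p\<in>face_pairs w. z (fst p) \<otimes> (\<lambda>v\<in>faces. x v \<oplus> y v) (snd p))
    = (\<Oplus>p\<in>face_pairs w. z (fst p) \<otimes> x (snd p)) \<oplus> (\<Oplus>p\<in>face_pairs w. z (fst p) \<otimes> y (snd p))" for w
  proof -
    have "(\<Oplus>p\<in>face_pairs w. z (fst p) \<otimes> (\<lambda>v\<in>faces. x v \<oplus> y v) (snd p))
      = (\<Oplus>p\<in>face_pairs w. z (fst p) \<otimes> x (snd p) \<oplus> z (fst p) \<otimes> y (snd p))"
      by (rule finsum_cong') (use face_pairsD c in \<open>auto simp: r_distr\<close>)
    also have "\<dots> = (\<Oplus>p\<in>face_pairs w. z (fst p) \<otimes> x (snd p)) \<oplus> (\<Oplus>p\<in>face_pairs w. z (fst p) \<otimes> y (snd p))"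
      by (rule finsum_addf) (use xyz face_products_closed[of z x w] face_products_closed[of z y w] in simp_all)
    finally show ?thesis .
  qed
  then show "z \<otimes>\<^bsub>?F\<^esub> (x \<oplus>\<^bsub>?F\<^esub> y) = z \<otimes>\<^bsub>?F\<^esub> x \<oplus>\<^bsub>?F\<^esub> z \<otimes>\<^bsub>?F\<^esub> y"
    by (simp add: restrict_def fun_eq_iff)
qed

end

subsection \<open>The invariant subalgebra\<close>

text \<open>Orbits are the sets of faces with equal composition, so invariance means that the
  coefficient depends on the composition only.\<close>

lemma invariant_carrier:
  fixes k :: "('k, 'm) ring_scheme"
  shows "carrier (invariant_face_algebra k :: ('k, ('n::{finite,linorder}) region \<Rightarrow> 'k) module) =
    {a \<in> faces \<rightarrow>\<^sub>E carrier k. \<forall>x \<in> faces. \<forall>y \<in> faces. composition x = composition y \<longrightarrow> a x = a y}"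
    (is "_ = ?C")
proof (intro equalityI subsetI)
  fix a :: "'n region \<Rightarrow> 'k" assume "a \<in> carrier (invariant_face_algebra k)"
  then have a: "a \<in> faces \<rightarrow>\<^sub>E carrier k" and inv: "\<And>\<omega>. \<omega> permutes UNIV \<Longrightarrow> perm_elem \<omega> a = a"
    by (auto simp: invariant_face_algebra_def)
  have "a x = a y" if xy: "x \<in> faces" "y \<in> faces" "composition x = composition y" for x y
  proof -
    obtain \<omega> where w: "bij \<omega>" "perm_vec \<omega> ` x = y" using composition_orbit[OF xy] by blast
    \<comment> \<open>The inverse is used because \<open>perm_elem\<close> evaluates at preimages:
      acting by it on \<open>a\<close> gives the value of \<open>a\<close> at \<open>y\<close> when
      evaluated at \<open>x\<close>.\<close>
    have "inv_into UNIV \<omega> permutes UNIV" using bij_imp_bij_inv[OF w(1)] by (rule bij_imp_permutes) simp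
    then have "perm_elem (inv_into UNIV \<omega>) a x = a x" using inv by metis
    then show ?thesis using xy w by (simp add: perm_elem_def inv_inv_eq)
  qed
  then show "a \<in> ?C" using a by blast
next
  fix a :: "'n region \<Rightarrow> 'k" assume a: "a \<in> ?C"
  have "perm_elem \<omega> a z = a z" if "\<omega> permutes UNIV" for \<omega> z
  proof (cases "z \<in> faces")
    case True
    have w: "bij (inv_into UNIV \<omega>)" using that permutes_bij bij_imp_bij_inv by blast
    have "a (perm_vec (inv_into UNIV \<omega>) ` z) = a z"
      using a True perm_vec_closed[OF w True] composition_perm_vec[OF w True] by blast
    then show ?thesis using True by (simp add: perm_elem_def)
  next
    case False
    then show ?thesis using a by (auto simp: perm_elem_def PiE_iff extensional_def)
  qed
  then show "a \<in> carrier (invariant_face_algebra k)"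
    using a by (auto simp: invariant_face_algebra_def)
qed

lemma invariant_memI:
  fixes a :: "('n::{finite,linorder}) region \<Rightarrow> 'k"
  assumes "\<And>x. x \<in> faces \<Longrightarrow> a x \<in> carrier k" "\<And>x. x \<notin> faces \<Longrightarrow> a x = undefined"
    and "\<And>x y. x \<in> faces \<Longrightarrow> y \<in> faces \<Longrightarrow> composition x = composition y \<Longrightarrow> a x = a y"
  shows "a \<in> carrier (invariant_face_algebra k)"
  unfolding invariant_carrier by (intro CollectI conjI PiE_I ballI impI assms; assumption)

lemma invariant_memD:
  fixes a :: "('n::{finite,linorder}) region \<Rightarrow> 'k"
  assumes "a \<in> carrier (invariant_face_algebra k)"
  shows "x \<in> faces \<Longrightarrow> a x \<in> carrier k" "x \<notin> faces \<Longrightarrow> a x = undefined"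
    "x \<in> faces \<Longrightarrow> y \<in> faces \<Longrightarrow> composition x = composition y \<Longrightarrow> a x = a y"
    "a \<in> faces \<rightarrow>\<^sub>E carrier k"
proof -
  have a: "a \<in> faces \<rightarrow>\<^sub>E carrier k" "\<forall>x \<in> faces. \<forall>y \<in> faces. composition x = composition y \<longrightarrow> a x = a y"
    using assms unfolding invariant_carrier by blast+
  show "a \<in> faces \<rightarrow>\<^sub>E carrier k" by (rule a(1))
  show "x \<in> faces \<Longrightarrow> a x \<in> carrier k" "x \<notin> faces \<Longrightarrow> a x = undefined"
    by (rule PiE_mem[OF a(1)], assumption, rule PiE_arb[OF a(1)])
  show "x \<in> faces \<Longrightarrow> y \<in> faces \<Longrightarrow> composition x = composition y \<Longrightarrow> a x = a y"
    using a(2) by blast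
qed

lemma invariant_ops [simp]:
  "\<one>\<^bsub>invariant_face_algebra k\<^esub> = \<one>\<^bsub>face_algebra k\<^esub>"
  "\<zero>\<^bsub>invariant_face_algebra k\<^esub> = \<zero>\<^bsub>face_algebra k\<^esub>"
  "a \<otimes>\<^bsub>invariant_face_algebra k\<^esub> b = a \<otimes>\<^bsub>face_algebra k\<^esub> b"
  "a \<oplus>\<^bsub>invariant_face_algebra k\<^esub> b = a \<oplus>\<^bsub>face_algebra k\<^esub> b"
  "c \<odot>\<^bsub>invariant_face_algebra k\<^esub> a = c \<odot>\<^bsub>face_algebra k\<^esub> a"
  by (simp_all add: invariant_face_algebra_def del: face_algebra_simps)

context field begin

lemma invariant_ring: "ring (invariant_face_algebra R :: ('a, ('n::{finite,linorder}) region \<Rightarrow> 'a) module)"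
proof -
  let ?F = "face_algebra R :: ('a, 'n region \<Rightarrow> 'a) module"
  let ?C = "carrier (invariant_face_algebra R :: ('a, 'n region \<Rightarrow> 'a) module)"
  interpret F: ring ?F by (rule face_algebra_ring)
  have "subring ?C ?F"
  proof (rule F.subringI)
    show "?C \<subseteq> carrier ?F" by (auto simp: invariant_carrier)
    \<comment> \<open>The face on all hyperplanes is fixed by every permutation and forms an orbit
      by itself.\<close>
    have one_iff: "x = face_one \<longleftrightarrow> y = face_one"
      if "x \<in> faces" "y \<in> faces" "composition x = composition y" for x y :: "'n region"
    proof -
      have "u = face_one \<Longrightarrow> v = face_one" if uv: "u \<in> faces" "v \<in> faces" "composition u = composition v" for u v :: "'n region"
      proof -
        assume u: "u = face_one"
        obtain \<omega> where w: "bij \<omega>" "perm_vec \<omega> ` u = v" using composition_orbit[OF uv] by blast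
        show ?thesis
          by (rule face_eqI[OF uv(2) face_one(1)])
            (simp add: w(2)[symmetric] perm_vec_face_lt[OF w(1) uv(1)], simp add: u)
      qed
      then show ?thesis using that by metis
    qed
    show "\<one>\<^bsub>?F\<^esub> \<in> ?C"
    proof (rule invariant_memI)
      fix x y :: "'n region" assume xy: "x \<in> faces" "y \<in> faces" "composition x = composition y"
      show "\<one>\<^bsub>?F\<^esub> x = \<one>\<^bsub>?F\<^esub> y" using xy(1,2) one_iff[OF xy] by simp
    qed simp_all
    fix a assume a: "a \<in> ?C"
    note ac = invariant_memD(1)[OF a]
    have "\<ominus>\<^bsub>?F\<^esub> a = (\<lambda>z\<in>faces. \<ominus> a z)"
      by (rule F.minus_equality) (use ac invariant_memD(4)[OF a] in \<open>auto simp: l_neg intro!: restrict_ext\<close>)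
    moreover have "(\<lambda>z\<in>faces. \<ominus> a z) \<in> ?C"
    proof (rule invariant_memI)
      fix x y :: "'n region" assume "x \<in> faces" "y \<in> faces" "composition x = composition y"
      then show "(\<lambda>z\<in>faces. \<ominus> a z) x = (\<lambda>z\<in>faces. \<ominus> a z) y" using invariant_memD(3)[OF a, of x y] by simp
    qed (simp_all add: ac)
    ultimately show "\<ominus>\<^bsub>?F\<^esub> a \<in> ?C" by simp
    fix b assume b: "b \<in> ?C"
    note bc = invariant_memD(1)[OF b]
    show "a \<oplus>\<^bsub>?F\<^esub> b \<in> ?C"
    proof (rule invariant_memI)
      fix x y :: "'n region" assume "x \<in> faces" "y \<in> faces" "composition x = composition y"
      then show "(a \<oplus>\<^bsub>?F\<^esub> b) x = (a \<oplus>\<^bsub>?F\<^esub> b) y"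
        using invariant_memD(3)[OF a, of x y] invariant_memD(3)[OF b, of x y] by simp
    qed (simp_all add: ac bc)
    \<comment> \<open>A permutation from \<open>x\<close> to \<open>y\<close> maps the
      factorisations of \<open>x\<close> bijectively to those of \<open>y\<close> and preserves the
      coefficients of both factors.\<close>
    have mult_eq: "(\<Oplus>p\<in>face_pairs x. a (fst p) \<otimes> b (snd p)) = (\<Oplus>p\<in>face_pairs y. a (fst p) \<otimes> b (snd p))"
      if xy: "x \<in> faces" "y \<in> faces" "composition x = composition y" for x y
    proof -
      obtain \<omega> where w: "bij \<omega>" "perm_vec \<omega> ` x = y" using composition_orbit[OF xy] by blast
      let ?w = "\<lambda>p. (perm_vec \<omega> ` fst p, perm_vec \<omega> ` snd p)"
      let ?v = "\<lambda>p. (perm_vec (inv_into UNIV \<omega>) ` fst p, perm_vec (inv_into UNIV \<omega>) ` snd p)"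
      note w' = bij_imp_bij_inv[OF w(1)]
      have canc: "perm_vec (inv_into UNIV \<omega>) ` perm_vec \<omega> ` u = u"
        "perm_vec \<omega> ` perm_vec (inv_into UNIV \<omega>) ` u = u" if "u \<in> faces" for u
      proof -
        have eq: "inv_into UNIV (inv_into UNIV \<omega>) = \<omega>" using w(1) by (simp add: inv_inv_eq)
        have c: "inv_into UNIV \<omega> (\<omega> i) = i" "\<omega> (inv_into UNIV \<omega> i) = i" for i
          using w(1) by (simp_all add: bij_is_inj bij_is_surj surj_f_inv_f)
        show "perm_vec (inv_into UNIV \<omega>) ` perm_vec \<omega> ` u = u"
          by (rule face_eqI) (simp_all add: that perm_vec_closed w w' perm_vec_face_lt eq c)
        show "perm_vec \<omega> ` perm_vec (inv_into UNIV \<omega>) ` u = u"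
          by (rule face_eqI) (simp_all add: that perm_vec_closed w w' perm_vec_face_lt eq c)
      qed
      have xv: "perm_vec (inv_into UNIV \<omega>) ` y = x" using canc(1)[OF xy(1)] w(2) by simp
      have "bij_betw ?w (face_pairs x) (face_pairs y)"
      proof (rule bij_betw_byWitness[of _ ?v])
        show "?w ` face_pairs x \<subseteq> face_pairs y"
          using w xy by (auto simp: perm_vec_closed perm_vec_mult[OF w(1), symmetric])
        show "?v ` face_pairs y \<subseteq> face_pairs x"
          using w' xv xy by (auto simp: perm_vec_closed perm_vec_mult[OF w', symmetric])
        show "\<forall>p \<in> face_pairs x. ?v (?w p) = p" "\<forall>p \<in> face_pairs y. ?w (?v p) = p"
          by (intro ballI, simp only: fst_conv snd_conv canc face_pairsD(1,2) prod.collapse)+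
      qed
      then have "(\<Oplus>p\<in>face_pairs x. a (fst (?w p)) \<otimes> b (snd (?w p))) = (\<Oplus>p\<in>face_pairs y. a (fst p) \<otimes> b (snd p))"
        by (rule finsum_bij) (use ac bc face_pairsD in auto)
      moreover have "(\<Oplus>p\<in>face_pairs x. a (fst p) \<otimes> b (snd p)) = (\<Oplus>p\<in>face_pairs x. a (fst (?w p)) \<otimes> b (snd (?w p)))"
      proof (rule finsum_cong'[OF refl])
        show "(\<lambda>p. a (fst (?w p)) \<otimes> b (snd (?w p))) \<in> face_pairs x \<rightarrow> carrier R"
          using ac bc w by (auto simp: perm_vec_closed)
        fix p assume "p \<in> face_pairs x"
        then have p: "fst p \<in> faces" "snd p \<in> faces" using face_pairsD by blast+
        have "a (perm_vec \<omega> ` fst p) = a (fst p)" "b (perm_vec \<omega> ` snd p) = b (snd p)"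
          by (rule invariant_memD(3)[OF a], simp_all add: p perm_vec_closed[OF w(1)] composition_perm_vec[OF w(1)])
            (rule invariant_memD(3)[OF b], simp_all add: p perm_vec_closed[OF w(1)] composition_perm_vec[OF w(1)])
        then show "a (fst p) \<otimes> b (snd p) = a (fst (?w p)) \<otimes> b (snd (?w p))" by simp
      qed
      ultimately show ?thesis by simp
    qed
    show "a \<otimes>\<^bsub>?F\<^esub> b \<in> ?C"
    proof (rule invariant_memI)
      fix x y :: "'n region" assume xy: "x \<in> faces" "y \<in> faces" "composition x = composition y"
      show "(a \<otimes>\<^bsub>?F\<^esub> b) x = (a \<otimes>\<^bsub>?F\<^esub> b) y" using xy(1,2) mult_eq[OF xy] by simp
    next
      fix x :: "'n region" assume "x \<in> faces"
      then show "(a \<otimes>\<^bsub>?F\<^esub> b) x \<in> carrier R"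
        using finsum_closed[OF face_products_closed[OF invariant_memD(4)[OF a] invariant_memD(4)[OF b]]] by simp
    qed simp
  qed
  from F.subring_is_ring[OF this] show ?thesis
    by (simp add: invariant_face_algebra_def)
qed

lemma invariant_assoc_algebra:
  "assoc_algebra R (invariant_face_algebra R :: ('a, ('n::{finite,linorder}) region \<Rightarrow> 'a) module)"
  unfolding assoc_algebra_def
proof (intro conjI ballI invariant_ring)
  let ?A = "invariant_face_algebra R :: ('a, 'n region \<Rightarrow> 'a) module"
  interpret A: ring ?A by (rule invariant_ring)
  note cl = invariant_memD(1)
  have ext: "(\<lambda>z\<in>faces. a z) = a" if "a \<in> carrier ?A" for a
    using invariant_memD(4)[OF that] by (simp add: PiE_iff extensional_restrict)
  have sm: "c \<odot>\<^bsub>?A\<^esub> a \<in> carrier ?A" if "c \<in> carrier R" "a \<in> carrier ?A" for c a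
  proof (rule invariant_memI)
    fix x y :: "'n region" assume "x \<in> faces" "y \<in> faces" "composition x = composition y"
    then show "(c \<odot>\<^bsub>?A\<^esub> a) x = (c \<odot>\<^bsub>?A\<^esub> a) y" using invariant_memD(3)[OF that(2), of x y] by simp
  qed (simp_all add: that(1) cl[OF that(2)])
  show "Module.module R ?A"
  proof (rule moduleI)
    show "abelian_group ?A" by (rule A.abelian_group_axioms)
    show "cring R" by (rule is_cring)
    show "c \<odot>\<^bsub>?A\<^esub> x \<in> carrier ?A" if "c \<in> carrier R" "x \<in> carrier ?A" for c x using sm that by blast
    show "\<one> \<odot>\<^bsub>?A\<^esub> x = x" if "x \<in> carrier ?A" for x
    proof -
      have "(\<lambda>z\<in>faces. \<one> \<otimes> x z) = (\<lambda>z\<in>faces. x z)" by (rule restrict_ext) (simp add: cl[OF that])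
      then show ?thesis using ext[OF that] by simp
    qed
  qed (auto simp: cl l_distr r_distr m_assoc intro!: restrict_ext)
  fix c a b assume cab: "c \<in> carrier R" "a \<in> carrier ?A" "b \<in> carrier ?A"
  note cla = cl[OF cab(2)] and clb = cl[OF cab(3)]
  have p: "(\<lambda>p. a (fst p) \<otimes> b (snd p)) \<in> face_pairs z \<rightarrow> carrier R" for z
    using cab by (intro face_products_closed invariant_memD(4))
  have "(\<Oplus>p\<in>face_pairs z. (\<lambda>z\<in>faces. c \<otimes> a z) (fst p) \<otimes> b (snd p)) = c \<otimes> (\<Oplus>p\<in>face_pairs z. a (fst p) \<otimes> b (snd p))" for z
    unfolding finsum_rdistr[OF finite_face_pairs cab(1) p]
    by (rule finsum_cong') (use cab(1) cla clb face_pairsD in \<open>auto simp: m_assoc\<close>)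
  then show "(c \<odot>\<^bsub>?A\<^esub> a) \<otimes>\<^bsub>?A\<^esub> b = c \<odot>\<^bsub>?A\<^esub> (a \<otimes>\<^bsub>?A\<^esub> b)"
    by (simp add: restrict_def fun_eq_iff)
  have "(\<Oplus>p\<in>face_pairs z. a (fst p) \<otimes> (\<lambda>z\<in>faces. c \<otimes> b z) (snd p)) = c \<otimes> (\<Oplus>p\<in>face_pairs z. a (fst p) \<otimes> b (snd p))" for z
    unfolding finsum_rdistr[OF finite_face_pairs cab(1) p]
    by (rule finsum_cong') (use cab(1) cla clb face_pairsD in \<open>auto simp: m_lcomm\<close>)
  then show "a \<otimes>\<^bsub>?A\<^esub> (c \<odot>\<^bsub>?A\<^esub> b) = c \<odot>\<^bsub>?A\<^esub> (a \<otimes>\<^bsub>?A\<^esub> b)"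
    by (simp add: restrict_def fun_eq_iff)
qed

end

text \<open>Characteristic zero is covered: \<open>ring_characteristic\<close> is then zero, which
  does not divide a factorial.\<close>

locale invariant_faces = k: field k
  for k :: "('k, 'm) ring_scheme" +
  fixes A :: "('k, ('n::{finite,linorder}) region \<Rightarrow> 'k) module" (structure)
  assumes A_eq: "A = invariant_face_algebra k"
    and characteristic: "\<not> ring_characteristic k dvd fact CARD('n)"

sublocale invariant_faces \<subseteq> assoc_alg k A
  by (intro assoc_alg.intro assoc_alg_axioms.intro k.field_axioms)
    (simp_all add: A_eq k.invariant_ring k.invariant_assoc_algebra)

context invariant_faces begin

lemma coeff_closed: "a \<in> carrier A \<Longrightarrow> z \<in> faces \<Longrightarrow> a z \<in> carrier k"
  unfolding A_eq by (rule invariant_memD(1))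

lemma coeff_extensional: "a \<in> carrier A \<Longrightarrow> a \<in> faces \<rightarrow>\<^sub>E carrier k"
  unfolding A_eq by (rule invariant_memD(4))

lemma coeff_composition: "a \<in> carrier A \<Longrightarrow> x \<in> faces \<Longrightarrow> y \<in> faces \<Longrightarrow> composition x = composition y \<Longrightarrow> a x = a y"
  unfolding A_eq by (rule invariant_memD(3))

lemma coeff_eqI:
  assumes "a \<in> carrier A" "b \<in> carrier A" "\<And>z. z \<in> faces \<Longrightarrow> a z = b z"
  shows "a = b"
  using coeff_extensional[OF assms(1)] coeff_extensional[OF assms(2)] assms(3) by (rule PiE_ext)

lemma coeff_simps [simp]:
  assumes "z \<in> faces"
  shows "(a \<oplus> b) z = a z \<oplus>\<^bsub>k\<^esub> b z" "\<zero> z = \<zero>\<^bsub>k\<^esub>" "(c \<odot> a) z = c \<otimes>\<^bsub>k\<^esub> a z"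
    "\<one> z = (if z = face_one then \<one>\<^bsub>k\<^esub> else \<zero>\<^bsub>k\<^esub>)"
  using assms by (simp_all add: A_eq)

lemma coeff_mult:
  "z \<in> faces \<Longrightarrow> (a \<otimes> b) z = (\<Oplus>\<^bsub>k\<^esub>p\<in>face_pairs z. a (fst p) \<otimes>\<^bsub>k\<^esub> b (snd p))"
  by (simp add: A_eq)

lemma coeff_uminus [simp]:
  assumes "a \<in> carrier A" "z \<in> faces"
  shows "(\<ominus> a) z = \<ominus>\<^bsub>k\<^esub> a z"
proof -
  have "(\<ominus> a \<oplus> a) z = \<zero>\<^bsub>k\<^esub>" using assms by (simp add: l_neg del: coeff_simps(1))
  then have "(\<ominus> a) z \<oplus>\<^bsub>k\<^esub> a z = \<zero>\<^bsub>k\<^esub>" using assms by simp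
  then show ?thesis
    using k.minus_equality[of "(\<ominus> a) z" "a z"] coeff_closed[OF assms] coeff_closed[OF a_inv_closed[OF assms(1)] assms(2)] by simp
qed

lemma coeff_minus [simp]:
  assumes "a \<in> carrier A" "b \<in> carrier A" "z \<in> faces"
  shows "(a \<ominus> b) z = a z \<ominus>\<^bsub>k\<^esub> b z"
  using assms by (simp add: a_minus_def k.minus_eq)

lemma coeff_finsum:
  assumes "finite S" "f \<in> S \<rightarrow> carrier A" "z \<in> faces"
  shows "(\<Oplus>s\<in>S. f s) z = (\<Oplus>\<^bsub>k\<^esub>s\<in>S. f s z)"
  using assms(1,2)
proof (induction S rule: finite_induct)
  case (insert s S)
  then have f: "f s \<in> carrier A" "f \<in> S \<rightarrow> carrier A" by auto
  then have "(\<lambda>s. f s z) \<in> S \<rightarrow> carrier k" using assms(3) coeff_closed by blast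
  then show ?case using insert f assms(3) coeff_closed[OF f(1) assms(3)] by simp
qed (simp add: assms(3))

definition orbit_sum :: "(nat list \<Rightarrow> 'k) \<Rightarrow> 'n region \<Rightarrow> 'k" where
  "orbit_sum f = (\<lambda>z \<in> faces. f (composition z))"

lemma orbit_sum_closed [simp]: "(\<And>c. f c \<in> carrier k) \<Longrightarrow> orbit_sum f \<in> carrier A"
  unfolding A_eq by (rule invariant_memI) (simp_all add: orbit_sum_def)

lemma orbit_sum_coeff [simp]: "z \<in> faces \<Longrightarrow> orbit_sum f z = f (composition z)"
  by (simp add: orbit_sum_def)

definition scalar_nat :: "nat \<Rightarrow> 'k" where
  "scalar_nat m = add_pow k m \<one>\<^bsub>k\<^esub>"

lemma scalar_nat_closed [simp]: "scalar_nat m \<in> carrier k"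
  by (simp add: scalar_nat_def)

lemma scalar_nat_nonzero:
  assumes "m dvd fact CARD('n)"
  shows "scalar_nat m \<noteq> \<zero>\<^bsub>k\<^esub>"
proof
  assume "scalar_nat m = \<zero>\<^bsub>k\<^esub>"
  then have "add_pow k m \<one>\<^bsub>k\<^esub> = \<zero>\<^bsub>k\<^esub>" by (simp add: scalar_nat_def)
  then have "group.ord (add_monoid k) \<one>\<^bsub>k\<^esub> dvd m"
    using k.add.pow_eq_id[of "\<one>\<^bsub>k\<^esub>" m] by simp
  then show False using assms characteristic dvd_trans unfolding ring_characteristic_def by blast
qed

text \<open>The value beyond \<open>CARD('n)\<close> is a dummy that keeps \<open>fact_inv\<close>
  in \<open>k\<close>; no face has so many blocks.\<close>

definition fact_inv :: "nat \<Rightarrow> 'k" where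
  "fact_inv l = (if l \<le> CARD('n) then inv\<^bsub>k\<^esub> (scalar_nat (fact l)) else \<zero>\<^bsub>k\<^esub>)"

lemma fact_inv:
  shows fact_inv_closed [simp]: "fact_inv l \<in> carrier k"
    and fact_inv_mult: "l \<le> CARD('n) \<Longrightarrow> scalar_nat (fact l) \<otimes>\<^bsub>k\<^esub> fact_inv l = \<one>\<^bsub>k\<^esub>"
proof -
  have u: "scalar_nat (fact l) \<in> Units k" if "l \<le> CARD('n)"
    using scalar_nat_nonzero[OF fact_dvd[OF that]] by (simp add: k.field_Units)
  show "fact_inv l \<in> carrier k" using u by (auto simp: fact_inv_def)
  show "l \<le> CARD('n) \<Longrightarrow> scalar_nat (fact l) \<otimes>\<^bsub>k\<^esub> fact_inv l = \<one>\<^bsub>k\<^esub>" using u by (simp add: fact_inv_def)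
qed

lemma finsum_const_scalar:
  assumes "c \<in> carrier k"
  shows "(\<Oplus>\<^bsub>k\<^esub>s\<in>S. c) = scalar_nat (card S) \<otimes>\<^bsub>k\<^esub> c"
  using assms k.add.finprod_const[OF assms, of S] k.add_pow_ldistr[of "\<one>\<^bsub>k\<^esub>" c "card S"]
  by (simp add: scalar_nat_def)

subsection \<open>The filtration by the number of blocks\<close>

text \<open>The two-sided ideal of elements supported on faces with at least \<open>l\<close>
  blocks. It is the whole algebra for \<open>l = 1\<close> and zero for
  \<open>l = Suc CARD('n)\<close>.\<close>

definition filt :: "nat \<Rightarrow> ('n region \<Rightarrow> 'k) set" where
  "filt l = {a \<in> carrier A. \<forall>z \<in> faces. nblocks z < l \<longrightarrow> a z = \<zero>\<^bsub>k\<^esub>}"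

lemma filtI: "a \<in> carrier A \<Longrightarrow> (\<And>z. z \<in> faces \<Longrightarrow> nblocks z < l \<Longrightarrow> a z = \<zero>\<^bsub>k\<^esub>) \<Longrightarrow> a \<in> filt l"
  by (simp add: filt_def)

lemma filtD: "a \<in> filt l \<Longrightarrow> z \<in> faces \<Longrightarrow> nblocks z < l \<Longrightarrow> a z = \<zero>\<^bsub>k\<^esub>"
  by (simp add: filt_def)

lemma filt_carrier [simp]: "a \<in> filt l \<Longrightarrow> a \<in> carrier A"
  by (simp add: filt_def)

lemma filt_minus: "a \<in> filt l \<Longrightarrow> b \<in> filt l \<Longrightarrow> a \<ominus> b \<in> filt l"
  by (intro filtI) (simp_all add: filtD k.minus_eq)

lemma filt_mono: "a \<in> filt l \<Longrightarrow> m \<le> l \<Longrightarrow> a \<in> filt m"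
  by (intro filtI) (simp_all add: filtD)

lemma filt_mult:
  assumes a: "a \<in> filt l" and b: "b \<in> carrier A"
  shows "a \<otimes> b \<in> filt l" "b \<otimes> a \<in> filt l"
proof -
  have ac: "a \<in> carrier A" using a by simp
  note [simp] = coeff_closed[OF ac] coeff_closed[OF b]
  show "a \<otimes> b \<in> filt l"
  proof (rule filtI)
    fix z :: "'n region" assume z: "z \<in> faces" "nblocks z < l"
    show "(a \<otimes> b) z = \<zero>\<^bsub>k\<^esub>"
      unfolding coeff_mult[OF z(1)]
    proof (rule k.add.finprod_one_eqI)
      fix p assume p: "p \<in> face_pairs z"
      have "a (fst p) = \<zero>\<^bsub>k\<^esub>"
        using face_pairsD[OF p] mult_nblocks(1)[of "fst p" "snd p"] z by (intro filtD[OF a]) simp_all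
      then show "a (fst p) \<otimes>\<^bsub>k\<^esub> b (snd p) = \<zero>\<^bsub>k\<^esub>" using face_pairsD(2)[OF p] by simp
    qed
  qed (simp add: ac b)
  show "b \<otimes> a \<in> filt l"
  proof (rule filtI)
    fix z :: "'n region" assume z: "z \<in> faces" "nblocks z < l"
    show "(b \<otimes> a) z = \<zero>\<^bsub>k\<^esub>"
      unfolding coeff_mult[OF z(1)]
    proof (rule k.add.finprod_one_eqI)
      fix p assume p: "p \<in> face_pairs z"
      have "a (snd p) = \<zero>\<^bsub>k\<^esub>"
        using face_pairsD[OF p] mult_nblocks(2)[of "fst p" "snd p"] z by (intro filtD[OF a]) simp_all
      then show "b (fst p) \<otimes>\<^bsub>k\<^esub> a (snd p) = \<zero>\<^bsub>k\<^esub>" using face_pairsD(1)[OF p] by simp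
    qed
  qed (simp add: ac b)
qed

lemma filt_top: "a \<in> filt (Suc CARD('n)) \<Longrightarrow> a = \<zero>"
  using nblocks_bounds(2) by (intro coeff_eqI) (auto simp: less_Suc_eq_le intro!: filtD)

lemma filt_bottom: "a \<in> carrier A \<Longrightarrow> a \<in> filt 1"
proof (rule filtI)
  fix z :: "'n region" assume "z \<in> faces" "nblocks z < 1"
  then show "a z = \<zero>\<^bsub>k\<^esub>" using nblocks_bounds(1)[of z] by simp
qed

text \<open>The character of the semigroup algebra attached to the set partition of
  \<open>z\<close>: a face counts one if \<open>z\<close> refines it and zero otherwise.\<close>

definition psi :: "'n region \<Rightarrow> ('n region \<Rightarrow> 'k) \<Rightarrow> 'k" where
  "psi z a = (\<Oplus>\<^bsub>k\<^esub>y\<in>{y \<in> faces. face_refines z y}. a y)"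

lemma psi_closed [simp]: "a \<in> carrier A \<Longrightarrow> psi z a \<in> carrier k"
  unfolding psi_def by (rule k.finsum_closed) (auto simp: coeff_closed)

text \<open>In a factorisation of \<open>z\<close> the left factor has fewer blocks than
  \<open>z\<close>, where \<open>a\<close> vanishes, or it equals \<open>z\<close> by
  \<open>mult_eq_same_nblocks\<close>. The right factors \<open>y\<close> with
  \<open>face_mult z y = z\<close> are those that \<open>z\<close> refines.\<close>

lemma leading_coeff:
  assumes a: "a \<in> filt l" and b: "b \<in> carrier A" and z: "z \<in> faces" "nblocks z = l"
  shows "(a \<otimes> b) z = a z \<otimes>\<^bsub>k\<^esub> psi z b"
proof -
  let ?Y = "{y \<in> faces. face_refines z y}" and ?t = "\<lambda>p. a (fst p) \<otimes>\<^bsub>k\<^esub> b (snd p)"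
  have ac: "a \<in> carrier A" using a by simp
  note [simp] = coeff_closed[OF ac] coeff_closed[OF b]
  have "(a \<otimes> b) z = (\<Oplus>\<^bsub>k\<^esub>p\<in>face_pairs z. ?t p)" by (rule coeff_mult[OF z(1)])
  also have "\<dots> = (\<Oplus>\<^bsub>k\<^esub>p\<in>Pair z ` ?Y. ?t p)"
  proof (rule k.add.finprod_mono_neutral_cong_right)
    show "Pair z ` ?Y \<subseteq> face_pairs z" using z(1) mult_eq_left_iff[OF z(1)] by auto
    show "?t \<in> face_pairs z \<rightarrow> carrier k"
      using ac b face_pairsD by auto
    fix p assume p: "p \<in> face_pairs z - Pair z ` ?Y"
    then have p': "fst p \<in> faces" "snd p \<in> faces" "face_mult (fst p) (snd p) = z" using face_pairsD[of p z] by auto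
    have "fst p \<noteq> z"
    proof
      assume eq: "fst p = z"
      then have "snd p \<in> ?Y" using p' mult_eq_left_iff[OF z(1) p'(2)] by simp
      then have "p \<in> Pair z ` ?Y" using eq by (intro image_eqI[of _ _ "snd p"]) (simp_all add: prod_eq_iff)
      then show False using p by blast
    qed
    then have "\<not> nblocks z \<le> nblocks (fst p)"
      using mult_eq_same_nblocks[OF p'(1,2)] p'(3) by metis
    then have "a (fst p) = \<zero>\<^bsub>k\<^esub>" using p' z(2) by (intro filtD[OF a]) simp_all
    then show "?t p = \<zero>\<^bsub>k\<^esub>" using p' b by simp
  qed simp_all
  also have "\<dots> = (\<Oplus>\<^bsub>k\<^esub>y\<in>?Y. ?t (z, y))"
    using ac b z(1) by (intro k.add.finprod_reindex) (auto simp: inj_on_def)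
  also have "\<dots> = a z \<otimes>\<^bsub>k\<^esub> psi z b"
    unfolding psi_def using ac b z(1) by (simp, intro k.finsum_rdistr[symmetric]) auto
  finally show ?thesis .
qed

text \<open>A product is refined by \<open>z\<close> if and only if both factors are, so the sum
  over the factorisations of such faces runs over all pairs of such faces.\<close>

lemma psi_mult:
  assumes a: "a \<in> carrier A" and b: "b \<in> carrier A" and z: "z \<in> faces"
  shows "psi z (a \<otimes> b) = psi z a \<otimes>\<^bsub>k\<^esub> psi z b"
proof -
  let ?Y = "{y \<in> faces. face_refines z y}" and ?t = "\<lambda>p. a (fst p) \<otimes>\<^bsub>k\<^esub> b (snd p)"
  note [simp] = coeff_closed[OF a] coeff_closed[OF b]
  have "psi z (a \<otimes> b) = (\<Oplus>\<^bsub>k\<^esub>w\<in>?Y. \<Oplus>\<^bsub>k\<^esub>p\<in>face_pairs w. ?t (snd (w, p)))"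
    unfolding psi_def
    by (rule k.finsum_cong') (use face_pairsD a b coeff_mult in \<open>auto intro!: k.finsum_closed\<close>)
  also have "\<dots> = (\<Oplus>\<^bsub>k\<^esub>q\<in>Sigma ?Y face_pairs. ?t (snd q))"
    by (rule k.finsum_Sigma) (use face_pairsD a b in auto)
  also have "\<dots> = (\<Oplus>\<^bsub>k\<^esub>p\<in>?Y \<times> ?Y. ?t p)"
  proof (rule k.finsum_bij)
    show "bij_betw snd (Sigma ?Y face_pairs) (?Y \<times> ?Y)"
    proof (rule bij_betw_byWitness[of _ "\<lambda>p. (face_mult (fst p) (snd p), p)"])
      show "snd ` Sigma ?Y face_pairs \<subseteq> ?Y \<times> ?Y"
        by (auto simp: mult_refines(3))
      show "(\<lambda>p. (face_mult (fst p) (snd p), p)) ` (?Y \<times> ?Y) \<subseteq> Sigma ?Y face_pairs"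
        by (auto simp: mult_refines(3) face_mult_closed)
    qed auto
  qed (use a b in auto)
  also have "\<dots> = (\<Oplus>\<^bsub>k\<^esub>x\<in>?Y. \<Oplus>\<^bsub>k\<^esub>y\<in>?Y. ?t (x, y))"
    by (rule k.finsum_Sigma[symmetric]) (use a b in auto)
  also have "\<dots> = (\<Oplus>\<^bsub>k\<^esub>x\<in>?Y. a x \<otimes>\<^bsub>k\<^esub> psi z b)"
  proof (rule k.finsum_cong'[OF refl])
    fix x assume "x \<in> ?Y"
    then show "(\<Oplus>\<^bsub>k\<^esub>y\<in>?Y. ?t (x, y)) = a x \<otimes>\<^bsub>k\<^esub> psi z b"
      unfolding psi_def using a b by (simp, intro k.finsum_rdistr[symmetric]) auto
  qed (use a b in auto)
  also have "\<dots> = psi z a \<otimes>\<^bsub>k\<^esub> psi z b"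
    using a b unfolding psi_def[of z a] by (intro k.finsum_ldistr[symmetric]) auto
  finally show ?thesis .
qed

lemma psi_add:
  assumes "a \<in> carrier A" "b \<in> carrier A"
  shows "psi z (a \<oplus> b) = psi z a \<oplus>\<^bsub>k\<^esub> psi z b"
proof -
  note [simp] = coeff_closed[OF assms(1)] coeff_closed[OF assms(2)]
  have "psi z (a \<oplus> b) = (\<Oplus>\<^bsub>k\<^esub>y\<in>{y \<in> faces. face_refines z y}. a y \<oplus>\<^bsub>k\<^esub> b y)"
    unfolding psi_def by (rule k.finsum_cong') (use assms in auto)
  also have "\<dots> = psi z a \<oplus>\<^bsub>k\<^esub> psi z b"
    unfolding psi_def by (rule k.finsum_addf) (use assms in auto)
  finally show ?thesis .
qed

lemma psi_smult:
  assumes "c \<in> carrier k" "a \<in> carrier A"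
  shows "psi z (c \<odot> a) = c \<otimes>\<^bsub>k\<^esub> psi z a"
proof -
  note [simp] = coeff_closed[OF assms(2)]
  have "psi z (c \<odot> a) = (\<Oplus>\<^bsub>k\<^esub>y\<in>{y \<in> faces. face_refines z y}. c \<otimes>\<^bsub>k\<^esub> a y)"
    unfolding psi_def by (rule k.finsum_cong') (use assms in auto)
  also have "\<dots> = c \<otimes>\<^bsub>k\<^esub> psi z a"
    unfolding psi_def by (rule k.finsum_rdistr[symmetric]) (use assms in auto)
  finally show ?thesis .
qed

lemma height_face_one: "height (face_one :: 'n region) i = height (face_one :: 'n region) j"
  using height_eq_iff[OF face_one(1), of i j] by simp

lemma psi_one: "psi z \<one> = \<one>\<^bsub>k\<^esub>"
proof -
  have "face_refines z face_one" unfolding face_refines_def by (intro allI impI height_face_one)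
  then have "psi z \<one> = \<one> (face_one :: 'n region)"
    unfolding psi_def by (intro k.finsum_single) auto
  then show ?thesis by simp
qed

lemma psi_ring_hom: "z \<in> faces \<Longrightarrow> psi z \<in> ring_hom A k"
  by (rule ring_hom_memI) (simp_all add: psi_mult psi_add psi_one)

lemma psi_filt:
  assumes "a \<in> filt l" "z \<in> faces" "nblocks z < l"
  shows "psi z a = \<zero>\<^bsub>k\<^esub>"
  unfolding psi_def
proof (rule k.add.finprod_one_eqI)
  fix y assume "y \<in> {y \<in> faces. face_refines z y}"
  then have "y \<in> faces" "nblocks y \<le> nblocks z" using refines_nblocks(1)[OF assms(2), of y] by auto
  then show "a y = \<zero>\<^bsub>k\<^esub>" using assms(3) by (intro filtD[OF assms(1)]) simp_all
qed

text \<open>Among the faces that \<open>z\<close> refines, those with as many blocks as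
  \<open>z\<close> are its reorderings.\<close>

lemma psi_orbit_sum:
  assumes f: "\<And>c. f c \<in> carrier k" "\<And>c. length c \<noteq> nblocks z \<Longrightarrow> f c = \<zero>\<^bsub>k\<^esub>" and z: "z \<in> faces"
  shows "psi z (orbit_sum f) = (\<Oplus>\<^bsub>k\<^esub>y\<in>{y \<in> faces. set (blocks y) = set (blocks z)}. f (composition y))"
  unfolding psi_def
proof (rule k.add.finprod_mono_neutral_cong_right)
  show "{y \<in> faces. set (blocks y) = set (blocks z)} \<subseteq> {y \<in> faces. face_refines z y}"
    using blocks_eq_iff_refines[OF z] by auto
  fix y assume y: "y \<in> {y \<in> faces. face_refines z y} - {y \<in> faces. set (blocks y) = set (blocks z)}"
  then have "nblocks y \<noteq> nblocks z"
    using refines_nblocks(2)[OF z] blocks_eq_iff_refines[OF z] by auto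
  then show "orbit_sum f y = \<zero>\<^bsub>k\<^esub>" using y f(2) by simp
qed (use f in auto)

end

section \<open>Connecting the rearrangements of a word\<close>

text \<open>If the letter \<open>m = a + b\<close> commutes with all other letters up to \<open>E\<close>, then all occurrences of \<open>m\<close>
  can be collected in one place, where the hypothesis allows to exchange \<open>a\<close> and \<open>b\<close>. As the letters
  are positive, this gives all exchanges by downward induction on \<open>a + b\<close>.\<close>

locale word_connection =
  fixes \<mu> :: "nat multiset" and E :: "nat list \<Rightarrow> nat list \<Rightarrow> bool"
  assumes pos: "e \<in># \<mu> \<Longrightarrow> 0 < e"
    and E_refl: "mset c = \<mu> \<Longrightarrow> E c c"
    and E_sym: "E c c' \<Longrightarrow> E c' c"
    and E_trans: "E c c' \<Longrightarrow> E c' c'' \<Longrightarrow> E c c''"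
    and exchange: "a \<noteq> b \<Longrightarrow> a + b \<notin> set x \<Longrightarrow> a + b \<notin> set y \<Longrightarrow>
      mset (x @ [a, b] @ replicate n (a + b) @ y) = \<mu> \<Longrightarrow>
      (\<And>i. i \<le> n \<Longrightarrow> E (x @ replicate i (a + b) @ [a, b] @ replicate (n - i) (a + b) @ y)
        (x @ [a, b] @ replicate n (a + b) @ y)) \<Longrightarrow>
      (\<And>i. i \<le> n \<Longrightarrow> E (x @ replicate i (a + b) @ [b, a] @ replicate (n - i) (a + b) @ y)
        (x @ [b, a] @ replicate n (a + b) @ y)) \<Longrightarrow>
      E (x @ [a, b] @ replicate n (a + b) @ y) (x @ [b, a] @ replicate n (a + b) @ y)"
begin

definition commutes :: "nat \<Rightarrow> nat \<Rightarrow> bool" where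
  "commutes a b \<longleftrightarrow> (\<forall>x y. mset (x @ a # b # y) = \<mu> \<longrightarrow> E (x @ a # b # y) (x @ b # a # y))"

lemma commutesD: "commutes a b \<Longrightarrow> mset (x @ a # b # y) = \<mu> \<Longrightarrow> E (x @ a # b # y) (x @ b # a # y)"
  by (simp add: commutes_def)

lemma commutes_replicate:
  assumes "commutes e m"
  shows "mset (p @ e # replicate n m @ q) = \<mu> \<Longrightarrow> E (p @ e # replicate n m @ q) (p @ replicate n m @ e # q)"
proof (induction n arbitrary: p)
  case 0
  then show ?case by (simp add: E_refl)
next
  case (Suc n)
  have 1: "E (p @ e # m # replicate n m @ q) (p @ m # e # replicate n m @ q)"
    using Suc.prems by (intro commutesD[OF assms]) simp
  have "E ((p @ [m]) @ e # replicate n m @ q) ((p @ [m]) @ replicate n m @ e # q)"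
    using Suc.prems by (intro Suc.IH) (simp add: add_mset_commute)
  then have 2: "E (p @ m # e # replicate n m @ q) (p @ m # replicate n m @ e # q)" by simp
  show ?case using E_trans[OF 1 2] by simp
qed

text \<open>Each other letter is moved behind the copies of \<open>m\<close> already collected from
  its right. The fixed prefix \<open>p\<close> is what the induction passes over.\<close>

lemma collect_letter:
  assumes "\<And>e. e \<in># \<mu> \<Longrightarrow> e \<noteq> m \<Longrightarrow> commutes e m"
  shows "mset (p @ c) = \<mu> \<Longrightarrow> E (p @ c) (p @ replicate (count (mset c) m) m @ filter (\<lambda>e. e \<noteq> m) c)"
proof (induction c arbitrary: p)
  case Nil
  then show ?case by (simp add: E_refl)
next
  case (Cons e c)
  have IH: "E ((p @ [e]) @ c) ((p @ [e]) @ replicate (count (mset c) m) m @ filter (\<lambda>e. e \<noteq> m) c)"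
    using Cons.prems by (intro Cons.IH) simp
  show ?case
  proof (cases "e = m")
    case True
    then show ?thesis using IH by simp
  next
    case False
    have "e \<in># \<mu>" unfolding Cons.prems[symmetric] by simp
    then have com: "commutes e m" using assms False by blast
    define w where "w = replicate (count (mset c) m) m @ filter (\<lambda>e. e \<noteq> m) c"
    have "mset w = mset c"
      unfolding w_def by (rule multiset_eqI) (auto simp: count_eq_zero_iff)
    then have "mset (p @ e # w) = \<mu>" using Cons.prems by simp
    then have "mset (p @ e # replicate (count (mset c) m) m @ filter (\<lambda>e. e \<noteq> m) c) = \<mu>"
      by (simp only: w_def)
    note step = commutes_replicate[OF com this]
    have "E (p @ e # c) (p @ e # replicate (count (mset c) m) m @ filter (\<lambda>e. e \<noteq> m) c)"
      using IH by simp
    from E_trans[OF this step] show ?thesis using False by simp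
  qed
qed

text \<open>Both words are connected to the same normal form, with all copies of \<open>m\<close> in
  front.\<close>

lemma collect_letter_eq:
  assumes "\<And>e. e \<in># \<mu> \<Longrightarrow> e \<noteq> m \<Longrightarrow> commutes e m"
    and "mset c = \<mu>" "mset c' = \<mu>" "filter (\<lambda>e. e \<noteq> m) c = filter (\<lambda>e. e \<noteq> m) c'"
  shows "E c c'"
proof -
  let ?r = "\<lambda>c. replicate (count (mset c) m) m @ filter (\<lambda>e. e \<noteq> m) c"
  have r: "E d (?r d)" if "mset d = \<mu>" for d
    using collect_letter[OF assms(1), of "[]" d] that by simp
  have "?r c' = ?r c" by (simp only: assms(2-4))
  then show ?thesis using E_trans[OF r[OF assms(2)] E_sym] r[OF assms(3)] by simp
qed

text \<open>With \<open>m\<close> movable, a word may be replaced by any other with the same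
  remaining letters. All copies of \<open>m\<close> are gathered behind the pair \<open>a\<close>,
  \<open>b\<close>, where the premises of \<open>exchange\<close> again only require moving
  \<open>m\<close>; afterwards they are put back.\<close>

lemma commutes_sum_less:
  assumes ab: "a + b = m" "a \<in># \<mu>" "b \<in># \<mu>" and com: "\<And>e. e \<in># \<mu> \<Longrightarrow> e \<noteq> m \<Longrightarrow> commutes e m"
  shows "commutes a b"
  unfolding commutes_def
proof (intro allI impI)
  fix x y assume mu: "mset (x @ a # b # y) = \<mu>"
  show "E (x @ a # b # y) (x @ b # a # y)"
  proof (cases "a = b")
    case True
    then show ?thesis using mu E_refl by simp
  next
    case False
    have am: "a \<noteq> m" "b \<noteq> m" using ab(1) pos[OF ab(2)] pos[OF ab(3)] by auto
    define x' y' n where "x' = filter (\<lambda>e. e \<noteq> m) x" and "y' = filter (\<lambda>e. e \<noteq> m) y"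
      and "n = count (mset (x @ y)) m"
    have split: "mset (filter (\<lambda>e. e \<noteq> m) w) + replicate_mset (count (mset w) m) m = mset w" for w
      by (rule multiset_eqI) (auto simp: count_eq_zero_iff)
    have mu': "mset (x' @ y') + replicate_mset n m + {#a, b#} = \<mu>"
    proof -
      have "mset (x' @ y') + replicate_mset n m = mset (x @ y)"
        using split[of "x @ y"] by (simp add: x'_def y'_def n_def)
      moreover have "mset (x @ y) + {#a, b#} = \<mu>" using mu by simp
      ultimately show ?thesis by simp
    qed
    have notin: "m \<notin> set x'" "m \<notin> set y'" by (auto simp: x'_def y'_def)
    have word: "mset (x' @ replicate i m @ [c, d] @ replicate (n - i) m @ y') = \<mu>"
      "filter (\<lambda>e. e \<noteq> m) (x' @ replicate i m @ [c, d] @ replicate (n - i) m @ y') = x' @ [c, d] @ y'"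
      if cd: "i \<le> n" "{#c, d#} = {#a, b#}" for i c d
    proof -
      have "set_mset {#c, d#} = set_mset {#a, b#}" using cd(2) by simp
      then have ne: "c \<noteq> m" "d \<noteq> m" using am by auto
      have "mset (x' @ replicate i m @ [c, d] @ replicate (n - i) m @ y') = mset (x' @ y') + replicate_mset n m + {#c, d#}"
        by (rule multiset_eqI) (use cd(1) in auto)
      then show "mset (x' @ replicate i m @ [c, d] @ replicate (n - i) m @ y') = \<mu>"
        by (simp only: cd(2) mu')
      show "filter (\<lambda>e. e \<noteq> m) (x' @ replicate i m @ [c, d] @ replicate (n - i) m @ y') = x' @ [c, d] @ y'"
        using ne by (simp add: x'_def y'_def filter_replicate)
    qed
    have base: "mset (x' @ [c, d] @ replicate n m @ y') = \<mu>"
      "filter (\<lambda>e. e \<noteq> m) (x' @ [c, d] @ replicate n m @ y') = x' @ [c, d] @ y'"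
      if "{#c, d#} = {#a, b#}" for c d
      using word[of 0 c d] that by simp_all
    have ba: "{#b, a#} = {#a, b#}" by simp
    have "E (x' @ [a, b] @ replicate n m @ y') (x' @ [b, a] @ replicate n m @ y')"
      unfolding ab(1)[symmetric]
    proof (rule exchange[OF False]; unfold ab(1))
      show "m \<notin> set x'" "m \<notin> set y'" by (rule notin)+
      show "mset (x' @ [a, b] @ replicate n m @ y') = \<mu>" by (rule base(1)[OF refl])
      fix i assume i: "i \<le> n"
      show "E (x' @ replicate i m @ [a, b] @ replicate (n - i) m @ y') (x' @ [a, b] @ replicate n m @ y')"
        by (rule collect_letter_eq[OF com]) (assumption, assumption, simp only: word[OF i refl], simp only: base[OF refl], simp only: word[OF i refl] base[OF refl])
      show "E (x' @ replicate i m @ [b, a] @ replicate (n - i) m @ y') (x' @ [b, a] @ replicate n m @ y')"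
        by (rule collect_letter_eq[OF com]) (assumption, assumption, simp only: word[OF i ba], simp only: base[OF ba], simp only: word[OF i ba] base[OF ba])
    qed
    moreover have "E (x @ a # b # y) (x' @ [a, b] @ replicate n m @ y')"
    proof (rule collect_letter_eq[OF com mu base(1)[OF refl]])
      show "filter (\<lambda>e. e \<noteq> m) (x @ a # b # y) = filter (\<lambda>e. e \<noteq> m) (x' @ [a, b] @ replicate n m @ y')"
        unfolding base(2)[OF refl] using am by (simp add: x'_def y'_def)
    qed
    moreover have "E (x' @ [b, a] @ replicate n m @ y') (x @ b # a # y)"
    proof (rule collect_letter_eq[OF com base(1)[OF ba]])
      show "mset (x @ b # a # y) = \<mu>" using mu by (simp add: add_mset_commute)
      show "filter (\<lambda>e. e \<noteq> m) (x' @ [b, a] @ replicate n m @ y') = filter (\<lambda>e. e \<noteq> m) (x @ b # a # y)"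
        unfolding base(2)[OF ba] using am by (simp add: x'_def y'_def)
    qed
    ultimately show ?thesis using E_trans by blast
  qed
qed

text \<open>To exchange \<open>a\<close> and \<open>b\<close>, the letter \<open>a + b\<close> has
  to commute with each other letter \<open>e\<close>, a pair whose sum is larger since
  \<open>e\<close> is positive. If \<open>a + b\<close> is not a letter, there is nothing to
  show.\<close>

lemma commutes_all: "a \<in># \<mu> \<Longrightarrow> b \<in># \<mu> \<Longrightarrow> commutes a b"
proof (induction "2 * sum_mset \<mu> - (a + b)" arbitrary: a b rule: less_induct)
  case less
  have le: "e \<le> sum_mset \<mu>" if "e \<in># \<mu>" for e
    using that by (metis insert_DiffM le_add1 sum_mset.add_mset)
  have "a \<le> sum_mset \<mu>" "b \<le> sum_mset \<mu>" using le less.prems by blast+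
  show ?case
  proof (rule commutes_sum_less[OF refl less.prems])
    fix e assume e: "e \<in># \<mu>"
    show "commutes e (a + b)"
    proof (cases "a + b \<in># \<mu>")
      case True
      \<comment> \<open>Letters are bounded by the sum of \<mu>, so the subtraction in the measure
        does not truncate and the measure decreases strictly.\<close>
      have "a + b + e \<le> 2 * sum_mset \<mu>" using le[OF e] le[OF True] by simp
      then show ?thesis using pos[OF e] e True by (intro less.hyps) auto
    next
      case False
      have "a + b \<in># mset (x @ e # (a + b) # y)" for x y by simp
      then show ?thesis using False unfolding commutes_def by metis
    qed
  qed
qed

lemma move_to_front: "mset (p @ u @ e # v) = \<mu> \<Longrightarrow> E (p @ u @ e # v) (p @ e # u @ v)"
proof (induction u arbitrary: p)
  case Nil
  then show ?case by (simp add: E_refl)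
next
  case (Cons d u)
  have "E ((p @ [d]) @ u @ e # v) ((p @ [d]) @ e # u @ v)"
    using Cons.prems by (intro Cons.IH) simp
  moreover have "E (p @ d # e # u @ v) (p @ e # d # u @ v)"
  proof (rule commutesD)
    have "d \<in># \<mu>" "e \<in># \<mu>" unfolding Cons.prems[symmetric] by simp_all
    then show "commutes d e" by (rule commutes_all)
    show "mset (p @ d # e # u @ v) = \<mu>" using Cons.prems by (simp add: add_mset_commute)
  qed
  ultimately show ?case using E_trans by simp
qed

lemma rearrangements_connected_prefix:
  "mset (p @ c) = \<mu> \<Longrightarrow> mset c = mset c' \<Longrightarrow> E (p @ c) (p @ c')"
proof (induction c' arbitrary: p c)
  case Nil
  then show ?case by (simp add: E_refl)
next
  case (Cons e c')
  then have "e \<in> set c" by (metis list.set_intros(1) set_mset_mset)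
  then obtain u v where c: "c = u @ e # v" by (meson split_list)
  have "E (p @ u @ e # v) (p @ e # u @ v)" using Cons.prems c by (intro move_to_front) simp
  moreover have "E ((p @ [e]) @ (u @ v)) ((p @ [e]) @ c')"
    using Cons.prems c by (intro Cons.IH) simp_all
  ultimately show ?case using E_trans c by simp
qed

theorem rearrangements_connected: "mset c = \<mu> \<Longrightarrow> mset c' = \<mu> \<Longrightarrow> E c c'"
  using rearrangements_connected_prefix[of "[]" c c'] by simp

end

text \<open>Merging \<open>a\<close> and \<open>b\<close> produces the letter \<open>a + b\<close>
  at position \<open>j\<close>; as neither \<open>x\<close> nor \<open>y\<close> contains it,
  \<open>j\<close> lies in the run between them.\<close>

lemma merge_adjacent_block:
  assumes m: "a + b \<notin> set x" "a + b \<notin> set y"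
  shows "Suc j < length c \<and> merge_adjacent c j = x @ replicate (Suc n) (a + b) @ y \<and> c ! j = a \<and> c ! Suc j = b
    \<longleftrightarrow> (\<exists>i \<le> n. j = length x + i \<and> c = x @ replicate i (a + b) @ [a, b] @ replicate (n - i) (a + b) @ y)"
    (is "?L \<longleftrightarrow> ?R")
proof
  let ?d = "x @ replicate (Suc n) (a + b) @ y"
  assume L: ?L
  have c: "c = take j c @ [a, b] @ drop (j + 2) c"
    using L id_take_nth_drop[of j c] Cons_nth_drop_Suc[of "Suc j" c] by simp
  have d: "take j c @ (a + b) # drop (j + 2) c = ?d"
  proof -
    have "merge_adjacent c j = ?d" "c ! j = a" "c ! Suc j = b" using L by blast+
    then show ?thesis by (simp only: merge_adjacent_def)
  qed
  have lenj: "length (take j c) = j" using L by simp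
  have dj: "?d ! j = a + b" using d lenj by (metis nth_append_length)
  have jd: "j < length ?d" using arg_cong[OF d, of length] lenj by simp
  have "length x \<le> j"
  proof (rule ccontr)
    assume "\<not> length x \<le> j"
    then have "?d ! j = x ! j" "j < length x" by (simp_all add: nth_append)
    then show False using dj m(1) nth_mem by metis
  qed
  moreover have "j \<le> length x + n"
  proof (rule ccontr)
    assume "\<not> j \<le> length x + n"
    then have "((x @ replicate (Suc n) (a + b)) @ y) ! j = y ! (j - length x - Suc n)"
      by (subst nth_append) simp
    moreover have "j - length x - Suc n < length y" using jd \<open>\<not> j \<le> length x + n\<close> by simp
    ultimately have "?d ! j = y ! (j - length x - Suc n)" "j - length x - Suc n < length y"
      by simp_all
    then show False using dj m(2) nth_mem by metis
  qed
  ultimately obtain i where i: "j = length x + i" "i \<le> n" by (metis le_Suc_ex nat_add_left_cancel_le)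
  have split: "?d = (x @ replicate i (a + b)) @ (a + b) # (replicate (n - i) (a + b) @ y)"
  proof -
    have "replicate (Suc n) (a + b) = replicate i (a + b) @ (a + b) # replicate (n - i) (a + b)"
      using i(2) by (metis Suc_diff_le add_diff_inverse_nat le_imp_less_Suc le_SucI not_less replicate_Suc replicate_add)
    then show ?thesis by simp
  qed
  have "take j c = x @ replicate i (a + b) \<and> drop (j + 2) c = replicate (n - i) (a + b) @ y"
    using d[unfolded split] lenj i(1) by (subst (asm) append_eq_append_conv) auto
  then show ?R using c i by (intro exI[of _ i]) simp
next
  assume ?R
  then obtain i where i: "i \<le> n" "j = length x + i"
    "c = x @ replicate i (a + b) @ [a, b] @ replicate (n - i) (a + b) @ y" by blast
  have rep: "replicate i (a + b) @ (a + b) # replicate (n - i) (a + b) = replicate (Suc n) (a + b)"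
    using i(1) by (metis Suc_diff_le add_diff_inverse_nat le_imp_less_Suc le_SucI not_less replicate_Suc replicate_add)
  show ?L using rep by (simp add: i merge_adjacent_def nth_append)
qed

text \<open>A word determines its splitting position: at the smaller of two positions one word has
  the letter \<open>a\<close>, the other \<open>a + b\<close>, and \<open>b\<close> is
  positive.\<close>

lemma merge_adjacent_block_card:
  assumes m: "a + b \<notin> set x" "a + b \<notin> set y" and a: "0 < a" "0 < b"
  shows "card {j. Suc j < length c \<and> merge_adjacent c j = x @ replicate (Suc n) (a + b) @ y \<and> c ! j = a \<and> c ! Suc j = b}
    = (if \<exists>i \<le> n. c = x @ replicate i (a + b) @ [a, b] @ replicate (n - i) (a + b) @ y then 1 else 0)"
proof -
  let ?w = "\<lambda>i. x @ replicate i (a + b) @ [a, b] @ replicate (n - i) (a + b) @ y"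
  have inj: "i = i'" if "?w i = ?w i'" for i i'
  proof -
    have False if lt: "i < i'" and eq: "?w i = ?w i'" for i i'
    proof -
      have "?w i ! (length x + i) = a" by (simp add: nth_append)
      moreover have "?w i' ! (length x + i) = a + b" using lt by (simp add: nth_append)
      ultimately have "a = a + b" by (simp only: eq)
      then show False using a by simp
    qed
    then show ?thesis using that by (metis linorder_neqE_nat)
  qed
  show ?thesis
  proof (cases "\<exists>i \<le> n. c = ?w i")
    case True
    then obtain i where i: "i \<le> n" "c = ?w i" by blast
    have "{j. \<exists>i \<le> n. j = length x + i \<and> c = ?w i} = {length x + i}"
      using i inj by blast
    then show ?thesis unfolding merge_adjacent_block[OF m] using True by simp
  next
    case False
    then have empty: "{j. \<exists>i \<le> n. j = length x + i \<and> c = ?w i} = {}" by blast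
    show ?thesis unfolding merge_adjacent_block[OF m] empty if_not_P[OF False] by simp
  qed
qed

context invariant_faces begin

section \<open>Primitive idempotents of the invariants\<close>

definition face_type :: "'n region \<Rightarrow> nat multiset" where
  "face_type z = mset (composition z)"

lemma face_type_in_parts [simp]: "z \<in> faces \<Longrightarrow> face_type z \<in> integer_partitions CARD('n)"
  using composition_pos[of z] sum_composition[of z]
  by (auto simp: face_type_def integer_partitions_def sum_mset_sum_list)

lemma size_face_type [simp]: "size (face_type z) = nblocks z"
  by (simp add: face_type_def)

lemma face_type_same_blocks:
  "y \<in> faces \<Longrightarrow> z \<in> faces \<Longrightarrow> set (blocks y) = set (blocks z) \<Longrightarrow> face_type y = face_type z"
  by (simp add: face_type_def mset_composition)

lemma parts_face:
  assumes "mset c \<in> integer_partitions CARD('n)"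
  obtains z :: "'n region" where "z \<in> faces" "composition z = c"
proof -
  have "sum_list c = CARD('n)" "\<And>a. a \<in> set c \<Longrightarrow> 0 < a"
    using assms by (auto simp: integer_partitions_def sum_mset_sum_list)
  from exists_face_of_composition[OF this] show thesis using that by blast
qed

lemma parts_eq: "integer_partitions CARD('n) = face_type ` faces"
proof
  show "integer_partitions CARD('n) \<subseteq> face_type ` faces"
  proof
    fix \<mu> assume mu: "\<mu> \<in> integer_partitions CARD('n)"
    obtain c where c: "mset c = \<mu>" using ex_mset by blast
    obtain z :: "'n region" where "z \<in> faces" "composition z = c" using parts_face[of c] mu c by blast
    then show "\<mu> \<in> face_type ` faces" using c by (force simp: face_type_def)
  qed
qed auto

lemma finite_parts [simp]: "finite (integer_partitions CARD('n))"
  by (simp add: parts_eq)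

lemma size_parts: "\<mu> \<in> integer_partitions CARD('n) \<Longrightarrow> 0 < size \<mu> \<and> size \<mu> \<le> CARD('n)"
  using nblocks_bounds by (auto simp: parts_eq)

definition type_rep :: "nat multiset \<Rightarrow> 'n region" where
  "type_rep \<mu> = (SOME z. z \<in> faces \<and> face_type z = \<mu>)"

lemma type_rep:
  assumes "\<mu> \<in> integer_partitions CARD('n)"
  shows "type_rep \<mu> \<in> faces" "face_type (type_rep \<mu>) = \<mu>" "nblocks (type_rep \<mu>) = size \<mu>"
proof -
  have "\<exists>z. z \<in> faces \<and> face_type z = \<mu>" using assms by (auto simp: parts_eq)
  from someI_ex[OF this] show 1: "type_rep \<mu> \<in> faces" "face_type (type_rep \<mu>) = \<mu>"
    by (simp_all add: type_rep_def)
  show "nblocks (type_rep \<mu>) = size \<mu>" using size_face_type[of "type_rep \<mu>"] 1(2) by simp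
qed

text \<open>A set partition with \<open>l\<close> blocks has \<open>l!\<close> orderings, so the
  factor \<open>fact_inv l\<close> gives \<open>len_elem l\<close> the value one under its
  character. The same normalisation for a single type is used in \<open>type_elem\<close>.\<close>

definition len_elem :: "nat \<Rightarrow> 'n region \<Rightarrow> 'k" where
  "len_elem l = orbit_sum (\<lambda>c. if length c = l then fact_inv l else \<zero>\<^bsub>k\<^esub>)"

definition type_elem :: "nat multiset \<Rightarrow> 'n region \<Rightarrow> 'k" where
  "type_elem \<mu> = orbit_sum (\<lambda>c. if mset c = \<mu> then fact_inv (size \<mu>) else \<zero>\<^bsub>k\<^esub>)"

lemma len_elem_coeff: "z \<in> faces \<Longrightarrow> len_elem l z = (if nblocks z = l then fact_inv l else \<zero>\<^bsub>k\<^esub>)"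
  by (simp add: len_elem_def)

lemma type_elem_coeff: "z \<in> faces \<Longrightarrow> type_elem \<mu> z = (if face_type z = \<mu> then fact_inv (size \<mu>) else \<zero>\<^bsub>k\<^esub>)"
  by (simp add: type_elem_def face_type_def)

lemma len_elem_closed [simp]: "len_elem l \<in> carrier A"
  unfolding len_elem_def by (rule orbit_sum_closed) simp

lemma type_elem_closed [simp]: "type_elem \<mu> \<in> carrier A"
  unfolding type_elem_def by (rule orbit_sum_closed) simp

lemma len_elem_filt: "len_elem l \<in> filt l"
  by (rule filtI) (simp_all add: len_elem_coeff)

lemma type_elem_filt: "type_elem \<mu> \<in> filt (size \<mu>)"
  by (rule filtI) (auto simp: type_elem_coeff)

lemma psi_len_elem:
  assumes z: "z \<in> faces" "nblocks z = l"
  shows "psi z (len_elem l) = \<one>\<^bsub>k\<^esub>"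
proof -
  let ?S = "{y \<in> faces. set (blocks y) = set (blocks z)}"
  have "psi z (len_elem l) = (\<Oplus>\<^bsub>k\<^esub>y\<in>?S. (\<lambda>c. if length c = l then fact_inv l else \<zero>\<^bsub>k\<^esub>) (composition y))"
    unfolding len_elem_def by (rule psi_orbit_sum) (use z in auto)
  also have "\<dots> = (\<Oplus>\<^bsub>k\<^esub>y\<in>?S. fact_inv l)"
  proof (rule k.finsum_cong'[OF refl])
    fix y assume "y \<in> ?S"
    then have "nblocks y = l" using nblocks_card[of y] nblocks_card[OF z(1)] z(2) by auto
    then show "(\<lambda>c. if length c = l then fact_inv l else \<zero>\<^bsub>k\<^esub>) (composition y) = fact_inv l" by simp
  qed simp
  also have "\<dots> = scalar_nat (fact l) \<otimes>\<^bsub>k\<^esub> fact_inv l"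
    unfolding finsum_const_scalar[OF fact_inv_closed] card_same_blocks[OF z(1)] z(2) by (rule refl)
  also have "\<dots> = \<one>\<^bsub>k\<^esub>" using fact_inv_mult nblocks_bounds(2)[OF z(1)] z(2) by simp
  finally show ?thesis .
qed

lemma psi_type_elem:
  assumes z: "z \<in> faces" "nblocks z = size \<nu>"
  shows "psi z (type_elem \<nu>) = (if face_type z = \<nu> then \<one>\<^bsub>k\<^esub> else \<zero>\<^bsub>k\<^esub>)"
proof -
  let ?S = "{y \<in> faces. set (blocks y) = set (blocks z)}"
  let ?f = "\<lambda>c. if mset c = \<nu> then fact_inv (size \<nu>) else \<zero>\<^bsub>k\<^esub>"
  have eq: "psi z (type_elem \<nu>) = (\<Oplus>\<^bsub>k\<^esub>y\<in>?S. ?f (composition y))"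
    unfolding type_elem_def by (rule psi_orbit_sum) (use z in \<open>auto simp flip: size_mset\<close>)
  have t: "mset (composition y) = face_type z" if "y \<in> ?S" for y
    using face_type_same_blocks[of y z] that z by (simp add: face_type_def)
  show ?thesis
  proof (cases "face_type z = \<nu>")
    case True
    have "(\<Oplus>\<^bsub>k\<^esub>y\<in>?S. ?f (composition y)) = (\<Oplus>\<^bsub>k\<^esub>y\<in>?S. fact_inv (size \<nu>))"
      by (rule k.finsum_cong'[OF refl]) (use t True in auto)
    also have "\<dots> = scalar_nat (fact (size \<nu>)) \<otimes>\<^bsub>k\<^esub> fact_inv (size \<nu>)"
      unfolding finsum_const_scalar[OF fact_inv_closed] card_same_blocks[OF z(1)] z(2) by (rule refl)
    also have "\<dots> = \<one>\<^bsub>k\<^esub>" using fact_inv_mult nblocks_bounds(2)[OF z(1)] z(2) by simp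
    finally show ?thesis using eq True by simp
  next
    case False
    have "(\<Oplus>\<^bsub>k\<^esub>y\<in>?S. ?f (composition y)) = \<zero>\<^bsub>k\<^esub>"
      by (rule k.add.finprod_one_eqI) (use t False in auto)
    then show ?thesis using eq False by simp
  qed
qed

lemma filt_Suc:
  assumes "a \<in> filt l" "\<And>z. z \<in> faces \<Longrightarrow> nblocks z = l \<Longrightarrow> a z = \<zero>\<^bsub>k\<^esub>"
  shows "a \<in> filt (Suc l)"
proof (rule filtI)
  fix z :: "'n region" assume "z \<in> faces" "nblocks z < Suc l"
  then show "a z = \<zero>\<^bsub>k\<^esub>" using assms(2)[of z] filtD[OF assms(1), of z] by (cases "nblocks z = l") simp_all
qed (use assms in simp)

lemma minus_filt_Suc:
  assumes "a \<in> filt l" "b \<in> filt l" "\<And>z. z \<in> faces \<Longrightarrow> nblocks z = l \<Longrightarrow> a z = b z"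
  shows "a \<ominus> b \<in> filt (Suc l)"
proof (rule filt_Suc[OF filt_minus[OF assms(1,2)]])
  fix z :: "'n region" assume z: "z \<in> faces" "nblocks z = l"
  have "a z = b z" by (rule assms(3)[OF z])
  then show "(a \<ominus> b) z = \<zero>\<^bsub>k\<^esub>"
    using z assms(1,2) coeff_closed[of b z] by (simp add: k.minus_eq k.r_neg)
qed

text \<open>\<open>tail_elem l\<close> is the product of the \<open>1 - len_elem j\<close> for \<open>j = l, ..., n\<close>. It is the idempotent whose
  left annihilator contains all faces with at least \<open>l\<close> blocks.\<close>

primrec tail_aux :: "nat \<Rightarrow> 'n region \<Rightarrow> 'k" where
  "tail_aux 0 = \<one>"
| "tail_aux (Suc m) = (\<one> \<ominus> len_elem (CARD('n) - m)) \<otimes> tail_aux m"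

definition tail_elem :: "nat \<Rightarrow> 'n region \<Rightarrow> 'k" where
  "tail_elem l = tail_aux (Suc CARD('n) - l)"

lemma tail_elem_closed [simp]: "tail_elem l \<in> carrier A"
proof -
  have "tail_aux m \<in> carrier A" for m by (induction m) simp_all
  then show ?thesis by (simp add: tail_elem_def)
qed

lemma tail_elem_top: "tail_elem (Suc CARD('n)) = \<one>"
  by (simp add: tail_elem_def)

lemma tail_elem_step:
  assumes "l \<le> CARD('n)"
  shows "tail_elem l = (\<one> \<ominus> len_elem l) \<otimes> tail_elem (Suc l)"
proof -
  have "Suc CARD('n) - l = Suc (CARD('n) - l)" using assms by simp
  then show ?thesis using assms by (simp add: tail_elem_def)
qed

lemma tail_elem_step':
  assumes "l \<le> CARD('n)"
  shows "tail_elem l = tail_elem (Suc l) \<ominus> len_elem l \<otimes> tail_elem (Suc l)"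
  unfolding tail_elem_step[OF assms] by (simp add: a_minus_def l_distr l_minus)

lemma minus_mult_zero_iff:
  assumes "a \<in> carrier A" "b \<in> carrier A" "c \<in> carrier A" "(a \<ominus> b) \<otimes> c = \<zero>"
  shows "a \<otimes> c = b \<otimes> c"
proof -
  have "a \<otimes> c \<ominus> b \<otimes> c = \<zero>" using assms by (simp add: a_minus_def l_distr l_minus)
  then show ?thesis using assms by simp
qed

text \<open>By \<open>leading_coeff\<close>, \<open>a\<close> and
  \<open>a \<otimes> len_elem l\<close> agree on the faces with \<open>l\<close> blocks, so the
  first factor of the tail moves \<open>a\<close> into the next step of the filtration. The
  induction runs downwards from \<open>Suc CARD('n)\<close>, where the filtration is zero.\<close>

lemma filt_mult_tail: "l \<le> Suc CARD('n) \<Longrightarrow> a \<in> filt l \<Longrightarrow> a \<otimes> tail_elem l = \<zero>"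
proof (induction l arbitrary: a rule: inc_induct)
  case base
  then show ?case using filt_top by (simp add: tail_elem_top)
next
  case (step l)
  have ac: "a \<in> carrier A" using step.prems by simp
  have "a \<ominus> a \<otimes> len_elem l \<in> filt (Suc l)"
  proof (rule minus_filt_Suc[OF step.prems filt_mult(1)[OF step.prems len_elem_closed]])
    fix z :: "'n region" assume z: "z \<in> faces" "nblocks z = l"
    then show "a z = (a \<otimes> len_elem l) z"
      using leading_coeff[OF step.prems len_elem_closed z] psi_len_elem[OF z] coeff_closed[OF ac z(1)] by simp
  qed
  then have "(a \<ominus> a \<otimes> len_elem l) \<otimes> tail_elem (Suc l) = \<zero>" by (rule step.IH)
  moreover have "a \<otimes> tail_elem l = (a \<ominus> a \<otimes> len_elem l) \<otimes> tail_elem (Suc l)"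
    using step.hyps ac by (simp add: tail_elem_step a_minus_def r_distr r_minus l_distr l_minus m_assoc)
  ultimately show ?case by simp
qed

lemma tail_elem_one: "tail_elem 1 = \<zero>"
  using filt_mult_tail[of 1 \<one>] filt_bottom[OF one_closed] by simp

lemma tail_elem_minus_one: "l \<le> Suc CARD('n) \<Longrightarrow> tail_elem l \<ominus> \<one> \<in> filt l"
proof (induction l rule: inc_induct)
  case base
  show ?case by (rule filtI) (simp_all add: tail_elem_top a_minus_def r_neg)
next
  case (step l)
  have "tail_elem l \<ominus> \<one> = (tail_elem (Suc l) \<ominus> \<one>) \<ominus> len_elem l \<otimes> tail_elem (Suc l)"
    using step.hyps by (simp add: tail_elem_step' a_minus_def a_ac)
  moreover have "tail_elem (Suc l) \<ominus> \<one> \<in> filt l" by (rule filt_mono[OF step.IH]) simp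
  moreover have "len_elem l \<otimes> tail_elem (Suc l) \<in> filt l"
    by (rule filt_mult(1)[OF len_elem_filt tail_elem_closed])
  ultimately show ?case using filt_minus by simp
qed

lemma filt_mult_mult_tail:
  assumes "l \<le> CARD('n)" "a \<in> filt (Suc l)" "b \<in> carrier A"
  shows "a \<otimes> (b \<otimes> tail_elem (Suc l)) = \<zero>"
proof -
  have "(a \<otimes> b) \<otimes> tail_elem (Suc l) = \<zero>"
    using assms by (intro filt_mult_tail filt_mult(1)) simp_all
  then show ?thesis using assms by (simp add: m_assoc)
qed

text \<open>The difference of \<open>tail_elem m\<close> and \<open>\<one>\<close> lies in
  \<open>filt m\<close>, hence in \<open>filt (Suc l)\<close>, which annihilates left multiples of
  the tail.\<close>

lemma tail_mult_absorb:
  assumes "l \<le> CARD('n)" "l < m" "m \<le> Suc CARD('n)" "b \<in> carrier A"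
  shows "tail_elem m \<otimes> (b \<otimes> tail_elem (Suc l)) = b \<otimes> tail_elem (Suc l)"
proof -
  have "(tail_elem m \<ominus> \<one>) \<otimes> (b \<otimes> tail_elem (Suc l)) = \<zero>"
    using assms filt_mono[OF tail_elem_minus_one[of m], of "Suc l"] by (intro filt_mult_mult_tail) simp_all
  from minus_mult_zero_iff[OF _ _ _ this] show ?thesis using assms(4) by simp
qed

text \<open>Modulo faces with more blocks, the \<open>type_elem\<close> of one size are already
  orthogonal idempotents; the tail on the right turns these congruences into equations.\<close>

definition idem :: "nat multiset \<Rightarrow> 'n region \<Rightarrow> 'k" where
  "idem \<mu> = type_elem \<mu> \<otimes> tail_elem (Suc (size \<mu>))"

lemma idem_closed [simp]: "idem \<mu> \<in> carrier A"
  by (simp add: idem_def)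

text \<open>The difference lies in \<open>filt (Suc l)\<close>, which the tail annihilates. This is
  the form in which most identities below are checked.\<close>

lemma mult_tail_cong:
  assumes "l \<le> CARD('n)" "a \<in> filt l" "b \<in> filt l" "\<And>z. z \<in> faces \<Longrightarrow> nblocks z = l \<Longrightarrow> a z = b z"
  shows "a \<otimes> tail_elem (Suc l) = b \<otimes> tail_elem (Suc l)"
proof -
  have "a \<ominus> b \<in> filt (Suc l)" by (rule minus_filt_Suc[OF assms(2-4)])
  then have "(a \<ominus> b) \<otimes> tail_elem (Suc l) = \<zero>" using assms(1) by (intro filt_mult_tail) simp_all
  from minus_mult_zero_iff[OF _ _ _ this] show ?thesis using assms(2,3) by simp
qed

lemma len_elem_idem:
  assumes nu: "\<nu> \<in> integer_partitions CARD('n)"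
  shows "len_elem (size \<nu>) \<otimes> idem \<nu> = idem \<nu>"
proof -
  have "(len_elem (size \<nu>) \<otimes> type_elem \<nu>) \<otimes> tail_elem (Suc (size \<nu>)) = type_elem \<nu> \<otimes> tail_elem (Suc (size \<nu>))"
  proof (rule mult_tail_cong)
    show "size \<nu> \<le> CARD('n)" using size_parts[OF nu] by simp
    show "len_elem (size \<nu>) \<otimes> type_elem \<nu> \<in> filt (size \<nu>)" by (rule filt_mult(2)[OF type_elem_filt len_elem_closed])
    show "type_elem \<nu> \<in> filt (size \<nu>)" by (rule type_elem_filt)
    fix z :: "'n region" assume z: "z \<in> faces" "nblocks z = size \<nu>"
    show "(len_elem (size \<nu>) \<otimes> type_elem \<nu>) z = type_elem \<nu> z"
      using leading_coeff[OF len_elem_filt type_elem_closed z] psi_type_elem[OF z] z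
      by (simp add: len_elem_coeff type_elem_coeff)
  qed
  then show ?thesis by (simp add: idem_def m_assoc)
qed

text \<open>Factors of the tail with index above \<open>size \<nu>\<close> fix
  \<open>idem \<nu>\<close>; the factor with index \<open>size \<nu>\<close> annihilates it because
  \<open>len_elem\<close> of that index acts on it as the identity.\<close>

lemma tail_idem:
  assumes nu: "\<nu> \<in> integer_partitions CARD('n)" and "0 < m"
  shows "m \<le> size \<nu> \<Longrightarrow> tail_elem m \<otimes> idem \<nu> = \<zero>"
    and "size \<nu> < m \<Longrightarrow> m \<le> Suc CARD('n) \<Longrightarrow> tail_elem m \<otimes> idem \<nu> = idem \<nu>"
proof -
  have n: "size \<nu> \<le> CARD('n)" using size_parts[OF nu] by simp
  show 1: "tail_elem m \<otimes> idem \<nu> = idem \<nu>" if "size \<nu> < m" "m \<le> Suc CARD('n)" for m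
    unfolding idem_def using n that by (intro tail_mult_absorb) simp_all
  show "tail_elem m \<otimes> idem \<nu> = \<zero>" if "m \<le> size \<nu>"
    using that
  proof (induction m rule: inc_induct)
    case base
    have "tail_elem (size \<nu>) \<otimes> idem \<nu> = (\<one> \<ominus> len_elem (size \<nu>)) \<otimes> (tail_elem (Suc (size \<nu>)) \<otimes> idem \<nu>)"
      using n by (simp add: tail_elem_step m_assoc)
    also have "\<dots> = (\<one> \<ominus> len_elem (size \<nu>)) \<otimes> idem \<nu>" using 1[of "Suc (size \<nu>)"] n by simp
    also have "\<dots> = \<zero>" using len_elem_idem[OF nu] by (simp add: a_minus_def l_distr l_minus r_neg)
    finally show ?case .
  next
    case (step m)
    then show ?case using n by (simp add: tail_elem_step m_assoc)
  qed
qed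

text \<open>For smaller \<open>size \<mu>\<close> the tail inside the first idempotent annihilates
  the second; for larger size the second annihilates the first by the filtration; for equal sizes
  only leading coefficients matter, and they are given by characters.\<close>

lemma idem_mult:
  assumes mu: "\<mu> \<in> integer_partitions CARD('n)" and nu: "\<nu> \<in> integer_partitions CARD('n)"
  shows "idem \<mu> \<otimes> idem \<nu> = (if \<mu> = \<nu> then idem \<mu> else \<zero>)"
proof -
  have n: "size \<nu> \<le> CARD('n)" "size \<mu> \<le> CARD('n)" using size_parts[OF nu] size_parts[OF mu] by simp_all
  have eq: "idem \<mu> \<otimes> idem \<nu> = type_elem \<mu> \<otimes> (tail_elem (Suc (size \<mu>)) \<otimes> idem \<nu>)"
    by (simp add: idem_def[of \<mu>] m_assoc)
  consider "size \<mu> < size \<nu>" | "size \<mu> = size \<nu>" | "size \<nu> < size \<mu>" by linarith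
  then show ?thesis
  proof cases
    case 1
    then have "idem \<mu> \<otimes> idem \<nu> = \<zero>" unfolding eq using tail_idem(1)[OF nu, of "Suc (size \<mu>)"] by simp
    then show ?thesis using 1 by auto
  next
    case 2
    let ?b = "if \<mu> = \<nu> then type_elem \<mu> else \<zero>"
    have "idem \<mu> \<otimes> idem \<nu> = (type_elem \<mu> \<otimes> type_elem \<nu>) \<otimes> tail_elem (Suc (size \<nu>))"
      unfolding eq using tail_idem(2)[OF nu, of "Suc (size \<mu>)"] 2 n by (simp add: idem_def m_assoc)
    also have "\<dots> = ?b \<otimes> tail_elem (Suc (size \<nu>))"
    proof (rule mult_tail_cong)
      have f: "type_elem \<mu> \<in> filt (size \<nu>)" using type_elem_filt[of \<mu>] 2 by simp
      show "type_elem \<mu> \<otimes> type_elem \<nu> \<in> filt (size \<nu>)" by (rule filt_mult(1)[OF f type_elem_closed])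
      show "?b \<in> filt (size \<nu>)" using f by (auto intro: filtI)
      fix z :: "'n region" assume z: "z \<in> faces" "nblocks z = size \<nu>"
      show "(type_elem \<mu> \<otimes> type_elem \<nu>) z = ?b z"
        using leading_coeff[OF f type_elem_closed z] psi_type_elem[OF z] z by (auto simp: type_elem_coeff)
    qed (rule n(1))
    finally show ?thesis using 2 by (simp add: idem_def)
  next
    case 3
    have "idem \<mu> \<in> filt (size \<mu>)" unfolding idem_def by (rule filt_mult(1)[OF type_elem_filt tail_elem_closed])
    then have "idem \<mu> \<in> filt (Suc (size \<nu>))" by (rule filt_mono) (use 3 in simp)
    then have "idem \<mu> \<otimes> idem \<nu> = \<zero>"
      unfolding idem_def[of \<nu>] using n by (intro filt_mult_mult_tail) simp_all
    then show ?thesis using 3 by auto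
  qed
qed

lemma sum_type_elem: "l \<le> CARD('n) \<Longrightarrow> (\<Oplus>\<mu>\<in>{\<mu> \<in> integer_partitions CARD('n). size \<mu> = l}. type_elem \<mu>) = len_elem l"
proof (rule coeff_eqI)
  let ?S = "{\<mu> \<in> integer_partitions CARD('n). size \<mu> = l}"
  show "(\<Oplus>\<mu>\<in>?S. type_elem \<mu>) \<in> carrier A" by (rule finsum_closed) simp
  fix z :: "'n region" assume z: "z \<in> faces"
  have "(\<Oplus>\<mu>\<in>?S. type_elem \<mu>) z = (\<Oplus>\<^bsub>k\<^esub>\<mu>\<in>?S. type_elem \<mu> z)"
    by (rule coeff_finsum) (use z in simp_all)
  also have "\<dots> = len_elem l z"
  proof (cases "nblocks z = l")
    case True
    then have "face_type z \<in> ?S" using z by simp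
    then have "(\<Oplus>\<^bsub>k\<^esub>\<mu>\<in>?S. type_elem \<mu> z) = type_elem (face_type z) z"
      by (intro k.finsum_single) (use z in \<open>auto simp: type_elem_coeff\<close>)
    then show ?thesis using z True by (simp add: type_elem_coeff len_elem_coeff)
  next
    case False
    have "(\<Oplus>\<^bsub>k\<^esub>\<mu>\<in>?S. type_elem \<mu> z) = \<zero>\<^bsub>k\<^esub>"
      by (rule k.add.finprod_one_eqI) (use z False in \<open>auto simp: type_elem_coeff\<close>)
    then show ?thesis using z False by (simp add: len_elem_coeff)
  qed
  finally show "(\<Oplus>\<mu>\<in>?S. type_elem \<mu>) z = len_elem l z" .
qed simp

text \<open>The idempotents of size \<open>l\<close> add up to
  \<open>len_elem l \<otimes> tail_elem (Suc l)\<close>, the difference of two consecutive tails, so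
  the sum telescopes.\<close>

lemma sum_idem_tail: "l \<le> Suc CARD('n) \<Longrightarrow> (\<Oplus>\<mu>\<in>{\<mu> \<in> integer_partitions CARD('n). l \<le> size \<mu>}. idem \<mu>) = \<one> \<ominus> tail_elem l"
proof (induction l rule: inc_induct)
  case base
  have "{\<mu> \<in> integer_partitions CARD('n). Suc CARD('n) \<le> size \<mu>} = {}" using size_parts by fastforce
  then show ?case by (simp only: finsum_empty tail_elem_top) (simp add: a_minus_def r_neg)
next
  case (step l)
  let ?S = "{\<mu> \<in> integer_partitions CARD('n). size \<mu> = l}" and ?T = "{\<mu> \<in> integer_partitions CARD('n). Suc l \<le> size \<mu>}"
  have "{\<mu> \<in> integer_partitions CARD('n). l \<le> size \<mu>} = ?S \<union> ?T" by auto
  moreover have "(\<Oplus>\<mu>\<in>?S \<union> ?T. idem \<mu>) = (\<Oplus>\<mu>\<in>?S. idem \<mu>) \<oplus> (\<Oplus>\<mu>\<in>?T. idem \<mu>)"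
    by (rule finsum_Un_disjoint) auto
  moreover have "(\<Oplus>\<mu>\<in>?S. idem \<mu>) = len_elem l \<otimes> tail_elem (Suc l)"
  proof -
    have "(\<Oplus>\<mu>\<in>?S. idem \<mu>) = (\<Oplus>\<mu>\<in>?S. type_elem \<mu> \<otimes> tail_elem (Suc l))"
      by (rule finsum_cong') (auto simp: idem_def)
    also have "\<dots> = (\<Oplus>\<mu>\<in>?S. type_elem \<mu>) \<otimes> tail_elem (Suc l)"
      by (rule finsum_ldistr[symmetric]) auto
    finally show ?thesis using step.hyps sum_type_elem[of l] by simp
  qed
  ultimately have "(\<Oplus>\<mu>\<in>{\<mu> \<in> integer_partitions CARD('n). l \<le> size \<mu>}. idem \<mu>) = len_elem l \<otimes> tail_elem (Suc l) \<oplus> (\<one> \<ominus> tail_elem (Suc l))"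
    using step.IH by simp
  then show ?case using step.hyps by (simp add: tail_elem_step' a_minus_def minus_add a_ac)
qed

lemma sum_idem: "(\<Oplus>\<mu>\<in>(integer_partitions CARD('n)). idem \<mu>) = \<one>"
proof -
  have "{\<mu> \<in> integer_partitions CARD('n). 1 \<le> size \<mu>} = integer_partitions CARD('n)" using size_parts by fastforce
  then show ?thesis using sum_idem_tail[of 1] tail_elem_one by (simp add: a_minus_def)
qed

section \<open>Duality of characters and idempotents\<close>

definition type_char :: "nat multiset \<Rightarrow> ('n region \<Rightarrow> 'k) \<Rightarrow> 'k" where
  "type_char \<mu> = psi (type_rep \<mu>)"

lemma psi_tail:
  assumes z: "z \<in> faces" "nblocks z < m" "m \<le> Suc CARD('n)"
  shows "psi z (tail_elem m) = \<one>\<^bsub>k\<^esub>"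
proof -
  have "psi z (tail_elem m \<ominus> \<one>) = \<zero>\<^bsub>k\<^esub>" by (rule psi_filt[OF tail_elem_minus_one[OF z(3)] z(1,2)])
  moreover have "tail_elem m = (tail_elem m \<ominus> \<one>) \<oplus> \<one>" by (simp add: a_minus_def a_assoc l_neg)
  ultimately show ?thesis using psi_add[of "tail_elem m \<ominus> \<one>" \<one> z] psi_one[of z] by simp
qed

text \<open>Off the diagonal the value follows from orthogonality: multiplied by the value one on
  \<open>idem \<mu>\<close>, it gives the character of zero.\<close>

lemma type_char_idem:
  assumes mu: "\<mu> \<in> integer_partitions CARD('n)" and nu: "\<nu> \<in> integer_partitions CARD('n)"
  shows "type_char \<mu> (idem \<nu>) = (if \<mu> = \<nu> then \<one>\<^bsub>k\<^esub> else \<zero>\<^bsub>k\<^esub>)"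
proof -
  have self: "type_char \<mu> (idem \<mu>) = \<one>\<^bsub>k\<^esub>"
    unfolding type_char_def idem_def
    using type_rep[OF mu] psi_type_elem[of "type_rep \<mu>" \<mu>] psi_tail[of "type_rep \<mu>" "Suc (size \<mu>)"] size_parts[OF mu]
    by (simp add: psi_mult)
  show ?thesis
  proof (cases "\<mu> = \<nu>")
    case False
    have "type_char \<mu> (idem \<nu> \<otimes> idem \<mu>) = type_char \<mu> (idem \<nu>) \<otimes>\<^bsub>k\<^esub> type_char \<mu> (idem \<mu>)"
      unfolding type_char_def by (rule psi_mult) (simp_all add: type_rep[OF mu])
    then have "type_char \<mu> (idem \<nu>) = type_char \<mu> \<zero>"
      using idem_mult[OF nu mu] False self by (simp add: type_char_def)
    also have "\<dots> = \<zero>\<^bsub>k\<^esub>"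
      unfolding type_char_def psi_def by (rule k.add.finprod_one_eqI) simp
    finally show ?thesis using False by simp
  qed (use self in simp)
qed

end

section \<open>Exchanging the first two blocks, and uniqueness of the merged pair\<close>

lemma starts_iff: "starts a b bs \<longleftrightarrow> take 2 (map card bs) = [a, b]"
proof (cases bs)
  case (Cons B rest)
  then show ?thesis by (cases rest) (auto simp: starts_def)
qed (simp add: starts_def)

lemma card_starts_swap:
  "card {bs \<in> permutations_of_set S. starts a b bs} = card {bs \<in> permutations_of_set S. starts b a bs}"
proof -
  define sw where "sw bs = (case bs of B # C # rest \<Rightarrow> C # B # rest | _ \<Rightarrow> bs)" for bs :: "'a set list"
  have sw: "sw bs \<in> {bs \<in> permutations_of_set S. starts b a bs}"
    if mem: "bs \<in> {bs \<in> permutations_of_set S. starts a b bs}" for a b bs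
  proof -
    obtain B C rest where bs: "bs = B # C # rest" "card B = a" "card C = b"
      using mem by (auto simp: starts_def)
    have "distinct bs" "set bs = S" using mem by (auto simp: permutations_of_set_def)
    then show ?thesis using bs by (auto simp: starts_def permutations_of_set_def sw_def)
  qed
  have swsw: "sw (sw bs) = bs" for bs by (simp add: sw_def split: list.split)
  have "bij_betw sw {bs \<in> permutations_of_set S. starts a b bs} {bs \<in> permutations_of_set S. starts b a bs}"
    by (rule bij_betw_byWitness[of _ sw]; intro ballI image_subsetI swsw sw)
  then show ?thesis by (rule bij_betw_same_card)
qed

lemma replicate_block_inj:
  assumes "x @ replicate i (a + b) @ [a, b] @ u = x @ replicate i' (a + b) @ [a, b] @ u'" "0 < a" "0 < (b :: nat)"
  shows "i = i'"
proof -
  have False if lt: "i < i'" and eq: "replicate i (a + b) @ [a, b] @ u = replicate i' (a + b) @ [a, b] @ u'" for i i' u u'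
  proof -
    have "(replicate i (a + b) @ [a, b] @ u) ! i = a" by (simp add: nth_append)
    moreover have "(replicate i' (a + b) @ [a, b] @ u') ! i = a + b" using lt by (simp add: nth_append)
    ultimately have "a = a + b" by (simp only: eq)
    then show False using assms(2,3) by simp
  qed
  moreover have "replicate i (a + b) @ [a, b] @ u = replicate i' (a + b) @ [a, b] @ u'" using assms(1) by simp
  ultimately show ?thesis by (metis linorder_neqE_nat)
qed

text \<open>Comparing the multisets, \<open>s\<close> and \<open>s'\<close> cancel. As
  \<open>a + b\<close> exceeds both \<open>a\<close> and \<open>b\<close>, it must be
  \<open>a' + b'\<close>, and then the pairs agree as multisets. So an arrow is determined by its
  ends up to the order of the pair.\<close>

lemma adds_two_distinct_unique:
  assumes "add_mset a (add_mset b s) = add_mset a' (add_mset b' s')" "add_mset (a + b) s = add_mset (a' + b') s'"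
    and "0 < a" "0 < (b :: nat)"
  shows "a' = a \<and> b' = b \<or> a' = b \<and> b' = a"
proof -
  have "{#a + b, a', b'#} + s' + s = {#a' + b', a, b#} + s' + s"
  proof -
    have "{#a + b, a', b'#} + s' + s = add_mset (a + b) s + add_mset a' (add_mset b' s')" by simp
    also have "\<dots> = add_mset (a' + b') s' + add_mset a (add_mset b s)" by (simp only: assms(1,2))
    also have "\<dots> = {#a' + b', a, b#} + s' + s" by simp
    finally show ?thesis .
  qed
  then have eq: "{#a + b, a', b'#} = {#a' + b', a, b#}" by simp
  have "a + b \<in># {#a + b, a', b'#}" by simp
  then have "a + b \<in># {#a' + b', a, b#}" unfolding eq .
  then have sum: "a + b = a' + b'" using assms(3,4) by auto
  then have eq2: "{#a', b'#} = {#a, b#}" using eq by simp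
  have "a' \<in># {#a', b'#}" by simp
  then have "a' = a \<or> a' = b" unfolding eq2 by simp
  then show ?thesis using sum by auto
qed

context invariant_faces begin

lemma scalar_nat_add: "scalar_nat (i + j) = scalar_nat i \<oplus>\<^bsub>k\<^esub> scalar_nat j"
  by (simp add: scalar_nat_def k.add.nat_pow_mult)

lemma scalar_nat_mult: "scalar_nat (i * j) = scalar_nat i \<otimes>\<^bsub>k\<^esub> scalar_nat j"
  by (simp add: scalar_nat_def k.add_pow_ldistr k.add.nat_pow_pow mult.commute)

lemma scalar_nat_0_1 [simp]: "scalar_nat 0 = \<zero>\<^bsub>k\<^esub>" "scalar_nat (Suc 0) = \<one>\<^bsub>k\<^esub>"
  by (simp_all add: scalar_nat_def)

text \<open>Converts the subtraction-free count of \<open>codim_one_count\<close> into a difference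
  of scalars.\<close>

lemma k_minus_eqI:
  assumes "p \<oplus>\<^bsub>k\<^esub> x = q \<oplus>\<^bsub>k\<^esub> y" "p \<in> carrier k" "q \<in> carrier k" "x \<in> carrier k" "y \<in> carrier k"
  shows "p \<ominus>\<^bsub>k\<^esub> q = y \<ominus>\<^bsub>k\<^esub> x"
proof -
  have "p \<ominus>\<^bsub>k\<^esub> q = ((p \<oplus>\<^bsub>k\<^esub> x) \<oplus>\<^bsub>k\<^esub> \<ominus>\<^bsub>k\<^esub> x) \<oplus>\<^bsub>k\<^esub> \<ominus>\<^bsub>k\<^esub> q"
    using assms(2-5) by (simp add: k.minus_eq k.a_assoc k.r_neg)
  also have "\<dots> = \<ominus>\<^bsub>k\<^esub> q \<oplus>\<^bsub>k\<^esub> (q \<oplus>\<^bsub>k\<^esub> (y \<oplus>\<^bsub>k\<^esub> \<ominus>\<^bsub>k\<^esub> x))"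
    unfolding assms(1) using assms(2-5) by (simp only: k.a_assoc k.a_closed k.a_inv_closed k.a_comm[of _ "\<ominus>\<^bsub>k\<^esub> q"])
  also have "\<dots> = y \<ominus>\<^bsub>k\<^esub> x"
    using assms(2-5) by (simp only: k.r_neg1 k.minus_eq k.a_closed k.a_inv_closed)
  finally show ?thesis .
qed

section \<open>Arrows between the idempotents\<close>

definition word_elem :: "nat list \<Rightarrow> 'n region \<Rightarrow> 'k" where
  "word_elem d = orbit_sum (\<lambda>c. if c = d then \<one>\<^bsub>k\<^esub> else \<zero>\<^bsub>k\<^esub>)"

definition swap_elem :: "nat multiset \<Rightarrow> nat \<Rightarrow> nat \<Rightarrow> 'n region \<Rightarrow> 'k" where
  "swap_elem \<mu> a b = orbit_sum (\<lambda>c. if mset c = \<mu> \<and> take 2 c = [a, b] then \<one>\<^bsub>k\<^esub>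
    else if mset c = \<mu> \<and> take 2 c = [b, a] then \<ominus>\<^bsub>k\<^esub> \<one>\<^bsub>k\<^esub> else \<zero>\<^bsub>k\<^esub>)"

lemma word_elem_closed [simp]: "word_elem d \<in> carrier A"
  unfolding word_elem_def by (rule orbit_sum_closed) simp

lemma swap_elem_closed [simp]: "swap_elem \<mu> a b \<in> carrier A"
  unfolding swap_elem_def by (rule orbit_sum_closed) simp

lemma word_elem_coeff: "z \<in> faces \<Longrightarrow> word_elem d z = (if composition z = d then \<one>\<^bsub>k\<^esub> else \<zero>\<^bsub>k\<^esub>)"
  by (simp add: word_elem_def)

lemma swap_elem_coeff: "z \<in> faces \<Longrightarrow> swap_elem \<mu> a b z = (if face_type z = \<mu> \<and> starts a b (blocks z) then \<one>\<^bsub>k\<^esub>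
    else if face_type z = \<mu> \<and> starts b a (blocks z) then \<ominus>\<^bsub>k\<^esub> \<one>\<^bsub>k\<^esub> else \<zero>\<^bsub>k\<^esub>)"
  by (simp add: swap_elem_def face_type_def starts_iff composition_def)

lemma word_elem_filt: "word_elem d \<in> filt (length d)"
  by (rule filtI) (auto simp: word_elem_coeff)

lemma swap_elem_filt: "swap_elem \<mu> a b \<in> filt (size \<mu>)"
  by (rule filtI) (auto simp: swap_elem_coeff)

lemma swap_elem_commute:
  assumes "a \<noteq> b"
  shows "swap_elem \<mu> b a = \<ominus> swap_elem \<mu> a b"
proof (rule coeff_eqI)
  fix z :: "'n region" assume z: "z \<in> faces"
  have "\<not> (starts a b (blocks z) \<and> starts b a (blocks z))" using assms by (auto simp: starts_iff)
  moreover have "\<ominus>\<^bsub>k\<^esub> \<zero>\<^bsub>k\<^esub> = \<zero>\<^bsub>k\<^esub>" by (rule k.minus_zero)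
  ultimately show "swap_elem \<mu> b a z = (\<ominus> swap_elem \<mu> a b) z"
    using z by (auto simp: swap_elem_coeff)
qed simp_all

lemma starts_not_both: "a \<noteq> b \<Longrightarrow> starts a b bs \<Longrightarrow> \<not> starts b a bs"
  by (auto simp: starts_iff)

text \<open>The reorderings of \<open>z\<close> that start with sizes \<open>a\<close>,
  \<open>b\<close> are as many as those that start with \<open>b\<close>, \<open>a\<close>, so the
  signs cancel.\<close>

lemma psi_swap_elem:
  assumes ab: "a \<noteq> b" and z: "z \<in> faces" "nblocks z = size \<mu>"
  shows "psi z (swap_elem \<mu> a b) = \<zero>\<^bsub>k\<^esub>"
proof -
  let ?S = "{y \<in> faces. set (blocks y) = set (blocks z)}"
  have "psi z (swap_elem \<mu> a b) = (\<Oplus>\<^bsub>k\<^esub>y\<in>?S. swap_elem \<mu> a b y)"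
  proof -
    have "psi z (swap_elem \<mu> a b) = (\<Oplus>\<^bsub>k\<^esub>y\<in>?S. (\<lambda>c. if mset c = \<mu> \<and> take 2 c = [a, b] then \<one>\<^bsub>k\<^esub>
      else if mset c = \<mu> \<and> take 2 c = [b, a] then \<ominus>\<^bsub>k\<^esub> \<one>\<^bsub>k\<^esub> else \<zero>\<^bsub>k\<^esub>) (composition y))"
      unfolding swap_elem_def by (rule psi_orbit_sum) (use z in auto)
    also have "\<dots> = (\<Oplus>\<^bsub>k\<^esub>y\<in>?S. swap_elem \<mu> a b y)"
      by (rule k.finsum_cong') (auto simp: swap_elem_def)
    finally show ?thesis .
  qed
  also have "\<dots> = \<zero>\<^bsub>k\<^esub>"
  proof (cases "face_type z = \<mu>")
    case True
    have t: "face_type y = \<mu>" if "y \<in> ?S" for y using face_type_same_blocks[of y z] that z True by simp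
    have card: "card {y \<in> ?S. starts a b (blocks y)} = card {bs \<in> permutations_of_set (set (blocks z)). starts a b bs}" for a b
    proof -
      note bij = bij_betw_blocks[OF z(1)]
      have "blocks ` {y \<in> ?S. starts a b (blocks y)} = {bs \<in> permutations_of_set (set (blocks z)). starts a b bs}"
        unfolding bij_betw_imp_surj_on[OF bij, symmetric] by auto
      moreover have "card (blocks ` {y \<in> ?S. starts a b (blocks y)}) = card {y \<in> ?S. starts a b (blocks y)}"
        by (rule card_image, rule inj_on_subset[OF bij_betw_imp_inj_on[OF bij]]) blast
      ultimately show ?thesis by (simp only:)
    qed
    have "(\<Oplus>\<^bsub>k\<^esub>y\<in>?S. swap_elem \<mu> a b y)
      = add_pow k (card {y \<in> ?S. starts a b (blocks y)}) \<one>\<^bsub>k\<^esub> \<ominus>\<^bsub>k\<^esub> add_pow k (card {y \<in> ?S. starts b a (blocks y)}) \<one>\<^bsub>k\<^esub>"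
    proof (rule k.finsum_signs)
      show "{y \<in> ?S. starts a b (blocks y)} \<inter> {y \<in> ?S. starts b a (blocks y)} = {}"
        using starts_not_both[OF ab] by blast
      fix y
      show "y \<in> {y \<in> ?S. starts a b (blocks y)} \<Longrightarrow> swap_elem \<mu> a b y = \<one>\<^bsub>k\<^esub>"
        using t[of y] by (simp add: swap_elem_coeff)
      show "y \<in> {y \<in> ?S. starts b a (blocks y)} \<Longrightarrow> swap_elem \<mu> a b y = \<ominus>\<^bsub>k\<^esub> \<one>\<^bsub>k\<^esub>"
        using t[of y] starts_not_both[OF ab, of "blocks y"] by (auto simp: swap_elem_coeff)
      show "y \<in> ?S \<Longrightarrow> y \<notin> {y \<in> ?S. starts a b (blocks y)} \<Longrightarrow> y \<notin> {y \<in> ?S. starts b a (blocks y)}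
          \<Longrightarrow> swap_elem \<mu> a b y = \<zero>\<^bsub>k\<^esub>"
        by (simp add: swap_elem_coeff)
    qed auto
    also have "\<dots> = \<zero>\<^bsub>k\<^esub>"
      unfolding card card_starts_swap[of _ a b] k.minus_eq by (rule k.r_neg) simp
    finally show ?thesis .
  next
    case False
    have "face_type y \<noteq> \<mu>" if "y \<in> ?S" for y using face_type_same_blocks[of y z] that z False by simp
    then show ?thesis by (intro k.add.finprod_one_eqI) (simp add: swap_elem_coeff)
  qed
  finally show ?thesis .
qed

text \<open>A right factor of type \<mu> has at least as many blocks as the product allows, so it
  shares its blocks, and hence its type, with the product.\<close>

lemma mult_other_type:
  assumes a: "a \<in> carrier A" and u: "u \<in> carrier A" "\<And>y. y \<in> faces \<Longrightarrow> face_type y \<noteq> \<mu> \<Longrightarrow> u y = \<zero>\<^bsub>k\<^esub>"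
    and z: "z \<in> faces" "nblocks z \<le> size \<mu>" "face_type z \<noteq> \<mu>"
  shows "(a \<otimes> u) z = \<zero>\<^bsub>k\<^esub>"
  unfolding coeff_mult[OF z(1)]
proof (rule k.add.finprod_one_eqI)
  fix p assume p: "p \<in> face_pairs z"
  note p' = face_pairsD[OF p]
  have "face_type (snd p) \<noteq> \<mu>"
  proof
    assume t: "face_type (snd p) = \<mu>"
    then have "nblocks (snd p) = size \<mu>" using size_face_type[of "snd p"] by simp
    then have "nblocks (snd p) = nblocks (face_mult (fst p) (snd p))"
      using mult_nblocks(2)[OF p'(1,2)] z(2) p'(3) by simp
    from mult_same_blocks[OF p'(1,2) this] have "face_type (snd p) = face_type z"
      using face_type_same_blocks[of "snd p" z] p' z(1) by simp
    then show False using t z(3) by simp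
  qed
  then show "a (fst p) \<otimes>\<^bsub>k\<^esub> u (snd p) = \<zero>\<^bsub>k\<^esub>"
    using u(2)[OF p'(2)] coeff_closed[OF a p'(1)] by simp
qed

text \<open>The coefficient is a signed count of factorisations of \<open>z\<close>, evaluated by
  \<open>codim_one_count\<close>.\<close>

lemma word_swap_coeff:
  fixes z :: "'n region"
  assumes ab: "a \<noteq> b" and z: "z \<in> faces" "face_type z = \<mu>" and d: "Suc (length d) = size \<mu>"
  defines "T \<equiv> \<lambda>a b. card {j. Suc j < length (composition z) \<and> merge_adjacent (composition z) j = d \<and>
      composition z ! j = a \<and> composition z ! Suc j = b}"
  shows "(word_elem d \<otimes> swap_elem \<mu> a b) z
    = scalar_nat (fact (size \<mu> - 2)) \<otimes>\<^bsub>k\<^esub> (scalar_nat (T a b) \<ominus>\<^bsub>k\<^esub> scalar_nat (T b a))"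
proof -
  define M where "M a b = {(x, y). x \<in> faces \<and> y \<in> faces \<and> face_mult x y = z \<and> composition x = d \<and>
      nblocks y = nblocks z \<and> starts a b (blocks y)}" for a b
  have nz: "nblocks z = size \<mu>" using z(2) size_face_type[of z] by simp
  have mem: "p \<in> M a b \<longleftrightarrow> p \<in> face_pairs z \<and> composition (fst p) = d \<and> nblocks (snd p) = nblocks z \<and> starts a b (blocks (snd p))" for p a b
    by (auto simp: M_def face_pairs_def)
  have type: "face_type (snd p) = \<mu>" if "p \<in> face_pairs z" "nblocks (snd p) = nblocks z" for p
    using face_pairsD[OF that(1)] mult_same_blocks[of "fst p" "snd p"] that(2) face_type_same_blocks[of "snd p" z] z by simp
  have "(word_elem d \<otimes> swap_elem \<mu> a b) z = (\<Oplus>\<^bsub>k\<^esub>p\<in>face_pairs z. word_elem d (fst p) \<otimes>\<^bsub>k\<^esub> swap_elem \<mu> a b (snd p))"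
    by (rule coeff_mult[OF z(1)])
  also have "\<dots> = add_pow k (card (M a b)) \<one>\<^bsub>k\<^esub> \<ominus>\<^bsub>k\<^esub> add_pow k (card (M b a)) \<one>\<^bsub>k\<^esub>"
  proof (rule k.finsum_signs)
    show "M a b \<subseteq> face_pairs z" "M b a \<subseteq> face_pairs z" using mem by blast+
    show "M a b \<inter> M b a = {}" using mem starts_not_both[OF ab] by blast
    fix p
    show "word_elem d (fst p) \<otimes>\<^bsub>k\<^esub> swap_elem \<mu> a b (snd p) = \<one>\<^bsub>k\<^esub>" if "p \<in> M a b"
      using that[unfolded mem] type[of p] face_pairsD[of p z] by (simp add: word_elem_coeff swap_elem_coeff)
    show "word_elem d (fst p) \<otimes>\<^bsub>k\<^esub> swap_elem \<mu> a b (snd p) = \<ominus>\<^bsub>k\<^esub> \<one>\<^bsub>k\<^esub>" if "p \<in> M b a"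
      using that[unfolded mem] type[of p] face_pairsD[of p z] starts_not_both[OF ab, of "blocks (snd p)"]
      by (auto simp: word_elem_coeff swap_elem_coeff)
    show "word_elem d (fst p) \<otimes>\<^bsub>k\<^esub> swap_elem \<mu> a b (snd p) = \<zero>\<^bsub>k\<^esub>"
      if p: "p \<in> face_pairs z" "p \<notin> M a b" "p \<notin> M b a"
    proof (cases "composition (fst p) = d \<and> face_type (snd p) = \<mu>")
      case True
      then have "nblocks (snd p) = nblocks z" using nz size_face_type[of "snd p"] by simp
      then have "\<not> starts a b (blocks (snd p))" "\<not> starts b a (blocks (snd p))" using p True mem by blast+
      then show ?thesis using face_pairsD[OF p(1)] by (simp add: word_elem_coeff swap_elem_coeff)
    next
      case False
      then show ?thesis using face_pairsD[OF p(1)] by (auto simp: word_elem_coeff swap_elem_coeff)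
    qed
  qed simp_all
  also have "\<dots> = scalar_nat (card (M a b)) \<ominus>\<^bsub>k\<^esub> scalar_nat (card (M b a))" by (simp add: scalar_nat_def)
  also have "\<dots> = scalar_nat (fact (size \<mu> - 2) * T a b) \<ominus>\<^bsub>k\<^esub> scalar_nat (fact (size \<mu> - 2) * T b a)"
  proof (rule k_minus_eqI)
    have "Suc (length d) = nblocks z" using d nz by simp
    from codim_one_count[OF z(1) this ab]
    have "card (M a b) + fact (size \<mu> - 2) * T b a = card (M b a) + fact (size \<mu> - 2) * T a b"
      unfolding M_def T_def nz length_composition .
    then show "scalar_nat (card (M a b)) \<oplus>\<^bsub>k\<^esub> scalar_nat (fact (size \<mu> - 2) * T b a)
      = scalar_nat (card (M b a)) \<oplus>\<^bsub>k\<^esub> scalar_nat (fact (size \<mu> - 2) * T a b)"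
      unfolding scalar_nat_add[symmetric] by (rule arg_cong)
  qed simp_all
  also have "\<dots> = scalar_nat (fact (size \<mu> - 2)) \<otimes>\<^bsub>k\<^esub> (scalar_nat (T a b) \<ominus>\<^bsub>k\<^esub> scalar_nat (T b a))"
    by (simp add: scalar_nat_mult k.minus_eq k.r_distr k.r_minus)
  finally show ?thesis .
qed

section \<open>Splitting one letter of a run\<close>

definition block_word :: "nat list \<Rightarrow> nat list \<Rightarrow> nat \<Rightarrow> nat \<Rightarrow> nat \<Rightarrow> nat \<Rightarrow> nat list" where
  "block_word x y n a b i = x @ replicate i (a + b) @ [a, b] @ replicate (n - i) (a + b) @ y"

lemma mset_block_word: "i \<le> n \<Longrightarrow> mset (block_word x y n a b i) = mset (x @ [a, b] @ replicate n (a + b) @ y)"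
  unfolding block_word_def by (rule multiset_eqI) auto

lemma mset_block_word_swap: "i \<le> n \<Longrightarrow> mset (block_word x y n b a i) = mset (x @ [a, b] @ replicate n (a + b) @ y)"
  unfolding block_word_def by (rule multiset_eqI) auto

text \<open>All words obtained from \<open>x @ replicate (Suc n) (a + b) @ y\<close> by splitting
  one letter of the run; \<open>i\<close> counts the copies left in front of the split one.\<close>

definition block_sum :: "nat list \<Rightarrow> nat list \<Rightarrow> nat \<Rightarrow> nat \<Rightarrow> nat \<Rightarrow> 'n region \<Rightarrow> 'k" where
  "block_sum x y n a b = (\<Oplus>i\<in>{..n}. word_elem (block_word x y n a b i))"

lemma block_sum_closed [simp]: "block_sum x y n a b \<in> carrier A"
  unfolding block_sum_def by (rule finsum_closed) simp

lemma block_sum_coeff: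
  assumes z: "z \<in> faces" and ab: "0 < a" "0 < b"
  shows "block_sum x y n a b z = (if \<exists>i \<le> n. composition z = block_word x y n a b i then \<one>\<^bsub>k\<^esub> else \<zero>\<^bsub>k\<^esub>)"
proof -
  have "block_sum x y n a b z = (\<Oplus>\<^bsub>k\<^esub>i\<in>{..n}. word_elem (block_word x y n a b i) z)"
    unfolding block_sum_def by (rule coeff_finsum) (use z in simp_all)
  also have "\<dots> = (if \<exists>i \<le> n. composition z = block_word x y n a b i then \<one>\<^bsub>k\<^esub> else \<zero>\<^bsub>k\<^esub>)"
  proof (cases "\<exists>i \<le> n. composition z = block_word x y n a b i")
    case True
    then obtain i where i: "i \<le> n" "composition z = block_word x y n a b i" by blast
    have uniq: "i' = i" if "composition z = block_word x y n a b i'" for i'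
    proof -
      have "block_word x y n a b i' = block_word x y n a b i" using that i(2) by (rule subst)
      then show ?thesis unfolding block_word_def by (rule replicate_block_inj[OF _ ab])
    qed
    have "(\<Oplus>\<^bsub>k\<^esub>i\<in>{..n}. word_elem (block_word x y n a b i) z) = word_elem (block_word x y n a b i) z"
    proof (rule k.finsum_single)
      fix i' assume "i' \<in> {..n}" "i' \<noteq> i"
      then have "composition z \<noteq> block_word x y n a b i'" using uniq by blast
      then show "word_elem (block_word x y n a b i') z = \<zero>\<^bsub>k\<^esub>" unfolding word_elem_coeff[OF z] by (rule if_not_P)
    qed (use i(1) coeff_closed[OF word_elem_closed z] in simp_all)
    also have "\<dots> = \<one>\<^bsub>k\<^esub>" unfolding word_elem_coeff[OF z] by (rule if_P[OF i(2)])
    finally show ?thesis unfolding if_P[OF True] .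
  next
    case False
    have "(\<Oplus>\<^bsub>k\<^esub>i\<in>{..n}. word_elem (block_word x y n a b i) z) = \<zero>\<^bsub>k\<^esub>"
    proof (rule k.add.finprod_one_eqI)
      fix i assume "i \<in> {..n}"
      then have "composition z \<noteq> block_word x y n a b i" using False by blast
      then show "word_elem (block_word x y n a b i) z = \<zero>\<^bsub>k\<^esub>" unfolding word_elem_coeff[OF z] by (rule if_not_P)
    qed
    then show ?thesis unfolding if_not_P[OF False] .
  qed
  finally show ?thesis .
qed

lemma block_sum_filt:
  assumes "0 < a" "0 < b" "\<And>i. i \<le> n \<Longrightarrow> length (block_word x y n a b i) = l"
  shows "block_sum x y n a b \<in> filt l"
proof (rule filtI)
  fix z :: "'n region" assume z: "z \<in> faces" "nblocks z < l"
  have "\<not> (\<exists>i \<le> n. composition z = block_word x y n a b i)"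
  proof
    assume "\<exists>i \<le> n. composition z = block_word x y n a b i"
    then obtain i where "i \<le> n" "composition z = block_word x y n a b i" by blast
    then have "nblocks z = l" using assms(3) length_composition[of z] by metis
    then show False using z(2) by simp
  qed
  then show "block_sum x y n a b z = \<zero>\<^bsub>k\<^esub>" unfolding block_sum_coeff[OF z(1) assms(1,2)] by (rule if_not_P)
qed simp

text \<open>Only faces with \<open>size \<mu>\<close> blocks have to be compared. On those of type
  \<mu> the counts of \<open>word_swap_coeff\<close> are zero or one by
  \<open>merge_adjacent_block_card\<close>; on all others both sides vanish.\<close>

lemma word_swap_tail:
  assumes ab: "a \<noteq> b" "0 < a" "0 < b" and m: "a + b \<notin> set x" "a + b \<notin> set y"
    and mu: "mset (x @ [a, b] @ replicate n (a + b) @ y) = \<mu>" "\<mu> \<in> integer_partitions CARD('n)"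
  shows "word_elem (x @ replicate (Suc n) (a + b) @ y) \<otimes> (swap_elem \<mu> a b \<otimes> tail_elem (Suc (size \<mu>)))
    = scalar_nat (fact (size \<mu> - 2)) \<odot> ((block_sum x y n a b \<ominus> block_sum x y n b a) \<otimes> tail_elem (Suc (size \<mu>)))"
proof -
  let ?d = "x @ replicate (Suc n) (a + b) @ y" and ?F = "scalar_nat (fact (size \<mu> - 2))"
  let ?D = "block_sum x y n a b \<ominus> block_sum x y n b a"
  have l: "Suc (length ?d) = size \<mu>" unfolding mu(1)[symmetric] by simp
  have len: "length (block_word x y n a b i) = size \<mu>" "length (block_word x y n b a i) = size \<mu>" if "i \<le> n" for i
    using arg_cong[OF mset_block_word[OF that, of x y a b], of size] arg_cong[OF mset_block_word_swap[OF that, of x y b a], of size]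
    unfolding mu(1) size_mset .
  have D: "?D \<in> filt (size \<mu>)" using block_sum_filt ab(2,3) len by (intro filt_minus) simp_all
  have FD: "?F \<odot> ?D \<in> filt (size \<mu>)"
  proof -
    have "?F \<odot> ?D = (?F \<odot> \<one>) \<otimes> ?D" by (simp add: scalar_mult)
    then show ?thesis using filt_mult(2)[OF D, of "?F \<odot> \<one>"] by simp
  qed
  have "(word_elem ?d \<otimes> swap_elem \<mu> a b) \<otimes> tail_elem (Suc (size \<mu>)) = (?F \<odot> ?D) \<otimes> tail_elem (Suc (size \<mu>))"
  proof (rule mult_tail_cong)
    show "size \<mu> \<le> CARD('n)" using size_parts[OF mu(2)] by simp
    show "word_elem ?d \<otimes> swap_elem \<mu> a b \<in> filt (size \<mu>)" by (rule filt_mult(2)[OF swap_elem_filt word_elem_closed])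
    show "?F \<odot> ?D \<in> filt (size \<mu>)" by (rule FD)
    fix z :: "'n region" assume z: "z \<in> faces" "nblocks z = size \<mu>"
    let ?c = "composition z"
    have Dz: "(?F \<odot> ?D) z = ?F \<otimes>\<^bsub>k\<^esub> ((if \<exists>i \<le> n. ?c = block_word x y n a b i then \<one>\<^bsub>k\<^esub> else \<zero>\<^bsub>k\<^esub>)
        \<ominus>\<^bsub>k\<^esub> (if \<exists>i \<le> n. ?c = block_word x y n b a i then \<one>\<^bsub>k\<^esub> else \<zero>\<^bsub>k\<^esub>))"
      using z(1) ab(2,3) by (simp add: block_sum_coeff)
    show "(word_elem ?d \<otimes> swap_elem \<mu> a b) z = (?F \<odot> ?D) z"
    proof (cases "face_type z = \<mu>")
      case True
      have T: "card {j. Suc j < length ?c \<and> merge_adjacent ?c j = ?d \<and> ?c ! j = a \<and> ?c ! Suc j = b}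
        = (if \<exists>i \<le> n. ?c = block_word x y n a b i then 1 else 0)"
        unfolding block_word_def by (rule merge_adjacent_block_card[OF m ab(2,3)])
      have T': "card {j. Suc j < length ?c \<and> merge_adjacent ?c j = ?d \<and> ?c ! j = b \<and> ?c ! Suc j = a}
        = (if \<exists>i \<le> n. ?c = block_word x y n b a i then 1 else 0)"
        unfolding block_word_def add.commute[of a b]
        by (rule merge_adjacent_block_card) (use m ab(2,3) in \<open>simp_all only: add.commute[of b a] not_False_eq_True\<close>)
      show ?thesis
        unfolding Dz word_swap_coeff[OF ab(1) z(1) True l] T T' if_distrib[of scalar_nat] One_nat_def scalar_nat_0_1 by (rule refl)
    next
      case False
      have "(word_elem ?d \<otimes> swap_elem \<mu> a b) z = \<zero>\<^bsub>k\<^esub>"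
        by (rule mult_other_type[of _ _ \<mu>]) (use z False in \<open>auto simp: swap_elem_coeff\<close>)
      moreover have "\<not> (\<exists>i \<le> n. ?c = block_word x y n a b i)" "\<not> (\<exists>i \<le> n. ?c = block_word x y n b a i)"
      proof -
        have "mset ?c \<noteq> \<mu>" using False by (simp add: face_type_def)
        moreover have "mset (block_word x y n a b i) = \<mu>" "mset (block_word x y n b a i) = \<mu>" if "i \<le> n" for i
          using mset_block_word[OF that, of x y a b] mset_block_word_swap[OF that, of x y b a] unfolding mu(1) .
        ultimately show "\<not> (\<exists>i \<le> n. ?c = block_word x y n a b i)" "\<not> (\<exists>i \<le> n. ?c = block_word x y n b a i)"
          by (intro notI; elim exE conjE; simp only:; blast)+
      qed
      ultimately show ?thesis unfolding Dz by (simp only: if_False k.minus_eq k.minus_zero k.l_zero k.zero_closed k.r_null scalar_nat_closed)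
    qed
  qed
  then show ?thesis by (simp add: m_assoc smult_mult_left)
qed

end

section \<open>Congruences modulo left ideals\<close>

lemma (in abelian_group) minus_swap: "x \<in> carrier G \<Longrightarrow> y \<in> carrier G \<Longrightarrow> \<ominus> (x \<ominus> y) = y \<ominus> x"
  by (simp add: a_minus_def minus_add a_comm)

lemma (in abelian_group) minus_split:
  assumes "x \<in> carrier G" "y \<in> carrier G" "z \<in> carrier G"
  shows "(x \<ominus> y) \<oplus> (y \<ominus> z) = x \<ominus> z"
proof -
  have "(x \<ominus> y) \<oplus> (y \<ominus> z) = x \<oplus> (\<ominus> y \<oplus> (y \<oplus> \<ominus> z))" using assms by (simp add: a_minus_def a_assoc)
  also have "\<dots> = x \<ominus> z" using assms by (simp only: r_neg1 a_inv_closed a_minus_def)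
  finally show ?thesis .
qed

context assoc_alg begin

lemma left_idealD:
  assumes "left_ideal L A"
  shows "additive_subgroup L A" "a \<in> carrier A \<Longrightarrow> v \<in> L \<Longrightarrow> a \<otimes> v \<in> L" "v \<in> L \<Longrightarrow> v \<in> carrier A"
  using assms additive_subgroup.a_Hcarr[of L A v] by (auto simp: left_ideal_def)

lemma left_ideal_smult:
  assumes "left_ideal L A" "c \<in> carrier k" "v \<in> L"
  shows "c \<odot> v \<in> L"
  using left_idealD(2)[OF assms(1), of "c \<odot> \<one>" v] assms left_idealD(3)[OF assms(1,3)]
  by (simp add: scalar_mult)

lemma left_ideal_unit_smult:
  assumes "left_ideal L A" "c \<in> carrier k" "c \<noteq> \<zero>\<^bsub>k\<^esub>" "v \<in> carrier A" "c \<odot> v \<in> L"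
  shows "v \<in> L"
proof -
  have u: "c \<in> Units k" using assms(2,3) by (simp add: k.field_Units)
  then have "inv\<^bsub>k\<^esub> c \<odot> (c \<odot> v) = (inv\<^bsub>k\<^esub> c \<otimes>\<^bsub>k\<^esub> c) \<odot> v"
    using assms(2,4) by (simp only: smult_assoc1 k.Units_inv_closed)
  then have "inv\<^bsub>k\<^esub> c \<odot> (c \<odot> v) = v" using u assms(4) by simp
  moreover have "inv\<^bsub>k\<^esub> c \<odot> (c \<odot> v) \<in> L" using u by (intro left_ideal_smult assms(1,5)) simp
  ultimately show ?thesis by simp
qed

text \<open>Left ideals absorb scalars, so congruences pass to linear combinations. Applied to runs
  with all weights one, and to expansions in words.\<close>

lemma weighted_sum_mod:
  assumes L: "left_ideal L A" and "finite S" and u: "u \<in> carrier A"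
    and c: "\<And>i. i \<in> S \<Longrightarrow> c i \<in> carrier k" and f: "\<And>i. i \<in> S \<Longrightarrow> f i \<in> carrier A" and "\<And>i. i \<in> S \<Longrightarrow> f i \<ominus> u \<in> L"
  shows "(\<Oplus>i\<in>S. c i \<odot> f i) \<ominus> (\<Oplus>\<^bsub>k\<^esub>i\<in>S. c i) \<odot> u \<in> L"
  using assms(2,4-6)
proof (induction S rule: finite_induct)
  case empty
  have "\<zero> \<in> L" by (rule additive_subgroup.zero_closed[OF left_idealD(1)[OF L]])
  then show ?case using u by (simp add: a_minus_def)
next
  case (insert s S)
  let ?F = "\<Oplus>i\<in>S. c i \<odot> f i" and ?C = "\<Oplus>\<^bsub>k\<^esub>i\<in>S. c i"
  have cl: "c s \<in> carrier k" "f s \<in> carrier A" "f s \<ominus> u \<in> L" using insert.prems by blast+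
  have Fc: "?F \<in> carrier A" "?C \<in> carrier k"
    using insert.prems by (auto intro!: finsum_closed k.finsum_closed)
  have s1: "(\<Oplus>i\<in>insert s S. c i \<odot> f i) = c s \<odot> f s \<oplus> ?F"
    by (rule finsum_insert) (use insert in auto)
  have s2: "(\<Oplus>\<^bsub>k\<^esub>i\<in>insert s S. c i) = c s \<oplus>\<^bsub>k\<^esub> ?C"
    by (rule k.finsum_insert) (use insert in auto)
  have "(\<Oplus>i\<in>insert s S. c i \<odot> f i) \<ominus> (\<Oplus>\<^bsub>k\<^esub>i\<in>insert s S. c i) \<odot> u
    = c s \<odot> (f s \<ominus> u) \<oplus> (?F \<ominus> ?C \<odot> u)"
    unfolding s1 s2 using cl Fc u
    by (simp add: a_minus_def smult_l_distr smult_r_distr module.smult_r_minus[OF smult_module] minus_add a_ac)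
  moreover have "c s \<odot> (f s \<ominus> u) \<in> L" by (rule left_ideal_smult[OF L cl(1,3)])
  moreover have "?F \<ominus> ?C \<odot> u \<in> L" using insert.prems by (intro insert.IH) auto
  ultimately show ?case using additive_subgroup.a_closed[OF left_idealD(1)[OF L]] by simp
qed

text \<open>The generated left ideal in the normal form with one coefficient for each generator, as
  required by \<open>J_generated\<close>.\<close>

definition left_span :: "'q set \<Rightarrow> ('q \<Rightarrow> 'a) \<Rightarrow> 'a set" where
  "left_span Q g = {\<Oplus>q\<in>Q. b q \<otimes> g q | b. \<forall>q. b q \<in> carrier A}"

lemma left_span_left_ideal:
  assumes "finite Q" "\<And>q. q \<in> Q \<Longrightarrow> g q \<in> carrier A"
  shows "left_ideal (left_span Q g) A"
proof -
  have g: "(\<lambda>q. b q \<otimes> g q) \<in> Q \<rightarrow> carrier A" if "\<forall>q. b q \<in> carrier A" for b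
    using that assms(2) by auto
  have sub: "left_span Q g \<subseteq> carrier A" using g by (auto simp: left_span_def intro!: finsum_closed)
  have mult: "a \<otimes> v \<in> left_span Q g" if a: "a \<in> carrier A" and v: "v \<in> left_span Q g" for a v
  proof -
    obtain b where b: "\<forall>q. b q \<in> carrier A" "v = (\<Oplus>q\<in>Q. b q \<otimes> g q)" using v by (auto simp: left_span_def)
    have "a \<otimes> v = (\<Oplus>q\<in>Q. a \<otimes> (b q \<otimes> g q))" unfolding b(2) by (rule finsum_rdistr[OF assms(1) a g[OF b(1)]])
    also have "\<dots> = (\<Oplus>q\<in>Q. (a \<otimes> b q) \<otimes> g q)"
      by (rule finsum_cong') (use a b(1) assms(2) in \<open>auto simp: m_assoc\<close>)
    finally show ?thesis using a b(1) unfolding left_span_def by (intro CollectI exI[of _ "\<lambda>q. a \<otimes> b q"]) simp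
  qed
  have add: "v \<oplus> w \<in> left_span Q g" if vw: "v \<in> left_span Q g" "w \<in> left_span Q g" for v w
  proof -
    obtain b c where b: "\<forall>q. b q \<in> carrier A" "v = (\<Oplus>q\<in>Q. b q \<otimes> g q)"
      and c: "\<forall>q. c q \<in> carrier A" "w = (\<Oplus>q\<in>Q. c q \<otimes> g q)" using vw by (auto simp: left_span_def)
    have "v \<oplus> w = (\<Oplus>q\<in>Q. b q \<otimes> g q \<oplus> c q \<otimes> g q)"
      unfolding b(2) c(2) by (rule finsum_addf[OF g[OF b(1)] g[OF c(1)], symmetric])
    also have "\<dots> = (\<Oplus>q\<in>Q. (b q \<oplus> c q) \<otimes> g q)"
      by (rule finsum_cong') (use b(1) c(1) assms(2) in \<open>auto simp: l_distr\<close>)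
    finally show ?thesis using b(1) c(1) unfolding left_span_def by (intro CollectI exI[of _ "\<lambda>q. b q \<oplus> c q"]) simp
  qed
  have neg: "\<ominus> v \<in> left_span Q g" if v: "v \<in> left_span Q g" for v
    using mult[OF a_inv_closed[OF one_closed] v] subsetD[OF sub v] by (simp add: l_minus)
  have "left_span Q g \<noteq> {}" by (auto simp: left_span_def intro: exI[of _ "\<lambda>_. \<one>"])
  then have "additive_subgroup (left_span Q g) A"
    using sub add neg by (intro additive_subgroupI add.subgroupI) auto
  then show ?thesis using mult by (simp add: left_ideal_def)
qed

lemma left_span_mem:
  assumes "finite Q" "\<And>q. q \<in> Q \<Longrightarrow> g q \<in> carrier A" "q \<in> Q" "b \<in> carrier A"
  shows "b \<otimes> g q \<in> left_span Q g"
proof -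
  have "(\<Oplus>p\<in>Q. (if p = q then b else \<zero>) \<otimes> g p) = (if q = q then b else \<zero>) \<otimes> g q"
    by (rule finsum_single) (use assms in auto)
  then show ?thesis using assms(4) unfolding left_span_def
    by (intro CollectI exI[of _ "\<lambda>p. if p = q then b else \<zero>"]) simp
qed

end

context invariant_faces begin

section \<open>Words of one type modulo the arrows\<close>

definition word_tail :: "nat list \<Rightarrow> 'n region \<Rightarrow> 'k" where
  "word_tail c = word_elem c \<otimes> tail_elem (Suc (length c))"

lemma word_tail_closed [simp]: "word_tail c \<in> carrier A"
  by (simp add: word_tail_def)

text \<open>The sum has \<open>Suc n\<close> terms, all congruent to \<open>v\<close>; the common
  length of the words lets one tail serve all of them.\<close>

lemma block_sum_tail:
  assumes L: "left_ideal L A" and v: "v \<in> carrier A"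
    and len: "\<And>i. i \<le> n \<Longrightarrow> length (block_word x y n a b i) = l"
    and cong: "\<And>i. i \<le> n \<Longrightarrow> word_tail (block_word x y n a b i) \<ominus> v \<in> L"
  shows "block_sum x y n a b \<otimes> tail_elem (Suc l) \<ominus> scalar_nat (Suc n) \<odot> v \<in> L"
proof -
  have "block_sum x y n a b \<otimes> tail_elem (Suc l) = (\<Oplus>i\<in>{..n}. word_elem (block_word x y n a b i) \<otimes> tail_elem (Suc l))"
    unfolding block_sum_def by (rule finsum_ldistr) auto
  also have "\<dots> = (\<Oplus>i\<in>{..n}. \<one>\<^bsub>k\<^esub> \<odot> word_tail (block_word x y n a b i))"
    by (rule finsum_cong') (auto simp: word_tail_def len)
  finally have eq: "block_sum x y n a b \<otimes> tail_elem (Suc l) = \<dots>" .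
  have "(\<Oplus>\<^bsub>k\<^esub>i\<in>{..n}. \<one>\<^bsub>k\<^esub>) = scalar_nat (Suc n)"
    using finsum_const_scalar[of "\<one>\<^bsub>k\<^esub>" "{..n}"] by simp
  moreover have "(\<Oplus>i\<in>{..n}. \<one>\<^bsub>k\<^esub> \<odot> word_tail (block_word x y n a b i)) \<ominus> (\<Oplus>\<^bsub>k\<^esub>i\<in>{..n}. \<one>\<^bsub>k\<^esub>) \<odot> v \<in> L"
    by (rule weighted_sum_mod[OF L _ v]) (use cong in auto)
  ultimately show ?thesis unfolding eq by simp
qed

lemma parts_pos: "\<mu> \<in> integer_partitions CARD('n) \<Longrightarrow> e \<in># \<mu> \<Longrightarrow> 0 < e"
  by (simp add: integer_partitions_def)

text \<open>The blocks of equal words collected by the locale \<open>word_connection\<close> produce the multiple \<open>Suc n\<close> of a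
  difference, which can be divided by since \<open>Suc n\<close> divides \<open>fact CARD('n)\<close>.\<close>

lemma word_tail_connected:
  assumes mu: "\<mu> \<in> integer_partitions CARD('n)" and L: "left_ideal L A"
    and rel: "\<And>a b s d. a \<noteq> b \<Longrightarrow> \<mu> = add_mset a (add_mset b s) \<Longrightarrow> mset d = add_mset (a + b) s \<Longrightarrow>
      word_elem d \<otimes> (swap_elem \<mu> a b \<otimes> tail_elem (Suc (size \<mu>))) \<in> L"
    and c: "mset c = \<mu>" "mset c' = \<mu>"
  shows "word_tail c \<ominus> word_tail c' \<in> L"
proof -
  interpret L: additive_subgroup L A by (rule left_idealD(1)[OF L])
  \<comment> \<open>The relation on words is congruence of their \<open>word_tail\<close> modulo
    \<open>L\<close>; only the exchange property is not formal.\<close>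
  interpret word_connection \<mu> "\<lambda>c c'. word_tail c \<ominus> word_tail c' \<in> L"
  proof
    show "0 < e" if "e \<in># \<mu>" for e using parts_pos[OF mu that] .
    show "word_tail c \<ominus> word_tail c \<in> L" for c by (simp add: a_minus_def r_neg)
    show "word_tail c' \<ominus> word_tail c \<in> L" if "word_tail c \<ominus> word_tail c' \<in> L" for c c'
      using L.a_inv_closed[OF that] by (simp add: minus_swap)
    show "word_tail c \<ominus> word_tail c'' \<in> L"
      if "word_tail c \<ominus> word_tail c' \<in> L" "word_tail c' \<ominus> word_tail c'' \<in> L" for c c' c''
      using L.a_closed[OF that] by (simp add: minus_split)
  next
    fix a b x y n
    let ?v1 = "word_tail (x @ [a, b] @ replicate n (a + b) @ y)" and ?v2 = "word_tail (x @ [b, a] @ replicate n (a + b) @ y)"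
    assume ab: "a \<noteq> b" and m: "a + b \<notin> set x" "a + b \<notin> set y"
      and w: "mset (x @ [a, b] @ replicate n (a + b) @ y) = \<mu>"
      and e1: "\<And>i. i \<le> n \<Longrightarrow> word_tail (x @ replicate i (a + b) @ [a, b] @ replicate (n - i) (a + b) @ y) \<ominus> ?v1 \<in> L"
      and e2: "\<And>i. i \<le> n \<Longrightarrow> word_tail (x @ replicate i (a + b) @ [b, a] @ replicate (n - i) (a + b) @ y) \<ominus> ?v2 \<in> L"
    let ?d = "x @ replicate (Suc n) (a + b) @ y" and ?F = "scalar_nat (fact (size \<mu> - 2))" and ?S = "scalar_nat (Suc n)"
    let ?T = "tail_elem (Suc (size \<mu>))" and ?B1 = "block_sum x y n a b" and ?B2 = "block_sum x y n b a"
    have pos: "0 < a" "0 < b" by (rule parts_pos[OF mu], simp add: w[symmetric])+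
    have sz: "size \<mu> = length x + Suc (Suc n) + length y" unfolding w[symmetric] by simp
    have n: "size \<mu> \<le> CARD('n)" using size_parts[OF mu] by simp
    have F: "?F \<noteq> \<zero>\<^bsub>k\<^esub>" by (rule scalar_nat_nonzero, rule fact_dvd) (use n in simp)
    have S: "?S \<noteq> \<zero>\<^bsub>k\<^esub>" by (rule scalar_nat_nonzero, rule dvd_fact) (use n sz in simp_all)
    have "word_elem ?d \<otimes> (swap_elem \<mu> a b \<otimes> ?T) \<in> L"
      by (rule rel[OF ab, of "mset (x @ replicate n (a + b) @ y)"]) (simp_all add: w[symmetric])
    then have "?F \<odot> ((?B1 \<ominus> ?B2) \<otimes> ?T) \<in> L" unfolding word_swap_tail[OF ab pos m w mu] .
    from left_ideal_unit_smult[OF L _ F _ this] have D: "(?B1 \<ominus> ?B2) \<otimes> ?T \<in> L" by simp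
    have B1: "?B1 \<otimes> ?T \<ominus> ?S \<odot> ?v1 \<in> L"
      by (rule block_sum_tail[OF L]) (use e1 sz in \<open>simp_all add: block_word_def\<close>)
    have B2: "?B2 \<otimes> ?T \<ominus> ?S \<odot> ?v2 \<in> L"
      by (rule block_sum_tail[OF L]) (use e2 sz in \<open>simp_all add: block_word_def add.commute[of b a]\<close>)
    \<comment> \<open>The two block sums are \<open>?S\<close> times \<open>?v1\<close> and
      \<open>?v2\<close> modulo \<open>L\<close>, and their difference lies in \<open>L\<close> by
      the relation.\<close>
    have "?S \<odot> (?v1 \<ominus> ?v2) = \<ominus> (?B1 \<otimes> ?T \<ominus> ?S \<odot> ?v1) \<oplus> ((?B1 \<ominus> ?B2) \<otimes> ?T \<oplus> (?B2 \<otimes> ?T \<ominus> ?S \<odot> ?v2))"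
    proof -
      have "(?B1 \<ominus> ?B2) \<otimes> ?T = ?B1 \<otimes> ?T \<ominus> ?B2 \<otimes> ?T" by (simp add: a_minus_def l_distr l_minus)
      moreover have "?S \<odot> (?v1 \<ominus> ?v2) = ?S \<odot> ?v1 \<ominus> ?S \<odot> ?v2"
        by (simp add: a_minus_def smult_r_distr module.smult_r_minus[OF smult_module])
      ultimately show ?thesis
        using minus_split[of "?B1 \<otimes> ?T" "?B2 \<otimes> ?T" "?S \<odot> ?v2"] minus_split[of "?S \<odot> ?v1" "?B1 \<otimes> ?T" "?S \<odot> ?v2"]
          minus_swap[of "?B1 \<otimes> ?T" "?S \<odot> ?v1"] by simp
    qed
    then have "?S \<odot> (?v1 \<ominus> ?v2) \<in> L" using L.a_closed L.a_inv_closed B1 B2 D by simp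
    from left_ideal_unit_smult[OF L _ S _ this] show "?v1 \<ominus> ?v2 \<in> L" by simp
  qed
  show ?thesis by (rule rearrangements_connected[OF c])
qed

text \<open>The characters with \<open>size \<mu>\<close> blocks vanish on the swap element, so the
  product moves into the next step of the filtration, which the tail annihilates.\<close>

lemma filt_mult_swap_tail:
  assumes mu: "\<mu> \<in> integer_partitions CARD('n)" and ab: "a \<noteq> b" and x: "x \<in> filt (size \<mu>)"
  shows "x \<otimes> (swap_elem \<mu> a b \<otimes> tail_elem (Suc (size \<mu>))) = \<zero>"
proof -
  have "x \<otimes> swap_elem \<mu> a b \<in> filt (Suc (size \<mu>))"
  proof (rule filt_Suc[OF filt_mult(1)[OF x swap_elem_closed]])
    fix z :: "'n region" assume z: "z \<in> faces" "nblocks z = size \<mu>"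
    show "(x \<otimes> swap_elem \<mu> a b) z = \<zero>\<^bsub>k\<^esub>"
      unfolding leading_coeff[OF x swap_elem_closed z] psi_swap_elem[OF ab z]
      by (rule k.r_null[OF coeff_closed[OF filt_carrier[OF x] z(1)]])
  qed
  then have "(x \<otimes> swap_elem \<mu> a b) \<otimes> tail_elem (Suc (size \<mu>)) = \<zero>"
    using size_parts[OF mu] by (intro filt_mult_tail) simp_all
  then show ?thesis using x by (simp add: m_assoc)
qed

lemma mult_idem_swap_tail:
  assumes mu: "\<mu> \<in> integer_partitions CARD('n)" and ab: "a \<noteq> b"
    and sz: "size \<mu> = Suc (size \<nu>)" and d: "mset d = \<nu>"
  shows "word_elem d \<otimes> (idem \<nu> \<otimes> (swap_elem \<mu> a b \<otimes> tail_elem (Suc (size \<mu>))))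
    = word_elem d \<otimes> (swap_elem \<mu> a b \<otimes> tail_elem (Suc (size \<mu>)))"
proof -
  let ?r = "swap_elem \<mu> a b \<otimes> tail_elem (Suc (size \<mu>))"
  note n = size_parts[OF mu]
  have "(tail_elem (size \<mu>) \<ominus> \<one>) \<otimes> ?r = \<zero>"
    by (rule filt_mult_swap_tail[OF mu ab tail_elem_minus_one]) (use n in simp)
  from minus_mult_zero_iff[OF _ _ _ this] have t: "tail_elem (size \<mu>) \<otimes> ?r = ?r" by simp
  have wf: "word_elem d \<in> filt (size \<nu>)" using word_elem_filt[of d] d by auto
  have "word_elem d \<otimes> type_elem \<nu> \<ominus> word_elem d \<in> filt (size \<mu>)"
    unfolding sz
  proof (rule minus_filt_Suc[OF filt_mult(1)[OF wf type_elem_closed] wf])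
    fix z :: "'n region" assume z: "z \<in> faces" "nblocks z = size \<nu>"
    show "(word_elem d \<otimes> type_elem \<nu>) z = word_elem d z"
      unfolding leading_coeff[OF wf type_elem_closed z] psi_type_elem[OF z] word_elem_coeff[OF z(1)]
      using d by (auto simp: face_type_def)
  qed
  from filt_mult_swap_tail[OF mu ab this] minus_mult_zero_iff[of "word_elem d \<otimes> type_elem \<nu>" "word_elem d" ?r]
  have "(word_elem d \<otimes> type_elem \<nu>) \<otimes> ?r = word_elem d \<otimes> ?r" by simp
  moreover have "idem \<nu> \<otimes> ?r = type_elem \<nu> \<otimes> ?r"
    using t by (simp add: idem_def m_assoc sz)
  ultimately show ?thesis by (simp add: m_assoc)
qed

text \<open>On faces with \<open>size \<mu>\<close> blocks, \<open>type_elem \<mu>\<close> does not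
  change the swap element, so the swap element times the tail already ends in
  \<open>idem \<mu>\<close>.\<close>

lemma swap_tail_idem:
  assumes mu: "\<mu> \<in> integer_partitions CARD('n)"
  shows "(swap_elem \<mu> a b \<otimes> tail_elem (Suc (size \<mu>))) \<otimes> idem \<mu> = swap_elem \<mu> a b \<otimes> tail_elem (Suc (size \<mu>))"
proof -
  note n = size_parts[OF mu]
  have "(swap_elem \<mu> a b \<otimes> tail_elem (Suc (size \<mu>))) \<otimes> idem \<mu> = (swap_elem \<mu> a b \<otimes> type_elem \<mu>) \<otimes> tail_elem (Suc (size \<mu>))"
    using tail_idem(2)[OF mu, of "Suc (size \<mu>)"] n by (simp add: m_assoc) (simp add: idem_def)
  also have "\<dots> = swap_elem \<mu> a b \<otimes> tail_elem (Suc (size \<mu>))"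
  proof (rule mult_tail_cong)
    show "swap_elem \<mu> a b \<otimes> type_elem \<mu> \<in> filt (size \<mu>)" by (rule filt_mult(1)[OF swap_elem_filt type_elem_closed])
    fix z :: "'n region" assume z: "z \<in> faces" "nblocks z = size \<mu>"
    show "(swap_elem \<mu> a b \<otimes> type_elem \<mu>) z = swap_elem \<mu> a b z"
      unfolding leading_coeff[OF swap_elem_filt type_elem_closed z] psi_type_elem[OF z]
      by (simp add: swap_elem_coeff[OF z(1)])
  qed (use n swap_elem_filt in simp_all)
  finally show ?thesis .
qed

text \<open>Multiplied by the word of type \<nu> with all copies of \<open>a + b\<close> in front,
  the element becomes a nonzero multiple of a difference of block sums times a tail. Its coefficient
  at the word with \<open>a\<close>, \<open>b\<close> in front is one before scaling, since every
  word of the other block sum begins with \<open>b\<close> or \<open>a + b\<close>.\<close>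

lemma idem_swap_tail_nonzero:
  assumes mu: "\<mu> \<in> integer_partitions CARD('n)" and ab: "a \<noteq> b" and s: "\<mu> = add_mset a (add_mset b s)"
  shows "idem (add_mset (a + b) s) \<otimes> (swap_elem \<mu> a b \<otimes> tail_elem (Suc (size \<mu>))) \<noteq> \<zero>"
proof
  let ?T = "tail_elem (Suc (size \<mu>))" and ?F = "scalar_nat (fact (size \<mu> - 2))"
  assume zero: "idem (add_mset (a + b) s) \<otimes> (swap_elem \<mu> a b \<otimes> ?T) = \<zero>"
  have pos: "0 < a" "0 < b" by (rule parts_pos[OF mu], simp add: s)+
  have n: "size \<mu> \<le> CARD('n)" using size_parts[OF mu] by simp
  have F: "?F \<noteq> \<zero>\<^bsub>k\<^esub>" by (rule scalar_nat_nonzero, rule fact_dvd) (use n in simp)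
  obtain y where y: "mset y = filter_mset (\<lambda>e. e \<noteq> a + b) s" using ex_mset by blast
  define p where "p = count s (a + b)"
  let ?D = "block_sum [] y p a b \<ominus> block_sum [] y p b a"
  have notin: "a + b \<notin> set []" "a + b \<notin> set y" using arg_cong[OF y, of set_mset] by auto
  have sum: "mset (replicate p (a + b) @ y) = s"
    by (rule multiset_eqI) (auto simp: y p_def)
  have w: "mset ([] @ [a, b] @ replicate p (a + b) @ y) = \<mu>" using sum by (simp add: s)
  have d: "mset ([] @ replicate (Suc p) (a + b) @ y) = add_mset (a + b) s" using sum by simp
  have "?F \<odot> (?D \<otimes> ?T) = \<zero>"
    unfolding word_swap_tail[OF ab pos notin w mu, symmetric]
    using mult_idem_swap_tail[OF mu ab _ d] zero by (simp add: s)
  moreover have "left_ideal {\<zero>} A"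
    using additive_subgroupI[OF add.triv_subgroup] by (auto simp: left_ideal_def)
  ultimately have "?D \<otimes> ?T = \<zero>"
    using left_ideal_unit_smult[of "{\<zero>}" ?F "?D \<otimes> ?T"] F by simp
  moreover obtain z :: "'n region" where z: "z \<in> faces" "composition z = [] @ [a, b] @ replicate p (a + b) @ y"
    by (rule parts_face[of "[] @ [a, b] @ replicate p (a + b) @ y"]) (use mu w in simp, blast)
  have nz: "nblocks z = size \<mu>" using size_face_type[of z] unfolding face_type_def z(2) w by simp
  have len: "length (block_word [] y p a b i) = size \<mu>" "length (block_word [] y p b a i) = size \<mu>" if "i \<le> p" for i
    using that arg_cong[OF w, of size] by (simp_all add: block_word_def)
  have "?D \<in> filt (size \<mu>)" by (intro filt_minus block_sum_filt pos len)
  from leading_coeff[OF this tail_elem_closed z(1) nz] have "(?D \<otimes> ?T) z = ?D z"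
    using psi_tail[OF z(1), of "Suc (size \<mu>)"] nz n coeff_closed[OF _ z(1), of ?D] by simp
  moreover have "?D z = \<one>\<^bsub>k\<^esub>"
  proof -
    have 1: "\<exists>i \<le> p. composition z = block_word [] y p a b i"
      unfolding z(2) block_word_def by (rule exI[of _ 0]) simp
    have 2: "\<not> (\<exists>i \<le> p. composition z = block_word [] y p b a i)"
    proof
      assume "\<exists>i \<le> p. composition z = block_word [] y p b a i"
      then obtain i where "[a, b] @ replicate p (a + b) @ y = replicate i (b + a) @ [b, a] @ replicate (p - i) (b + a) @ y"
        unfolding z(2) block_word_def by auto
      then show False using ab pos by (cases i) auto
    qed
    show ?thesis
      unfolding coeff_minus[OF block_sum_closed block_sum_closed z(1)] block_sum_coeff[OF z(1) pos]
        block_sum_coeff[OF z(1) pos(2,1)] if_P[OF 1] if_not_P[OF 2] by (simp add: k.minus_eq)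
  qed
  ultimately show False using coeff_simps(2)[OF z(1)] by simp
qed

end

context invariant_faces begin

section \<open>Expansions in words and the arrows as generators\<close>

lemma psi_finsum:
  assumes "finite S" "\<And>s. s \<in> S \<Longrightarrow> f s \<in> carrier A" "\<And>s. s \<in> S \<Longrightarrow> psi z (f s) = \<zero>\<^bsub>k\<^esub>"
  shows "psi z (\<Oplus>s\<in>S. f s) = \<zero>\<^bsub>k\<^esub>"
  using assms
proof (induction S rule: finite_induct)
  case empty
  show ?case unfolding finsum_empty psi_def by (rule k.add.finprod_one_eqI) simp
next
  case (insert s S)
  have cl: "f s \<in> carrier A" "(\<Oplus>s\<in>S. f s) \<in> carrier A" using insert.prems by (auto intro!: finsum_closed)
  have "(\<Oplus>s\<in>insert s S. f s) = f s \<oplus> (\<Oplus>s\<in>S. f s)"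
    by (rule finsum_insert) (use insert in auto)
  moreover have "psi z (\<Oplus>s\<in>S. f s) = \<zero>\<^bsub>k\<^esub>" using insert.prems by (intro insert.IH) auto
  ultimately show ?case using psi_add[OF cl] insert.prems(2)[of s] by simp
qed

definition coeff_at :: "('n region \<Rightarrow> 'k) \<Rightarrow> nat list \<Rightarrow> 'k" where
  "coeff_at a c = (if \<exists>z :: 'n region. z \<in> faces \<and> composition z = c then a (SOME z. z \<in> faces \<and> composition z = c) else \<zero>\<^bsub>k\<^esub>)"

lemma coeff_at:
  assumes a: "a \<in> carrier A"
  shows coeff_at_closed: "coeff_at a c \<in> carrier k"
    and coeff_at_composition: "z \<in> faces \<Longrightarrow> coeff_at a (composition z) = a z"
proof -
  have some: "(SOME z :: 'n region. z \<in> faces \<and> composition z = c) \<in> faces \<and> composition (SOME z :: 'n region. z \<in> faces \<and> composition z = c) = c"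
    if "\<exists>z :: 'n region. z \<in> faces \<and> composition z = c" for c
    using that by (rule someI_ex)
  show "coeff_at a c \<in> carrier k"
    using some[of c] coeff_closed[OF a] by (auto simp: coeff_at_def)
  show "coeff_at a (composition z) = a z" if z: "z \<in> faces"
  proof -
    have ex: "\<exists>u :: 'n region. u \<in> faces \<and> composition u = composition z" using z by blast
    show ?thesis unfolding coeff_at_def if_P[OF ex]
      using some[OF ex] z by (intro coeff_composition[OF a]) blast+
  qed
qed

lemma word_elem_sum_coeff:
  assumes S: "finite S" and g: "\<And>c. g c \<in> carrier k" and z: "z \<in> faces"
  shows "(\<Oplus>c\<in>S. g c \<odot> word_elem c) z = (if composition z \<in> S then g (composition z) else \<zero>\<^bsub>k\<^esub>)"
proof -
  have eq: "(\<Oplus>c\<in>S. g c \<odot> word_elem c) z = (\<Oplus>\<^bsub>k\<^esub>c\<in>S. (g c \<odot> word_elem c) z)"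
    by (rule coeff_finsum[OF S _ z]) (use g in simp)
  have zero: "(g c \<odot> word_elem c) z = \<zero>\<^bsub>k\<^esub>" if "c \<noteq> composition z" for c
    using that g z by (simp add: word_elem_coeff)
  have self: "(g (composition z) \<odot> word_elem (composition z)) z = g (composition z)"
    using g z by (simp add: word_elem_coeff)
  show ?thesis
  proof (cases "composition z \<in> S")
    case True
    have "(\<Oplus>\<^bsub>k\<^esub>c\<in>S. (g c \<odot> word_elem c) z) = (g (composition z) \<odot> word_elem (composition z)) z"
      by (rule k.finsum_single[OF S True]) (use self g zero in auto)
    then show ?thesis unfolding eq self if_P[OF True] .
  next
    case False
    have "(\<Oplus>\<^bsub>k\<^esub>c\<in>S. (g c \<odot> word_elem c) z) = \<zero>\<^bsub>k\<^esub>"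
    proof (rule k.add.finprod_one_eqI)
      fix c assume "c \<in> S"
      then have "c \<noteq> composition z" using False by blast
      then show "(g c \<odot> word_elem c) z = \<zero>\<^bsub>k\<^esub>" by (rule zero)
    qed
    then show ?thesis unfolding eq if_not_P[OF False] .
  qed
qed

lemma finite_dimension_invariants: "finite_dimension (scalars k A) (carrier A)"
proof -
  have "finite (composition ` (faces :: 'n region set))" by simp
  then obtain cs where cs: "set cs = composition ` (faces :: 'n region set)" using finite_list by blast
  let ?Us = "map word_elem cs"
  have Us: "set ?Us \<subseteq> carrier A" by auto
  have sf: "subfield (scalars k A) A"
    unfolding scalars_def
  proof (rule ring_hom_ring.img_is_subfield(2)[OF scalar_ring_hom k.carrier_is_subfield])
    show "\<one> \<noteq> \<zero>"
    proof
      assume "\<one> = \<zero>"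
      then have "\<one> (face_one :: 'n region) = \<zero> (face_one :: 'n region)" by (rule arg_cong)
      then show False using coeff_simps(2,4)[OF face_one(1)] by simp
    qed
  qed
  note span = Span_subgroup_props[OF sf Us]
  have "a \<in> Span (scalars k A) ?Us" if a: "a \<in> carrier A" for a
  proof -
    note cl = coeff_at_closed[OF a]
    have mem: "coeff_at a c \<odot> word_elem c \<in> Span (scalars k A) ?Us" if "c \<in> set cs" for c
    proof -
      have "(coeff_at a c \<odot> \<one>) \<otimes> word_elem c \<in> Span (scalars k A) ?Us"
      proof (rule Span_smult_closed[OF sf Us])
        show "coeff_at a c \<odot> \<one> \<in> scalars k A" using cl by (simp add: scalars_def)
        show "word_elem c \<in> Span (scalars k A) ?Us"
          by (rule subsetD[OF Span_base_incl[OF sf Us]]) (use that in simp)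
      qed
      then show ?thesis by (simp add: scalar_mult cl)
    qed
    have sum: "(\<Oplus>c\<in>S. coeff_at a c \<odot> word_elem c) \<in> Span (scalars k A) ?Us"
      if "finite S" "S \<subseteq> set cs" for S
      using that
    proof (induction S rule: finite_induct)
      case empty
      then show ?case using span(2) by simp
    next
      case (insert c S)
      have "(\<Oplus>c\<in>insert c S. coeff_at a c \<odot> word_elem c) = coeff_at a c \<odot> word_elem c \<oplus> (\<Oplus>c\<in>S. coeff_at a c \<odot> word_elem c)"
        by (rule finsum_insert) (use insert.hyps cl in auto)
      then show ?case using insert span(3) mem by simp
    qed
    have "a = (\<Oplus>c\<in>set cs. coeff_at a c \<odot> word_elem c)"
    proof (rule coeff_eqI[OF a])
      show "(\<Oplus>c\<in>set cs. coeff_at a c \<odot> word_elem c) \<in> carrier A" by (rule finsum_closed) (use cl in simp)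
      fix z :: "'n region" assume z: "z \<in> faces"
      then have "composition z \<in> set cs" using cs by blast
      then show "a z = (\<Oplus>c\<in>set cs. coeff_at a c \<odot> word_elem c) z"
        unfolding word_elem_sum_coeff[OF finite_set cl z] using coeff_at_composition[OF a z] by simp
    qed
    then show ?thesis using sum[OF finite_set subset_refl] by simp
  qed
  then have "carrier A = Span (scalars k A) ?Us" using span(1) by blast
  then show ?thesis using Span_finite_dimension[OF sf Us] by simp
qed

text \<open>The ends determine the pair \<open>a\<close>, \<open>b\<close> only up to order, so a
  choice is made; it affects the sign alone.\<close>

definition arrow_elem :: "nat multiset \<Rightarrow> nat multiset \<Rightarrow> 'n region \<Rightarrow> 'k" where
  "arrow_elem \<mu> \<nu> = (SOME r. \<exists>a b s. a \<noteq> b \<and> \<mu> = add_mset a (add_mset b s) \<and> \<nu> = add_mset (a + b) s \<and>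
    r = idem \<nu> \<otimes> (swap_elem \<mu> a b \<otimes> tail_elem (Suc (size \<mu>))))"

lemma arrow_elemE:
  assumes "adds_two_distinct \<mu> \<nu>"
  obtains a b s where "a \<noteq> b" "\<mu> = add_mset a (add_mset b s)" "\<nu> = add_mset (a + b) s"
    "arrow_elem \<mu> \<nu> = idem \<nu> \<otimes> (swap_elem \<mu> a b \<otimes> tail_elem (Suc (size \<mu>)))"
proof -
  have "\<exists>r a b s. a \<noteq> b \<and> \<mu> = add_mset a (add_mset b s) \<and> \<nu> = add_mset (a + b) s \<and>
    r = idem \<nu> \<otimes> (swap_elem \<mu> a b \<otimes> tail_elem (Suc (size \<mu>)))"
    using assms unfolding adds_two_distinct_def by blast
  from someI_ex[OF this] show thesis using that unfolding arrow_elem_def by blast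
qed

lemma arrow_elem_closed [simp]: "adds_two_distinct \<mu> \<nu> \<Longrightarrow> arrow_elem \<mu> \<nu> \<in> carrier A"
  by (elim arrow_elemE) simp

text \<open>Exchanging \<open>a\<close> and \<open>b\<close> negates the swap element, and by
  \<open>adds_two_distinct_unique\<close> no other freedom exists.\<close>

lemma arrow_elem_sign:
  assumes mu: "\<mu> \<in> integer_partitions CARD('n)" and ab: "a \<noteq> b"
    and s: "\<mu> = add_mset a (add_mset b s)" "\<nu> = add_mset (a + b) s"
  shows "idem \<nu> \<otimes> (swap_elem \<mu> a b \<otimes> tail_elem (Suc (size \<mu>))) \<in> {arrow_elem \<mu> \<nu>, \<ominus> arrow_elem \<mu> \<nu>}"
proof -
  have "adds_two_distinct \<mu> \<nu>" using ab s unfolding adds_two_distinct_def by blast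
  then obtain a' b' s' where *: "a' \<noteq> b'" "\<mu> = add_mset a' (add_mset b' s')" "\<nu> = add_mset (a' + b') s'"
    "arrow_elem \<mu> \<nu> = idem \<nu> \<otimes> (swap_elem \<mu> a' b' \<otimes> tail_elem (Suc (size \<mu>)))" by (rule arrow_elemE)
  have pos: "0 < a" "0 < b" by (rule parts_pos[OF mu], simp add: s(1))+
  have e: "add_mset a (add_mset b s) = add_mset a' (add_mset b' s')" "add_mset (a + b) s = add_mset (a' + b') s'"
    using s *(2,3) by (simp_all only:)
  from adds_two_distinct_unique[OF e pos] show ?thesis
  proof
    assume "a' = a \<and> b' = b"
    then show ?thesis unfolding *(4) by simp
  next
    assume "a' = b \<and> b' = a"
    then have "arrow_elem \<mu> \<nu> = idem \<nu> \<otimes> (\<ominus> swap_elem \<mu> a b \<otimes> tail_elem (Suc (size \<mu>)))"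
      unfolding *(4) by (simp only: swap_elem_commute[OF ab])
    then have "idem \<nu> \<otimes> (swap_elem \<mu> a b \<otimes> tail_elem (Suc (size \<mu>))) = \<ominus> arrow_elem \<mu> \<nu>"
      by (simp add: l_minus r_minus)
    then show ?thesis by simp
  qed
qed

lemma adds_two_distinct_parts:
  assumes "adds_two_distinct \<mu> \<nu>" "\<mu> \<in> integer_partitions m"
  shows "\<nu> \<in> integer_partitions m"
  using assms by (auto simp: adds_two_distinct_def integer_partitions_def)

lemma adds_two_distinct_size: "adds_two_distinct \<mu> \<nu> \<Longrightarrow> size \<mu> = Suc (size \<nu>)"
  by (auto simp: adds_two_distinct_def)

text \<open>In front of the tail, \<open>a \<otimes> type_elem \<mu>\<close> counts only through its
  coefficients at words of type \<mu>, by \<open>mult_other_type\<close>. This writes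
  \<open>a \<otimes> idem \<mu>\<close> as a combination of elements that are all congruent to
  \<open>v\<close>.\<close>

lemma word_expansion:
  assumes mu: "\<mu> \<in> integer_partitions CARD('n)" and L: "left_ideal L A" and a: "a \<in> carrier A"
    and cong: "\<And>c. mset c = \<mu> \<Longrightarrow> word_tail c \<ominus> v \<in> L" and v: "v \<in> carrier A"
  shows "\<exists>\<kappa> \<in> carrier k. a \<otimes> idem \<mu> \<ominus> \<kappa> \<odot> v \<in> L"
proof -
  let ?S = "{c. mset c = \<mu>}" and ?T = "tail_elem (Suc (size \<mu>))"
  define w where "w = a \<otimes> type_elem \<mu>"
  have w: "w \<in> carrier A" "w \<in> filt (size \<mu>)"
    using a filt_mult(2)[OF type_elem_filt a] by (simp_all add: w_def)
  note cl = coeff_at_closed[OF w(1)]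
  have fin: "finite ?S" using finite_permutations_of_multiset[of \<mu>] by (simp add: permutations_of_multiset_def)
  have "w \<otimes> ?T = (\<Oplus>c\<in>?S. coeff_at w c \<odot> word_elem c) \<otimes> ?T"
  proof (rule mult_tail_cong)
    show "size \<mu> \<le> CARD('n)" using size_parts[OF mu] by simp
    show "w \<in> filt (size \<mu>)" by (rule w(2))
    have sum: "(\<Oplus>c\<in>?S. coeff_at w c \<odot> word_elem c) z = (if face_type z = \<mu> then w z else \<zero>\<^bsub>k\<^esub>)" if "z \<in> faces" for z
      unfolding word_elem_sum_coeff[OF fin cl that] coeff_at_composition[OF w(1) that] face_type_def by simp
    show "(\<Oplus>c\<in>?S. coeff_at w c \<odot> word_elem c) \<in> filt (size \<mu>)"
    proof (rule filtI)
      show "(\<Oplus>c\<in>?S. coeff_at w c \<odot> word_elem c) \<in> carrier A" by (rule finsum_closed) (use cl in simp)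
      fix z :: "'n region" assume z: "z \<in> faces" "nblocks z < size \<mu>"
      then have "face_type z \<noteq> \<mu>" using size_face_type[of z] by auto
      then show "(\<Oplus>c\<in>?S. coeff_at w c \<odot> word_elem c) z = \<zero>\<^bsub>k\<^esub>" unfolding sum[OF z(1)] by (rule if_not_P)
    qed
    fix z :: "'n region" assume z: "z \<in> faces" "nblocks z = size \<mu>"
    show "w z = (\<Oplus>c\<in>?S. coeff_at w c \<odot> word_elem c) z"
    proof (cases "face_type z = \<mu>")
      case False
      have "w z = \<zero>\<^bsub>k\<^esub>" unfolding w_def
        by (rule mult_other_type[OF a type_elem_closed _ z(1) _ False]) (use z(2) in \<open>simp_all add: type_elem_coeff\<close>)
      then show ?thesis unfolding sum[OF z(1)] if_not_P[OF False] .
    qed (simp add: sum[OF z(1)])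
  qed
  also have "\<dots> = (\<Oplus>c\<in>?S. (coeff_at w c \<odot> word_elem c) \<otimes> ?T)"
    by (rule finsum_ldistr[OF fin]) (use cl in auto)
  also have "\<dots> = (\<Oplus>c\<in>?S. coeff_at w c \<odot> word_tail c)"
  proof (rule finsum_cong'[OF refl])
    show "(\<lambda>c. coeff_at w c \<odot> word_tail c) \<in> ?S \<rightarrow> carrier A" using cl by simp
    fix c assume "c \<in> ?S"
    then have "length c = size \<mu>" by auto
    then show "(coeff_at w c \<odot> word_elem c) \<otimes> ?T = coeff_at w c \<odot> word_tail c"
      by (simp add: word_tail_def smult_mult_left cl)
  qed
  finally have eq: "a \<otimes> idem \<mu> = (\<Oplus>c\<in>?S. coeff_at w c \<odot> word_tail c)"
    using a by (simp add: idem_def w_def m_assoc)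
  have "(\<Oplus>c\<in>?S. coeff_at w c \<odot> word_tail c) \<ominus> (\<Oplus>\<^bsub>k\<^esub>c\<in>?S. coeff_at w c) \<odot> v \<in> L"
    by (rule weighted_sum_mod[OF L fin v]) (use cl cong in simp_all)
  moreover have "(\<Oplus>\<^bsub>k\<^esub>c\<in>?S. coeff_at w c) \<in> carrier k" by (rule k.finsum_closed) (use cl in simp)
  ultimately show ?thesis unfolding eq by blast
qed

lemma type_char_hom:
  assumes "\<mu> \<in> integer_partitions CARD('n)" "a \<in> carrier A" "b \<in> carrier A"
  shows "type_char \<mu> (a \<otimes> b) = type_char \<mu> a \<otimes>\<^bsub>k\<^esub> type_char \<mu> b"
  unfolding type_char_def by (rule psi_mult[OF assms(2,3) type_rep(1)[OF assms(1)]])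

lemma type_char_closed: "a \<in> carrier A \<Longrightarrow> type_char \<mu> a \<in> carrier k"
  by (simp add: type_char_def)

text \<open>Modulo the left ideal of the arrows, \<open>a \<otimes> idem \<mu>\<close> is a multiple
  of a single word. The character vanishes on the arrows, because they begin with idempotents of
  other types, and not on the word; so it detects the multiple.\<close>

lemma char_kernel_generated:
  assumes a: "a \<in> carrier A" and ker: "type_char \<mu> a = \<zero>\<^bsub>k\<^esub>" and mu: "\<mu> \<in> integer_partitions CARD('n)"
  shows "a \<otimes> idem \<mu> \<in> left_span {\<nu> \<in> integer_partitions CARD('n). adds_two_distinct \<mu> \<nu>} (arrow_elem \<mu>)"
proof -
  let ?Q = "{\<nu> \<in> integer_partitions CARD('n). adds_two_distinct \<mu> \<nu>}"
  let ?L = "left_span ?Q (arrow_elem \<mu>)"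
  have Q: "finite ?Q" "\<And>\<nu>. \<nu> \<in> ?Q \<Longrightarrow> arrow_elem \<mu> \<nu> \<in> carrier A" by simp_all
  have L: "left_ideal ?L A" by (rule left_span_left_ideal[OF Q])
  have rel: "word_elem d \<otimes> (swap_elem \<mu> a b \<otimes> tail_elem (Suc (size \<mu>))) \<in> ?L"
    if ab: "a \<noteq> b" and s: "\<mu> = add_mset a (add_mset b s)" and d: "mset d = add_mset (a + b) s" for a b s d
  proof -
    let ?r = "swap_elem \<mu> a b \<otimes> tail_elem (Suc (size \<mu>))" and ?\<nu> = "add_mset (a + b) s"
    have adj: "adds_two_distinct \<mu> ?\<nu>" using ab s unfolding adds_two_distinct_def by blast
    have nuQ: "?\<nu> \<in> ?Q" using adj adds_two_distinct_parts[OF adj mu] by simp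
    have eq: "word_elem d \<otimes> (idem ?\<nu> \<otimes> ?r) = word_elem d \<otimes> ?r"
      by (rule mult_idem_swap_tail[OF mu ab adds_two_distinct_size[OF adj] d])
    have r: "arrow_elem \<mu> ?\<nu> \<in> carrier A" using adj by simp
    have "word_elem d \<otimes> (idem ?\<nu> \<otimes> ?r) \<in> ?L"
      using arrow_elem_sign[OF mu ab s refl]
    proof (elim insertE emptyE)
      assume e: "idem ?\<nu> \<otimes> ?r = arrow_elem \<mu> ?\<nu>"
      show ?thesis unfolding e by (rule left_span_mem[OF Q nuQ word_elem_closed])
    next
      assume e: "idem ?\<nu> \<otimes> ?r = \<ominus> arrow_elem \<mu> ?\<nu>"
      have "(\<ominus> word_elem d) \<otimes> arrow_elem \<mu> ?\<nu> \<in> ?L" by (rule left_span_mem[OF Q nuQ a_inv_closed[OF word_elem_closed]])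
      then show ?thesis unfolding e using r by (simp add: l_minus r_minus)
    qed
    then show ?thesis unfolding eq .
  qed
  obtain c0 where c0: "mset c0 = \<mu>" using ex_mset by blast
  let ?v = "word_tail c0"
  have cong: "word_tail c \<ominus> ?v \<in> ?L" if "mset c = \<mu>" for c
    by (rule word_tail_connected[OF mu L rel that c0])
  have vanish: "type_char \<mu> x = \<zero>\<^bsub>k\<^esub>" if "x \<in> ?L" for x
  proof -
    obtain b where b: "\<forall>q. b q \<in> carrier A" "x = (\<Oplus>q\<in>?Q. b q \<otimes> arrow_elem \<mu> q)"
      using \<open>x \<in> ?L\<close> by (auto simp: left_span_def)
    have "type_char \<mu> (b q \<otimes> arrow_elem \<mu> q) = \<zero>\<^bsub>k\<^esub>" if "q \<in> ?Q" for q
    proof -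
      have q: "q \<in> integer_partitions CARD('n)" "adds_two_distinct \<mu> q" using that by auto
      obtain a' b' s' where e: "arrow_elem \<mu> q = idem q \<otimes> (swap_elem \<mu> a' b' \<otimes> tail_elem (Suc (size \<mu>)))"
        using q(2) by (rule arrow_elemE)
      have "\<mu> \<noteq> q" using adds_two_distinct_size[OF q(2)] by auto
      then have "type_char \<mu> (idem q) = \<zero>\<^bsub>k\<^esub>" using type_char_idem[OF mu q(1)] by simp
      then have "type_char \<mu> (arrow_elem \<mu> q) = \<zero>\<^bsub>k\<^esub>"
        unfolding e by (subst type_char_hom[OF mu]) (simp_all add: type_char_closed)
      then show ?thesis using b(1) q(2) by (subst type_char_hom[OF mu]) (simp_all add: type_char_closed)
    qed
    then show ?thesis unfolding b(2) type_char_def using b(1) by (intro psi_finsum) simp_all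
  qed
  have expand: "\<exists>\<kappa> \<in> carrier k. x \<otimes> idem \<mu> \<ominus> \<kappa> \<odot> ?v \<in> ?L \<and> type_char \<mu> x = \<kappa> \<otimes>\<^bsub>k\<^esub> type_char \<mu> ?v"
    if x: "x \<in> carrier A" for x
  proof -
    obtain \<kappa> where \<kappa>: "\<kappa> \<in> carrier k" "x \<otimes> idem \<mu> \<ominus> \<kappa> \<odot> ?v \<in> ?L"
      using word_expansion[OF mu L x cong word_tail_closed] by blast
    have "x \<otimes> idem \<mu> = (x \<otimes> idem \<mu> \<ominus> \<kappa> \<odot> ?v) \<oplus> \<kappa> \<odot> ?v"
      using x \<kappa>(1) by (simp add: a_minus_def a_assoc l_neg)
    then have "type_char \<mu> (x \<otimes> idem \<mu>) = type_char \<mu> (x \<otimes> idem \<mu> \<ominus> \<kappa> \<odot> ?v) \<oplus>\<^bsub>k\<^esub> type_char \<mu> (\<kappa> \<odot> ?v)"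
      using x \<kappa>(1) psi_add[of "x \<otimes> idem \<mu> \<ominus> \<kappa> \<odot> ?v" "\<kappa> \<odot> ?v"] unfolding type_char_def by simp
    then have "type_char \<mu> (x \<otimes> idem \<mu>) = \<kappa> \<otimes>\<^bsub>k\<^esub> type_char \<mu> ?v"
      unfolding vanish[OF \<kappa>(2)] using \<kappa>(1) by (simp add: type_char_def psi_smult)
    then have "type_char \<mu> x = \<kappa> \<otimes>\<^bsub>k\<^esub> type_char \<mu> ?v"
      using type_char_hom[OF mu x idem_closed] type_char_idem[OF mu mu] type_char_closed[OF x] by simp
    then show ?thesis using \<kappa> by blast
  qed
  \<comment> \<open>Otherwise the expansion would make the character vanish everywhere, also on
    \<open>idem \<mu>\<close>.\<close>
  have "type_char \<mu> ?v \<noteq> \<zero>\<^bsub>k\<^esub>"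
  proof
    assume "type_char \<mu> ?v = \<zero>\<^bsub>k\<^esub>"
    then have "type_char \<mu> (idem \<mu>) = \<zero>\<^bsub>k\<^esub>" using expand[OF idem_closed] by auto
    then show False using type_char_idem[OF mu mu] by simp
  qed
  moreover obtain \<kappa> where \<kappa>: "\<kappa> \<in> carrier k" "a \<otimes> idem \<mu> \<ominus> \<kappa> \<odot> ?v \<in> ?L" "\<zero>\<^bsub>k\<^esub> = \<kappa> \<otimes>\<^bsub>k\<^esub> type_char \<mu> ?v"
    using expand[OF a] unfolding ker by blast
  ultimately have "\<kappa> = \<zero>\<^bsub>k\<^esub>"
    using k.integral[of \<kappa> "type_char \<mu> ?v"] type_char_closed[OF word_tail_closed] by auto
  then show ?thesis using \<kappa>(2) a by (simp add: a_minus_def)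
qed

section \<open>The quiver of the invariants\<close>

theorem has_quiver_partitions: "has_quiver k A (partition_quiver CARD('n))"
proof -
  interpret quiver_data k A "integer_partitions CARD('n)" type_char idem size adds_two_distinct arrow_elem
  proof
    fix p q assume pq: "p \<in> integer_partitions CARD('n)" "q \<in> integer_partitions CARD('n)"
    show "type_char p (idem q) = (if p = q then \<one>\<^bsub>k\<^esub> else \<zero>\<^bsub>k\<^esub>)" by (rule type_char_idem[OF pq])
    show "idem p \<otimes> idem q = (if p = q then idem p else \<zero>)" by (rule idem_mult[OF pq])
  next
    fix p c a assume "p \<in> integer_partitions CARD('n)" "c \<in> carrier k" "a \<in> carrier A"
    then show "type_char p (c \<odot> a) = c \<otimes>\<^bsub>k\<^esub> type_char p a" by (simp add: type_char_def psi_smult)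
  next
    fix p assume "p \<in> integer_partitions CARD('n)"
    then show "type_char p \<in> ring_hom A k" unfolding type_char_def by (intro psi_ring_hom type_rep)
  next
    fix a p assume a: "a \<in> carrier A" "\<And>p. p \<in> integer_partitions CARD('n) \<Longrightarrow> type_char p a = \<zero>\<^bsub>k\<^esub>"
      and p: "p \<in> integer_partitions CARD('n)"
    show "\<exists>b. (\<forall>q. b q \<in> carrier A) \<and>
        a \<otimes> idem p = (\<Oplus>q\<in>{q \<in> integer_partitions CARD('n). adds_two_distinct p q}. b q \<otimes> arrow_elem p q)"
      using char_kernel_generated[OF a(1) a(2)[OF p] p] unfolding left_span_def by blast
  next
    fix p q assume p: "p \<in> integer_partitions CARD('n)" and q: "q \<in> integer_partitions CARD('n)"
      and adj: "adds_two_distinct p q"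
    obtain a b s where e: "a \<noteq> b" "p = add_mset a (add_mset b s)" "q = add_mset (a + b) s"
      "arrow_elem p q = idem q \<otimes> (swap_elem p a b \<otimes> tail_elem (Suc (size p)))"
      using adj by (rule arrow_elemE)
    show "arrow_elem p q \<noteq> \<zero>" using idem_swap_tail_nonzero[OF p e(1,2)] unfolding e(4) e(3)[symmetric] .
    show "idem q \<otimes> arrow_elem p q = arrow_elem p q"
    proof -
      have "idem q \<otimes> arrow_elem p q = (idem q \<otimes> idem q) \<otimes> (swap_elem p a b \<otimes> tail_elem (Suc (size p)))"
        unfolding e(4) by (rule m_assoc[symmetric]) simp_all
      then show ?thesis unfolding idem_mult[OF q q] e(4) by simp
    qed
    show "arrow_elem p q \<otimes> idem p = arrow_elem p q"
    proof -
      have "arrow_elem p q \<otimes> idem p = idem q \<otimes> ((swap_elem p a b \<otimes> tail_elem (Suc (size p))) \<otimes> idem p)"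
        unfolding e(4) by (rule m_assoc) simp_all
      then show ?thesis unfolding swap_tail_idem[OF p] e(4) .
    qed
  qed (simp_all add: sum_idem adds_two_distinct_size)
  show ?thesis using has_quiver_data[OF finite_dimension_invariants] by (simp only: partition_quiver_def)
qed

end

theorem theorem8p1:
  fixes k :: "('k, 'm) ring_scheme"
  assumes "field k"
    and "\<not> ring_characteristic k dvd fact CARD('n::{finite,linorder})"
  shows "has_quiver k (invariant_face_algebra k :: ('k, (real ^ 'n::{finite,linorder}) set \<Rightarrow> 'k) module)
    (partition_quiver CARD('n))"
  by (rule invariant_faces.has_quiver_partitions) (intro invariant_faces.intro invariant_faces_axioms.intro assms refl)

end
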